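(* Let $\mathcal X$ and $\mathcal Y$ be two compact sets of $\mathbb R^d$, let the cost $c$ be $C^\infty$, and let $s\ge1$ be an integer. Then the Sinkhorn potentials $(u,v)$ are uniformly bounded in the Sobolev space $\mathbf H^s(\mathbb R^d)$ (regardless of the probability measures $\alpha$ on $\mathcal X$ and $\beta$ on $\mathcal Y$), and their norms satisfy $$\|u\|_{\mathbf H^s}=O\left(1+\frac1{\varepsilon^{s-1}}\right)\quad\text{and}\quad \|v\|_{\mathbf H^s}=O\left(1+\frac1{\varepsilon^{s-1}}\right),$$ with constants that only depend on $|\mathcal X|$ (or $|\mathcal Y|$ for $v$), $d$, and $\|c^{(k)}\|_\infty$ for $k=0,\dots,s$. In particular, $\|u\|_{\mathbf H^s}=O(1)$ as $\varepsilon\to+\infty$ and $\|u\|_{\mathbf H^s}=O\left(\frac1{\varepsilon^{s-1}}\right)$ as $\varepsilon\to0$.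
   Context: $|\mathcal X|=\sup\{\|x-x'\|:x,x'\in\mathcal X\}$ is the diameter of $\mathcal X$ (similarly for $\mathcal Y$). $\|c^{(k)}\|_\infty$ denotes the sup norm of the derivatives of order $k$ of $c$. The notation $\phi=O(1+x^k)$ means that $\phi$ is bounded by a polynomial of order $k$ in $x$ with positive coefficients; here $x=1/\varepsilon$ and $k=s-1$. For probability measures $\alpha$ on $\mathcal X$ and $\beta$ on $\mathcal Y$ and $\varepsilon>0$, the dual formulation of entropy-regularized optimal transport is $$W_\varepsilon(\alpha,\beta)=\max_{u\in C(\mathcal X),\,v\in C(\mathcal Y)}\int_{\mathcal X} u\,d\alpha+\int_{\mathcal Y} v\,d\beta-\varepsilon\int_{\mathcal X\times\mathcal Y} e^{\frac{u(x)+v(y)-c(x,y)}{\varepsilon}}d\alpha(x)d\beta(y)+\varepsilon.$$ The Sinkhorn potentials $(u,v)$ are the optimal dual potentials, i.e. maximizers of this problem; they are unique $\alpha$- and $\beta$-a.e. up to an additive constant, and satisfy the optimality condition $e^{-u(x)/\varepsilon}=\int e^{(v(y)-c(x,y))/\varepsilon}d\beta(y)$ for $x\in\mathcal X$, and symmetrically $e^{-v(y)/\varepsilon}=\int e^{(u(x)-c(x,y))/\varepsilon}d\alpha(x)$ for $y\in\mathcal Y$. Being defined on $\mathcal X$ and $\mathcal Y$, they are regarded as elements of $\mathbf H^s(\mathbb R^d)$ through Sobolev extension. For an integer $s\ge1$ and $\Omega\subseteq\mathbb R^d$, $\mathbf H^s(\Omega)$ is the space of functions $\phi:\Omega\to\mathbb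 R$ such that for every multi-index $k$ with $|k|\le s$ the mixed partial derivative $\phi^{(k)}$ exists and belongs to $L^2(\Omega)$, with inner product $\langle\phi,\psi\rangle_{\mathbf H^s(\Omega)}=\sum_{|k|\le s}\int_\Omega\phi^{(k)}(x)\psi^{(k)}(x)\,dx$.
   Formalization: The potentials, unique only up to an additive constant, are normalized so that u vanishes at some point of X, and the sup norms of the derivatives of c are taken over the product of the convex hulls of X and Y; without these the bound fails for general compact sets. *)

theory Defs
  imports
    "HOL-Probability.Probability"
    "HOL-Library.Landau_Symbols"
    "HOL-Computational_Algebra.Polynomial"
begin

section \<open>Smooth functions and their partial derivatives\<close>

primrec iter_partial :: "'a list \<Rightarrow> ('a::euclidean_space \<Rightarrow> real) \<Rightarrow> 'a \<Rightarrow> real" where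
  "iter_partial [] f = f"
| "iter_partial (b # bs) f = (\<lambda>x. frechet_derivative (iter_partial bs f) (at x) b)"

definition smooth_fun :: "('a::euclidean_space \<Rightarrow> real) \<Rightarrow> bool" where
  "smooth_fun f \<longleftrightarrow> (\<forall>bs. set bs \<subseteq> Basis \<longrightarrow> (\<forall>x. iter_partial bs f differentiable (at x)))"

text \<open>Multi-indices are functions supported on the standard basis.\<close>

definition multi_indices :: "nat \<Rightarrow> ('a::euclidean_space \<Rightarrow> nat) set" where
  "multi_indices s = {k. (\<forall>b. b \<notin> Basis \<longrightarrow> k b = 0) \<and> (\<Sum>b\<in>Basis. k b) \<le> s}"

text \<open>The order in which the partial derivatives are taken is left open. It is immaterial for
  smooth functions, the only ones to which this operator is applied.\<close>

definition multi_deriv :: "('a \<Rightarrow> nat) \<Rightarrow> ('a::euclidean_space \<Rightarrow> real) \<Rightarrow> 'a \<Rightarrow> real" where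
  "multi_deriv k f = iter_partial (SOME bs. \<forall>b. count_list bs b = k b) f"

definition deriv_sup_norm :: "nat \<Rightarrow> 'a set \<Rightarrow> ('a::euclidean_space \<Rightarrow> real) \<Rightarrow> real" where
  "deriv_sup_norm k S f =
     (SUP (bs, z) \<in> {bs. set bs \<subseteq> Basis \<and> length bs = k} \<times> S. \<bar>iter_partial bs f z\<bar>)"

section \<open>The Sobolev space on the whole space\<close>

definition square_integrable :: "('a::euclidean_space \<Rightarrow> real) \<Rightarrow> bool" where
  "square_integrable f \<longleftrightarrow>
     f \<in> borel_measurable lebesgue \<and> integrable lebesgue (\<lambda>x. (f x)\<^sup>2)"

definition test_fun :: "('a::euclidean_space \<Rightarrow> real) \<Rightarrow> bool" where
  "test_fun \<psi> \<longleftrightarrow> smooth_fun \<psi> \<and> bounded {x. \<psi> x \<noteq> 0}"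

definition is_weak_deriv ::
    "('a \<Rightarrow> nat) \<Rightarrow> ('a::euclidean_space \<Rightarrow> real) \<Rightarrow> ('a \<Rightarrow> real) \<Rightarrow> bool" where
  "is_weak_deriv k \<phi> g \<longleftrightarrow>
     (\<forall>\<psi>. test_fun \<psi> \<longrightarrow>
        (LINT x|lebesgue. \<phi> x * multi_deriv k \<psi> x)
          = (-1) ^ (\<Sum>b\<in>Basis. k b) * (LINT x|lebesgue. g x * \<psi> x))"

text \<open>Square integrability of \<open>\<phi>\<close> itself is required separately: the Bochner integral of a
  non-integrable function is \<open>0\<close>, so the condition for the zero multi-index does not entail it.\<close>

definition sobolev_space :: "nat \<Rightarrow> ('a::euclidean_space \<Rightarrow> real) set" where
  "sobolev_space s =
     {\<phi>. square_integrable \<phi> \<and>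
        (\<forall>k\<in>multi_indices s. \<exists>g. square_integrable g \<and> is_weak_deriv k \<phi> g)}"

text \<open>The choice below is unique up to Lebesgue-null sets.\<close>

definition weak_deriv :: "('a \<Rightarrow> nat) \<Rightarrow> ('a::euclidean_space \<Rightarrow> real) \<Rightarrow> 'a \<Rightarrow> real" where
  "weak_deriv k \<phi> = (SOME g. square_integrable g \<and> is_weak_deriv k \<phi> g)"

definition sobolev_inner ::
    "nat \<Rightarrow> ('a::euclidean_space \<Rightarrow> real) \<Rightarrow> ('a \<Rightarrow> real) \<Rightarrow> real" where
  "sobolev_inner s \<phi> \<psi> =
     (\<Sum>k\<in>multi_indices s. LINT x|lebesgue. weak_deriv k \<phi> x * weak_deriv k \<psi> x)"

definition sobolev_norm :: "nat \<Rightarrow> ('a::euclidean_space \<Rightarrow> real) \<Rightarrow> real" where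
  "sobolev_norm s \<phi> = sqrt (sobolev_inner s \<phi> \<phi>)"

text \<open>Continuity of the extension makes the pointwise condition on \<open>X\<close> meaningful even if \<open>X\<close> is
  a Lebesgue-null set, where membership in the Sobolev space alone would impose nothing.\<close>

definition sobolev_extension ::
    "nat \<Rightarrow> 'a set \<Rightarrow> ('a::euclidean_space \<Rightarrow> real) \<Rightarrow> ('a \<Rightarrow> real) \<Rightarrow> bool" where
  "sobolev_extension s X u U \<longleftrightarrow>
     U \<in> sobolev_space s \<and> continuous_on UNIV U \<and> (\<forall>x\<in>X. U x = u x)"

section \<open>Entropy-regularized optimal transport\<close>

definition prob_measure_on :: "'a::euclidean_space set \<Rightarrow> 'a measure \<Rightarrow> bool" where
  "prob_measure_on X \<alpha> \<longleftrightarrow> prob_space \<alpha> \<and> sets \<alpha> = sets (restrict_space borel X)"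

definition dual_objective ::
    "('a \<times> 'a \<Rightarrow> real) \<Rightarrow> real \<Rightarrow> 'a measure \<Rightarrow> 'a measure \<Rightarrow> ('a \<Rightarrow> real) \<Rightarrow> ('a \<Rightarrow> real) \<Rightarrow> real"
  where
  "dual_objective c \<epsilon> \<alpha> \<beta> u v =
     (LINT x|\<alpha>. u x) + (LINT y|\<beta>. v y)
       - \<epsilon> * (LINT (x, y)|(\<alpha> \<Otimes>\<^sub>M \<beta>). exp ((u x + v y - c (x, y)) / \<epsilon>)) + \<epsilon>"

text \<open>Maximality determines \<open>u\<close> and \<open>v\<close> only on the supports of \<open>\<alpha>\<close> and \<open>\<beta>\<close> (up to a constant). The
  last two clauses, which every maximizer satisfies almost everywhere, fix the values on all
  of \<open>X\<close> and \<open>Y\<close>.\<close>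

definition sinkhorn_potentials ::
    "'a::euclidean_space set \<Rightarrow> 'a set \<Rightarrow> ('a \<times> 'a \<Rightarrow> real) \<Rightarrow> real \<Rightarrow> 'a measure \<Rightarrow> 'a measure
      \<Rightarrow> ('a \<Rightarrow> real) \<Rightarrow> ('a \<Rightarrow> real) \<Rightarrow> bool" where
  "sinkhorn_potentials X Y c \<epsilon> \<alpha> \<beta> u v \<longleftrightarrow>
     continuous_on X u \<and> continuous_on Y v \<and>
     (\<forall>u' v'. continuous_on X u' \<longrightarrow> continuous_on Y v' \<longrightarrow>
        dual_objective c \<epsilon> \<alpha> \<beta> u' v' \<le> dual_objective c \<epsilon> \<alpha> \<beta> u v) \<and>
     (\<forall>x\<in>X. exp (- u x / \<epsilon>) = (LINT y|\<beta>. exp ((v y - c (x, y)) / \<epsilon>))) \<and>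
     (\<forall>y\<in>Y. exp (- v y / \<epsilon>) = (LINT x|\<alpha>. exp ((u x - c (x, y)) / \<epsilon>)))"

text \<open>Potentials are determined up to replacing \<open>(u, v)\<close> by \<open>(u + t, v - t)\<close>, so norm bounds only
  make sense for a normalized pair. We let \<open>u\<close> vanish at some point of \<open>X\<close>.\<close>

definition normalized_potentials ::
    "'a::euclidean_space set \<Rightarrow> 'a set \<Rightarrow> ('a \<times> 'a \<Rightarrow> real) \<Rightarrow> real \<Rightarrow> 'a measure \<Rightarrow> 'a measure
      \<Rightarrow> ('a \<Rightarrow> real) \<Rightarrow> ('a \<Rightarrow> real) \<Rightarrow> bool" where
  "normalized_potentials X Y c \<epsilon> \<alpha> \<beta> u v \<longleftrightarrow>
     sinkhorn_potentials X Y c \<epsilon> \<alpha> \<beta> u v \<and> (\<exists>x\<^sub>0\<in>X. u x\<^sub>0 = 0)"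

text \<open>The sup norms of the derivatives of the cost of orders \<open>0, \<dots>, s\<close>. They are taken over the
  product of the convex hulls, which is \<open>X \<times> Y\<close> itself if both sets are convex. For general
  compact sets, derivative bounds on \<open>X \<times> Y\<close> alone do not control a potential between
  nearby points of \<open>X\<close>: in dimension one, let \<open>X = {0, h, 1}\<close>, let \<open>Y\<close> be a single point, and let
  the cost, as a function of \<open>x\<close>, equal \<open>0\<close> near \<open>0\<close> and \<open>1\<close> near \<open>h\<close> and near \<open>1\<close>. Its derivatives on
  \<open>X \<times> Y\<close> and the diameter of \<open>X\<close> do not depend on \<open>h\<close>, but every extension of \<open>u\<close> has norm at
  least \<open>1 / sqrt h\<close>. Passing to the convex hull changes neither
  compactness nor the diameter.\<close>

definition cost_norms ::
    "nat \<Rightarrow> 'a::euclidean_space set \<Rightarrow> 'a set \<Rightarrow> ('a \<times> 'a \<Rightarrow> real) \<Rightarrow> real list" where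
  "cost_norms s X Y c =
     map (\<lambda>k. deriv_sup_norm k ((convex hull X) \<times> (convex hull Y)) c) [0..<Suc s]"

end

theory Submission
  imports Defs
begin

text \<open>
  The optimality condition writes the potential as a soft minimum,
  \<open>u x = - \<epsilon> * ln (\<integral> exp ((v y - c (x, y)) / \<epsilon>) d\<beta> y)\<close> for
  \<open>x \<in> X\<close>, and the same formula extends \<open>u\<close> to a smooth function on the whole
  space. Its gradient is the average of the gradient of the cost under a probability measure whose density
  is a Gibbs weight, so it is bounded by the derivatives of \<open>c\<close> of order \<open>1\<close>,
  whatever \<open>\<epsilon>\<close> is. Each further derivative may hit a Gibbs weight, which costs a
  factor \<open>1 / \<epsilon>\<close>. Thus the derivatives of order \<open>k \<ge> 1\<close> grow at most
  like \<open>1 + 1 / \<epsilon> ^ (k - 1)\<close> on the convex hull of \<open>X\<close>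
  (\<open>jet_le_pd_potential\<close>). The gradient bound also controls the oscillation, so the
  normalization of \<open>u\<close> bounds \<open>u\<close>, and it bounds \<open>v\<close> through the
  optimality condition (\<open>conjugate_potential_normalized\<close>).

  Outside the hull nothing is known about the size of the derivatives of \<open>c\<close>, so an extension
  to the whole space with comparable bounds is needed, and its constants may depend on the diameter of
  \<open>X\<close> but not on its shape: the hull may be arbitrarily thin. This is Whitney's extension
  theorem for convex sets (\<open>whitney_extension\<close>). Away from a convex set \<open>K\<close> the
  function is replaced by an average of its Taylor polynomials at the points \<open>y\<close> of
  \<open>K\<close>, with weights that are a high negative power of the distance from \<open>x\<close> to
  \<open>y\<close>. Convexity enters twice. Segments between points of \<open>K\<close> stay in
  \<open>K\<close>, so Taylor polynomials at different points are compatible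
  (\<open>jet_le_taylor_recenter\<close>). And Lebesgue measure on \<open>K\<close> is doubling with a
  constant that depends only on the dimension, so the weights concentrate at distances comparable to the
  distance from \<open>x\<close> to \<open>K\<close> (\<open>integral_concentrates_near_point\<close>,
  \<open>jet_le_average\<close>). The average alone does not agree with the potential on \<open>X\<close>.
  But the potential is smooth on the whole space, so its bounds persist on a small neighbourhood of the
  hull, and there the average is replaced by the potential itself.

  All estimates on higher derivatives are pointwise bounds with an amplitude and a length scale
  (\<open>jet_le\<close>). The scale is \<open>min 1 \<epsilon>\<close> for potentials and the distance to
  \<open>K\<close> for the extension.

  The extension has compact support and continuous derivatives up to order \<open>s\<close>, which are
  therefore its weak derivatives. The latter are unique almost everywhere, so uniform bounds on the former
  bound the Sobolev norm (\<open>sobolev_norm_Ck_compact_support\<close>).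
\<close>

section \<open>Partial derivatives and families of differentiable functions\<close>

definition pd :: "'a::euclidean_space \<Rightarrow> ('a \<Rightarrow> real) \<Rightarrow> 'a \<Rightarrow> real" where
  "pd b f x = frechet_derivative f (at x) b"

lemma pd_eqI: "(f has_derivative F) (at x) \<Longrightarrow> pd b f x = F b"
  unfolding pd_def using frechet_derivative_at by metis

lemma has_derivative_pd:
  assumes "f differentiable at x"
  shows "(f has_derivative (\<lambda>h. \<Sum>b\<in>Basis. (h \<bullet> b) * pd b f x)) (at x)"
proof -
  have d: "(f has_derivative frechet_derivative f (at x)) (at x)"
    using assms frechet_derivative_works by blast
  then have l: "linear (frechet_derivative f (at x))"
    by (rule has_derivative_linear)
  have "frechet_derivative f (at x) = (\<lambda>h. \<Sum>b\<in>Basis. (h \<bullet> b) * pd b f x)"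
  proof
    fix h
    have "frechet_derivative f (at x) h = frechet_derivative f (at x) (\<Sum>b\<in>Basis. (h \<bullet> b) *\<^sub>R b)"
      by (simp add: euclidean_representation)
    also have "\<dots> = (\<Sum>b\<in>Basis. (h \<bullet> b) * pd b f x)"
      by (simp add: linear_sum[OF l] linear_cmul[OF l] pd_def)
    finally show "frechet_derivative f (at x) h = (\<Sum>b\<in>Basis. (h \<bullet> b) * pd b f x)" .
  qed
  then show ?thesis using d by simp
qed

lemma pd_const [simp]: "pd b (\<lambda>x. c) = (\<lambda>x. 0)"
  by (simp add: pd_def fun_eq_iff)

lemma pd_inner [simp]: "pd b (\<lambda>x. x \<bullet> a) = (\<lambda>x. b \<bullet> a)"
  by (rule ext, rule pd_eqI) (auto intro!: derivative_eq_intros)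

lemma pd_add:
  assumes "f differentiable at x" "g differentiable at x"
  shows "pd b (\<lambda>x. f x + g x) x = pd b f x + pd b g x"
proof -
  have "((\<lambda>x. f x + g x) has_derivative
      (\<lambda>h. frechet_derivative f (at x) h + frechet_derivative g (at x) h)) (at x)"
    using assms by (intro has_derivative_add) (auto simp: frechet_derivative_works)
  from pd_eqI[OF this] show ?thesis by (simp add: pd_def)
qed

lemma pd_mult:
  assumes "f differentiable at x" "g differentiable at x"
  shows "pd b (\<lambda>x. f x * g x) x = f x * pd b g x + pd b f x * g x"
proof -
  have "((\<lambda>x. f x * g x) has_derivative
      (\<lambda>h. f x * frechet_derivative g (at x) h + frechet_derivative f (at x) h * g x)) (at x)"
    using assms by (intro has_derivative_mult) (auto simp: frechet_derivative_works)
  from pd_eqI[OF this] show ?thesis by (simp add: pd_def)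
qed

lemma pd_compose:
  fixes H :: "real \<Rightarrow> real"
  assumes "(H has_real_derivative H') (at (g x))" "g differentiable at x"
  shows "pd b (\<lambda>x. H (g x)) x = H' * pd b g x"
    and "(\<lambda>x. H (g x)) differentiable at x"
proof -
  have "((\<lambda>x. H (g x)) has_derivative (\<lambda>h. frechet_derivative g (at x) h * H')) (at x)"
    using DERIV_compose_FDERIV[OF assms(1) assms(2)[unfolded frechet_derivative_works]] .
  from pd_eqI[OF this] this show "pd b (\<lambda>x. H (g x)) x = H' * pd b g x"
    "(\<lambda>x. H (g x)) differentiable at x"
    by (auto simp: pd_def differentiable_def)
qed

text \<open>Parameters are built into the notion of smoothness because potentials, Taylor polynomials and weighted
  averages are all integrals over a parameter: joint continuity of the partial derivatives is what allows
  differentiation under the integral sign.\<close>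

primrec Ck_family ::
    "nat \<Rightarrow> 'b::topological_space set \<Rightarrow> ('a::euclidean_space \<Rightarrow> 'b \<Rightarrow> real) \<Rightarrow> bool" where
  "Ck_family 0 S g \<longleftrightarrow> continuous_on (UNIV \<times> S) (\<lambda>(x, y). g x y)"
| "Ck_family (Suc n) S g \<longleftrightarrow> continuous_on (UNIV \<times> S) (\<lambda>(x, y). g x y) \<and>
     (\<forall>y\<in>S. \<forall>x. (\<lambda>x. g x y) differentiable at x) \<and>
     (\<forall>b\<in>Basis. Ck_family n S (\<lambda>x y. pd b (\<lambda>x. g x y) x))"

text \<open>A single function is a family over a parameter set with one point, so the closure properties need only one
  proof.\<close>

definition Ck :: "nat \<Rightarrow> ('a::euclidean_space \<Rightarrow> real) \<Rightarrow> bool" where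
  "Ck n f \<longleftrightarrow> Ck_family n {0::real} (\<lambda>x y. f x)"

lemma Ck_family_continuous: "Ck_family n S g \<Longrightarrow> continuous_on (UNIV \<times> S) (\<lambda>(x, y). g x y)"
  by (cases n) auto

lemma Ck_family_cong:
  assumes "\<And>x y. y \<in> S \<Longrightarrow> g x y = h x y"
  shows "Ck_family n S g \<longleftrightarrow> Ck_family n S h"
  using assms
proof (induction n arbitrary: g h)
  case 0
  then show ?case by (auto intro!: continuous_on_cong)
next
  case (Suc n)
  have "continuous_on (UNIV \<times> S) (\<lambda>(x, y). g x y) \<longleftrightarrow> continuous_on (UNIV \<times> S) (\<lambda>(x, y). h x y)"
    using Suc.prems by (intro continuous_on_cong) auto
  moreover have e: "(\<lambda>x. g x y) = (\<lambda>x. h x y)" if "y \<in> S" for y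
    using Suc.prems that by auto
  moreover have "Ck_family n S (\<lambda>x y. pd b (\<lambda>x. g x y) x)
      \<longleftrightarrow> Ck_family n S (\<lambda>x y. pd b (\<lambda>x. h x y) x)" for b
    by (rule Suc.IH) (simp add: e)
  ultimately show ?case by (auto simp: e)
qed

lemma Ck_family_differentiable:
  "Ck_family (Suc n) S g \<Longrightarrow> y \<in> S \<Longrightarrow> (\<lambda>x. g x y) differentiable at x"
  by simp

lemma Ck_family_pd:
  "Ck_family (Suc n) S g \<Longrightarrow> b \<in> Basis \<Longrightarrow> Ck_family n S (\<lambda>x y. pd b (\<lambda>x. g x y) x)"
  by simp

lemma Ck_family_mono: "Ck_family n S g \<Longrightarrow> m \<le> n \<Longrightarrow> Ck_family m S g"
proof (induction n arbitrary: m g)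
  case (Suc n)
  show ?case
  proof (cases m)
    case 0 then show ?thesis using Suc.prems by simp
  next
    case (Suc k)
    then show ?thesis using Suc.prems Suc.IH by auto
  qed
qed simp

lemma Ck_family_reparam:
  fixes g :: "'a::euclidean_space \<Rightarrow> 'b::topological_space \<Rightarrow> real" and r :: "'c::topological_space \<Rightarrow> 'b"
  assumes "Ck_family n S g" "continuous_on T r" "r ` T \<subseteq> S"
  shows "Ck_family n T (\<lambda>x t. g x (r t))"
  using assms(1)
proof (induction n arbitrary: g)
  have c: "continuous_on (UNIV \<times> T) (\<lambda>(x, t). g x (r t))"
    if "continuous_on (UNIV \<times> S) (\<lambda>(x, y). g x y)" for g :: "'a \<Rightarrow> 'b \<Rightarrow> real"
  proof -
    have "continuous_on (UNIV \<times> T) (\<lambda>z. (fst z, r (snd z)) :: 'a \<times> _)"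
      by (intro continuous_intros continuous_on_compose2[OF assms(2)]) auto
    moreover have "(\<lambda>z. (fst z, r (snd z)) :: 'a \<times> _) ` (UNIV \<times> T) \<subseteq> UNIV \<times> S"
      using assms(3) by auto
    ultimately show ?thesis
      using continuous_on_compose2[OF that, of _ "\<lambda>z. (fst z, r (snd z))"] by (simp add: case_prod_beta)
  qed
  {
    case 0
    then show ?case using c by simp
  next
    case (Suc n)
    have "Ck_family n T (\<lambda>x t. pd b (\<lambda>x. g x (r t)) x)" if "b \<in> Basis" for b
      using Suc.prems that by (intro Suc.IH[where g="\<lambda>x y. pd b (\<lambda>x. g x y) x"]) auto
    then show ?case using c[of g] assms(3) Suc.prems by (auto simp: image_subset_iff)
  }
qed

lemma Ck_family_section: "Ck_family n S g \<Longrightarrow> y \<in> S \<Longrightarrow> Ck n (\<lambda>x. g x y)"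
  unfolding Ck_def using Ck_family_reparam[where r="\<lambda>_. y"] by auto

lemma Ck_imp_family: "Ck n f \<Longrightarrow> Ck_family n S (\<lambda>x y. f x)"
  unfolding Ck_def using Ck_family_reparam[where r="\<lambda>_. 0"] by auto

lemma Ck_0: "Ck 0 f \<longleftrightarrow> continuous_on UNIV f"
proof
  assume "Ck 0 f"
  then have c: "continuous_on (UNIV \<times> {0::real}) (\<lambda>(x, y). f x)"
    by (simp add: Ck_def)
  have "continuous_on UNIV (\<lambda>x. (x, 0::real))"
    by (intro continuous_intros)
  from continuous_on_compose2[OF c this] show "continuous_on UNIV f" by auto
next
  assume "continuous_on UNIV f"
  then show "Ck 0 f"
    by (auto simp: Ck_def case_prod_beta intro!: continuous_on_compose2[of UNIV f] continuous_intros)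
qed

lemma Ck_continuous: "Ck n f \<Longrightarrow> continuous_on UNIV f"
  by (metis Ck_0 Ck_def Ck_family_mono zero_le)

lemma Ck_Suc: "Ck (Suc n) f \<longleftrightarrow> continuous_on UNIV f \<and> (\<forall>x. f differentiable at x) \<and>
    (\<forall>b\<in>Basis. Ck n (pd b f))"
  unfolding Ck_def using Ck_0[of f] by (auto simp: Ck_def)

lemma Ck_SucI:
  assumes "\<And>x. f differentiable at x" "\<And>b. b \<in> Basis \<Longrightarrow> Ck n (pd b f)"
  shows "Ck (Suc n) f"
  using assms by (auto simp: Ck_Suc continuous_on_eq_continuous_at differentiable_imp_continuous_within)

lemma Ck_mono: "Ck n f \<Longrightarrow> m \<le> n \<Longrightarrow> Ck m f"
  unfolding Ck_def by (rule Ck_family_mono)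

lemma Ck_pd: "Ck (Suc n) f \<Longrightarrow> b \<in> Basis \<Longrightarrow> Ck n (pd b f)"
  by (simp add: Ck_Suc)

lemma Ck_differentiable: "Ck (Suc n) f \<Longrightarrow> f differentiable at x"
  by (simp add: Ck_Suc)

lemma iter_partial_snoc: "iter_partial (bs @ [b]) f = iter_partial bs (pd b f)"
  by (induction bs) (simp_all add: pd_def[abs_def])

lemma smooth_fun_imp_Ck:
  assumes "smooth_fun f"
  shows "Ck n f"
proof -
  have p: "smooth_fun (pd b g)" if "smooth_fun g" "b \<in> Basis" for b and g :: "'a \<Rightarrow> real"
    using that iter_partial_snoc[of _ b g] unfolding smooth_fun_def
    by (metis Un_subset_iff empty_subsetI insert_subset list.set(1) list.set(2) set_append)
  have d: "g differentiable at x" if "smooth_fun g" for g :: "'a \<Rightarrow> real" and x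
    using that[unfolded smooth_fun_def, rule_format, of "[]"] by simp
  show ?thesis using assms
  proof (induction n arbitrary: f)
    case 0
    then show ?case using d
      by (auto simp: Ck_0 continuous_on_eq_continuous_at differentiable_imp_continuous_within)
  next
    case (Suc n)
    then show ?case using p d by (intro Ck_SucI) auto
  qed
qed

lemma Ck_iter_partial:
  "Ck n f \<Longrightarrow> set bs \<subseteq> Basis \<Longrightarrow> length bs \<le> n \<Longrightarrow> Ck (n - length bs) (iter_partial bs f)"
proof (induction bs arbitrary: f n rule: rev_induct)
  case (snoc b bs)
  then obtain m where m: "n = Suc m" by (cases n) auto
  have "Ck (m - length bs) (iter_partial bs (pd b f))"
    using snoc m by (intro snoc.IH) (auto simp: Ck_Suc)
  then show ?case using m by (simp add: iter_partial_snoc)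
qed simp

lemma Ck_imp_smooth_fun:
  assumes "\<And>n. Ck n f"
  shows "smooth_fun f"
  unfolding smooth_fun_def
proof (intro allI impI)
  fix bs :: "'a list" and x assume "set bs \<subseteq> Basis"
  then have "Ck 1 (iter_partial bs f)"
    using Ck_iter_partial[OF assms[of "Suc (length bs)"], of bs] by simp
  then show "iter_partial bs f differentiable at x" by (simp add: Ck_Suc)
qed

lemma Ck_family_parameter:
  fixes S :: "'b::topological_space set"
  assumes "continuous_on S h"
  shows "Ck_family n S (\<lambda>(x::'a::euclidean_space) y. h y)"
proof -
  have c: "continuous_on (UNIV \<times> S) (\<lambda>(x::'a, y). h y)"
    if "continuous_on S h" for h :: "'b \<Rightarrow> real"
    using that by (auto simp: case_prod_beta intro!: continuous_on_compose2[of S h] continuous_intros)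
  show ?thesis using assms
  proof (induction n arbitrary: h)
    case 0
    then show ?case using c[OF 0] by simp
  next
    case (Suc n)
    have "Ck_family n S (\<lambda>(x::'a) y. 0)" by (rule Suc.IH) simp
    then show ?case using c[OF Suc.prems] by simp
  qed
qed

lemma Ck_const: "Ck n (\<lambda>x. c)"
  unfolding Ck_def by (rule Ck_family_parameter) simp

lemma Ck_family_add:
  assumes "Ck_family n S f" "Ck_family n S g"
  shows "Ck_family n S (\<lambda>x y. f x y + g x y)"
  using assms
proof (induction n arbitrary: f g)
  case 0
  then show ?case by (auto simp: case_prod_beta intro!: continuous_intros)
next
  case (Suc n)
  have "Ck_family n S (\<lambda>x y. pd b (\<lambda>x. f x y + g x y) x)" if b: "b \<in> Basis" for b
  proof -
    have "Ck_family n S (\<lambda>x y. pd b (\<lambda>x. f x y) x + pd b (\<lambda>x. g x y) x)"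
      using Suc.prems b by (intro Suc.IH) auto
    then show ?thesis
      by (rule iffD1[OF Ck_family_cong, rotated]) (use Suc.prems in \<open>auto simp: pd_add\<close>)
  qed
  then show ?case using Suc.prems
    by (auto simp: case_prod_beta intro!: continuous_intros)
qed

lemma Ck_family_mult:
  assumes "Ck_family n S f" "Ck_family n S g"
  shows "Ck_family n S (\<lambda>x y. f x y * g x y)"
  using assms
proof (induction n arbitrary: f g)
  case 0
  then show ?case by (auto simp: case_prod_beta intro!: continuous_intros)
next
  case (Suc n)
  have "Ck_family n S (\<lambda>x y. pd b (\<lambda>x. f x y * g x y) x)" if b: "b \<in> Basis" for b
  proof -
    have "Ck_family n S (\<lambda>x y. f x y * pd b (\<lambda>x. g x y) x + pd b (\<lambda>x. f x y) x * g x y)"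
      using Suc.prems b Ck_family_mono[of "Suc n" S _ n]
      by (intro Ck_family_add Suc.IH) auto
    then show ?thesis
      by (rule iffD1[OF Ck_family_cong, rotated]) (use Suc.prems in \<open>auto simp: pd_mult\<close>)
  qed
  then show ?case using Suc.prems
    by (auto simp: case_prod_beta intro!: continuous_intros)
qed

lemma Ck_family_cmult: "Ck_family n S g \<Longrightarrow> Ck_family n S (\<lambda>x y. c * g x y)"
  using Ck_family_mult[OF Ck_family_parameter[of S "\<lambda>_. c" n]] by simp

lemma Ck_family_diff:
  "Ck_family n S f \<Longrightarrow> Ck_family n S g \<Longrightarrow> Ck_family n S (\<lambda>x y. f x y - g x y)"
  using Ck_family_add[OF _ Ck_family_cmult[of n S g "-1"]] by simp

lemma Ck_family_sum:
  assumes "\<And>i. i \<in> I \<Longrightarrow> Ck_family n S (g i)"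
  shows "Ck_family n S (\<lambda>x y. \<Sum>i\<in>I. g i x y)"
  using assms
proof (induction I rule: infinite_finite_induct)
  case (insert i I)
  then show ?case by (simp add: Ck_family_add)
qed (use Ck_family_parameter[of S "\<lambda>_. 0"] in auto)

lemma Ck_family_power: "Ck_family n S g \<Longrightarrow> Ck_family n S (\<lambda>x y. g x y ^ k)"
proof (induction k)
  case 0
  then show ?case using Ck_family_parameter[of S "\<lambda>_. 1"] by simp
qed (simp add: Ck_family_mult)

lemma Ck_inner: "Ck n (\<lambda>x. x \<bullet> b)"
proof (cases n)
  case 0
  then show ?thesis by (auto simp: Ck_0 intro!: continuous_intros)
next
  case (Suc m)
  have "((\<lambda>x. x \<bullet> b) has_derivative (\<lambda>h. h \<bullet> b)) (at x)" for x
    by (auto intro!: derivative_eq_intros)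
  then show ?thesis using Suc
    by (auto intro!: Ck_SucI Ck_const differentiableI)
qed

lemma Ck_family_inverse:
  fixes g :: "'a::euclidean_space \<Rightarrow> 'b::topological_space \<Rightarrow> real"
  assumes "Ck_family n S g" "\<And>x y. y \<in> S \<Longrightarrow> 0 < g x y"
  shows "Ck_family n S (\<lambda>x y. inverse (g x y))"
  using assms
proof (induction n arbitrary: g)
  have c: "continuous_on (UNIV \<times> S) (\<lambda>(x, y). inverse (g x y))"
    if "continuous_on (UNIV \<times> S) (\<lambda>(x, y). g x y)" "\<And>x y. y \<in> S \<Longrightarrow> 0 < g x y"
    for g :: "'a \<Rightarrow> 'b \<Rightarrow> real"
    unfolding case_prod_beta
    by (rule continuous_on_inverse)
      (use that in \<open>auto simp: case_prod_beta order_less_le\<close>)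
  {
  case 0
  then show ?case using c by simp
next
  case (Suc n)
  have d: "((\<lambda>z. inverse z) has_real_derivative - (inverse (g x y) ^ Suc (Suc 0))) (at (g x y))"
    if "y \<in> S" for x y
    using Suc.prems(2)[OF that, of x] by (intro DERIV_inverse) auto
  have e: "pd b (\<lambda>x. inverse (g x y)) x = - (inverse (g x y) ^ Suc (Suc 0)) * pd b (\<lambda>x. g x y) x"
    "(\<lambda>x. inverse (g x y)) differentiable at x" if "y \<in> S" for x y b
    using pd_compose[where H=inverse and g="\<lambda>x. g x y", OF d[OF that]] Suc.prems(1) that by auto
  have "Ck_family n S (\<lambda>x y. pd b (\<lambda>x. inverse (g x y)) x)" if b: "b \<in> Basis" for b
  proof -
    have "Ck_family n S (\<lambda>x y. inverse (g x y))"
      using Suc.IH Ck_family_mono[OF Suc.prems(1), of n] Suc.prems(2) by simp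
    moreover have "Ck_family n S (\<lambda>x y. pd b (\<lambda>x. g x y) x)"
      using Suc.prems(1) b by simp
    ultimately have "Ck_family n S (\<lambda>x y. (-1) * (inverse (g x y) ^ Suc (Suc 0)) * pd b (\<lambda>x. g x y) x)"
      by (intro Ck_family_mult Ck_family_power Ck_family_cmult)
    then show ?thesis
      by (rule iffD1[OF Ck_family_cong, rotated]) (simp add: e)
  qed
  moreover have "continuous_on (UNIV \<times> S) (\<lambda>(x, y). inverse (g x y))"
    using Suc.prems(2) Ck_family_continuous[OF Suc.prems(1)] by (rule c[rotated])
  ultimately show ?case using e by auto
  }
qed

lemma Ck_family_compose:
  fixes H :: "nat \<Rightarrow> real \<Rightarrow> real" and g :: "'a::euclidean_space \<Rightarrow> 'b::topological_space \<Rightarrow> real"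
  assumes "\<And>j t. (H j has_real_derivative H (Suc j) t) (at t)" "Ck_family n S g"
  shows "Ck_family n S (\<lambda>x y. H j (g x y))"
  using assms(2)
proof (induction n arbitrary: g j)
  have c: "continuous_on UNIV (H j)" for j
    using assms(1) by (meson DERIV_isCont continuous_at_imp_continuous_on)
  have c: "continuous_on (UNIV \<times> S) (\<lambda>(x, y). H j (g x y))"
    if "continuous_on (UNIV \<times> S) (\<lambda>(x, y). g x y)" for g :: "'a \<Rightarrow> 'b \<Rightarrow> real" and j
    using that by (auto simp: case_prod_beta intro!: continuous_on_compose2[OF c])
  {
    case 0
    then show ?case using c by auto
  next
    case (Suc n)
    have e: "pd b (\<lambda>x. H j (g x y)) x = H (Suc j) (g x y) * pd b (\<lambda>x. g x y) x"
      "(\<lambda>x. H j (g x y)) differentiable at x" if "y \<in> S" for x y b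
      using pd_compose[where H="H j" and g="\<lambda>x. g x y", OF assms(1)] Suc.prems that by auto
    have "Ck_family n S (\<lambda>x y. pd b (\<lambda>x. H j (g x y)) x)" if b: "b \<in> Basis" for b
    proof -
      have "Ck_family n S (\<lambda>x y. H (Suc j) (g x y) * pd b (\<lambda>x. g x y) x)"
        using Suc.IH[of g "Suc j"] Ck_family_mono[OF Suc.prems, of n] Suc.prems b
        by (intro Ck_family_mult) auto
      then show ?thesis
        by (rule iffD1[OF Ck_family_cong, rotated]) (simp add: e)
    qed
    then show ?case using e c Suc.prems by auto
  }
qed

lemma Ck_add: "Ck n f \<Longrightarrow> Ck n g \<Longrightarrow> Ck n (\<lambda>x. f x + g x)"
  unfolding Ck_def by (rule Ck_family_add)

lemma Ck_diff: "Ck n f \<Longrightarrow> Ck n g \<Longrightarrow> Ck n (\<lambda>x. f x - g x)"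
  unfolding Ck_def by (rule Ck_family_diff)

lemma Ck_mult: "Ck n f \<Longrightarrow> Ck n g \<Longrightarrow> Ck n (\<lambda>x. f x * g x)"
  unfolding Ck_def by (rule Ck_family_mult)

lemma Ck_cmult: "Ck n g \<Longrightarrow> Ck n (\<lambda>x. c * g x)"
  unfolding Ck_def by (rule Ck_family_cmult)

lemma Ck_sum: "(\<And>i. i \<in> I \<Longrightarrow> Ck n (g i)) \<Longrightarrow> Ck n (\<lambda>x. \<Sum>i\<in>I. g i x)"
  unfolding Ck_def by (rule Ck_family_sum)

lemma Ck_power: "Ck n g \<Longrightarrow> Ck n (\<lambda>x. g x ^ k)"
  unfolding Ck_def by (rule Ck_family_power)

lemma Ck_inverse: "Ck n g \<Longrightarrow> (\<And>x. 0 < g x) \<Longrightarrow> Ck n (\<lambda>x. inverse (g x))"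
  unfolding Ck_def by (rule Ck_family_inverse)

lemma Ck_compose:
  fixes H :: "nat \<Rightarrow> real \<Rightarrow> real"
  assumes "\<And>j t. (H j has_real_derivative H (Suc j) t) (at t)" "Ck n g"
  shows "Ck n (\<lambda>x. H j (g x))"
  using assms unfolding Ck_def by (rule Ck_family_compose)

section \<open>Bounds on the derivatives at a point, measured at a length scale\<close>

text \<open>A derivative of order \<open>j\<close> is bounded by \<open>A / \<rho> ^ j\<close>: the function looks
  like one of size \<open>A\<close> that varies on the length scale \<open>\<rho>\<close>. Such bounds
  survive products, quotients and compositions with the same \<open>\<rho>\<close>, so the Leibniz and chain
  rules for higher derivatives never need to be expanded.\<close>

primrec jet_le :: "nat \<Rightarrow> real \<Rightarrow> real \<Rightarrow> ('a::euclidean_space \<Rightarrow> real) \<Rightarrow> 'a \<Rightarrow> bool" where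
  "jet_le 0 \<rho> A f x \<longleftrightarrow> \<bar>f x\<bar> \<le> A"
| "jet_le (Suc n) \<rho> A f x \<longleftrightarrow> \<bar>f x\<bar> \<le> A \<and> (\<forall>b\<in>Basis. jet_le n \<rho> (A / \<rho>) (pd b f) x)"

lemma jet_le_abs: "jet_le n \<rho> A f x \<Longrightarrow> \<bar>f x\<bar> \<le> A"
  by (cases n) auto

lemma jet_le_nonneg: "jet_le n \<rho> A f x \<Longrightarrow> 0 \<le> A"
  using jet_le_abs by fastforce

lemma jet_le_pd: "jet_le (Suc n) \<rho> A f x \<Longrightarrow> b \<in> Basis \<Longrightarrow> jet_le n \<rho> (A / \<rho>) (pd b f) x"
  by simp

lemma jet_le_mono_order: "jet_le n \<rho> A f x \<Longrightarrow> m \<le> n \<Longrightarrow> jet_le m \<rho> A f x"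
proof (induction n arbitrary: m f A)
  case (Suc n)
  then show ?case by (cases m) auto
qed simp

lemma jet_le_mono: "jet_le n \<rho> A f x \<Longrightarrow> A \<le> B \<Longrightarrow> 0 < \<rho> \<Longrightarrow> jet_le n \<rho> B f x"
proof (induction n arbitrary: f A B)
  case (Suc n)
  then show ?case by (force simp: divide_right_mono intro: Suc.IH)
qed simp

lemma jet_le_mono_scale: "jet_le n \<rho> A f x \<Longrightarrow> 0 < \<sigma> \<Longrightarrow> \<sigma> \<le> \<rho> \<Longrightarrow> jet_le n \<sigma> A f x"
proof (induction n arbitrary: f A)
  case (Suc n)
  have "jet_le n \<sigma> (A / \<sigma>) (pd b f) x" if "b \<in> Basis" for b
  proof -
    have "jet_le n \<sigma> (A / \<rho>) (pd b f) x" using Suc that by auto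
    moreover have "A / \<rho> \<le> A / \<sigma>"
      using jet_le_nonneg[OF Suc.prems(1)] Suc.prems by (intro divide_left_mono) auto
    ultimately show ?thesis using jet_le_mono Suc.prems by blast
  qed
  then show ?case using Suc.prems by simp
qed simp

text \<open>An amplitude \<open>A * \<rho> ^ n\<close> leaves every derivative up to order \<open>n\<close> bounded as
  \<open>\<rho>\<close> tends to \<open>0\<close>. This is how the blow-up of cutoffs and weights near a set
  is paid for by the order of vanishing of a Taylor remainder.\<close>

lemma jet_le_unit_scale:
  assumes "jet_le n \<rho> (A * \<rho> ^ n) f x" "0 < \<rho>" "\<rho> \<le> R" "1 \<le> R"
  shows "jet_le n 1 (A * R ^ n) f x"
  using assms(1)
proof (induction n arbitrary: f)
  case (Suc n)
  have "0 \<le> A * \<rho> ^ Suc n" using jet_le_nonneg[OF Suc.prems] .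
  then have A: "0 \<le> A" using zero_less_power[OF assms(2), of "Suc n"]
    by (meson mult_neg_pos not_less)
  have "A * \<rho> ^ Suc n \<le> A * R ^ Suc n"
    using A assms by (intro mult_left_mono power_mono) auto
  moreover have "jet_le n 1 (A * R ^ Suc n) (pd b f) x" if b: "b \<in> Basis" for b
  proof -
    have "jet_le n \<rho> (A * \<rho> ^ n) (pd b f) x"
      using jet_le_pd[OF Suc.prems b] assms(2) by simp
    then have "jet_le n 1 (A * R ^ n) (pd b f) x" by (rule Suc.IH)
    moreover have "A * R ^ n \<le> A * R ^ Suc n"
      using A assms(4) by (intro mult_left_mono power_increasing) auto
    ultimately show ?thesis using jet_le_mono by fastforce
  qed
  ultimately show ?case using jet_le_abs[OF Suc.prems] by auto
qed simp

lemma jet_le_const: "\<bar>c\<bar> \<le> A \<Longrightarrow> 0 < \<rho> \<Longrightarrow> jet_le n \<rho> A (\<lambda>x. c) x"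
proof (induction n arbitrary: c A)
  case (Suc n)
  have "0 \<le> A" using Suc.prems by linarith
  then show ?case using Suc by simp
qed simp

lemma jet_le_add:
  assumes "Ck n f" "Ck n g" "jet_le n \<rho> A f x" "jet_le n \<rho> B g x"
  shows "jet_le n \<rho> (A + B) (\<lambda>x. f x + g x) x"
  using assms
proof (induction n arbitrary: f g A B)
  case (Suc n)
  have "pd b (\<lambda>x. f x + g x) = (\<lambda>x. pd b f x + pd b g x)" for b
    using Suc.prems by (auto simp: fun_eq_iff Ck_Suc intro!: pd_add)
  then show ?case using Suc.prems Suc.IH
    by (auto simp: Ck_Suc add_divide_distrib)
qed auto

lemma jet_le_mult:
  assumes "Ck n f" "Ck n g" "jet_le n \<rho> A f x" "jet_le n \<rho> B g x" "0 < \<rho>"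
  shows "jet_le n \<rho> (2 ^ n * A * B) (\<lambda>x. f x * g x) x"
  using assms
proof (induction n arbitrary: f g A B)
  case 0
  then show ?case by (simp add: abs_mult mult_mono)
next
  case (Suc n)
  have p: "pd b (\<lambda>x. f x * g x) = (\<lambda>x. f x * pd b g x + pd b f x * g x)" for b
    using Suc.prems by (auto simp: fun_eq_iff Ck_Suc intro!: pd_mult)
  have "jet_le n \<rho> (2 ^ Suc n * A * B / \<rho>) (pd b (\<lambda>x. f x * g x)) x" if b: "b \<in> Basis" for b
  proof -
    have "jet_le n \<rho> (2 ^ n * A * (B / \<rho>) + 2 ^ n * (A / \<rho>) * B)
        (\<lambda>x. f x * pd b g x + pd b f x * g x) x"
      using Suc.prems b Ck_mono[of "Suc n" _ n] jet_le_mono_order[of "Suc n" \<rho> _ _ _ n]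
      by (intro jet_le_add Suc.IH Ck_mult) (auto simp: Ck_Suc)
    then show ?thesis by (simp add: p algebra_simps)
  qed
  moreover have "\<bar>f x * g x\<bar> \<le> 2 ^ Suc n * A * B"
  proof -
    have "\<bar>f x * g x\<bar> \<le> A * B"
      using jet_le_abs[OF Suc.prems(3)] jet_le_abs[OF Suc.prems(4)] by (simp add: abs_mult mult_mono')
    also have "\<dots> \<le> 2 ^ Suc n * (A * B)"
      using jet_le_nonneg[OF Suc.prems(3)] jet_le_nonneg[OF Suc.prems(4)]
        mult_right_mono[of 1 "2 ^ Suc n" "A * B"] one_le_power[of "2::real" "Suc n"] by simp
    finally show ?thesis by (simp add: mult.assoc)
  qed
  ultimately show ?case by simp
qed

lemma jet_le_cmult:
  assumes "Ck n g" "jet_le n \<rho> B g x" "0 < \<rho>"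
  shows "jet_le n \<rho> (\<bar>c\<bar> * B) (\<lambda>x. c * g x) x"
  using assms
proof (induction n arbitrary: g B)
  case 0
  then show ?case by (simp add: abs_mult mult_left_mono)
next
  case (Suc n)
  have "pd b (\<lambda>x. c * g x) = (\<lambda>x. c * pd b g x)" for b
    using Suc.prems by (auto simp: fun_eq_iff Ck_Suc pd_mult)
  moreover have "jet_le n \<rho> (\<bar>c\<bar> * (B / \<rho>)) (\<lambda>x. c * pd b g x) x" if "b \<in> Basis" for b
    using Suc that by (intro Suc.IH) (auto simp: Ck_Suc)
  ultimately show ?case using Suc.prems by (simp add: abs_mult mult_left_mono)
qed

lemma jet_le_diff:
  assumes "Ck n f" "Ck n g" "jet_le n \<rho> A f x" "jet_le n \<rho> B g x" "0 < \<rho>"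
  shows "jet_le n \<rho> (A + B) (\<lambda>x. f x - g x) x"
  using jet_le_add[OF assms(1) Ck_cmult[OF assms(2), of "-1"] assms(3)]
    jet_le_cmult[OF assms(2,4,5), of "-1"] by simp

lemma jet_le_sum:
  assumes "\<And>i. i \<in> I \<Longrightarrow> Ck n (g i)" "\<And>i. i \<in> I \<Longrightarrow> jet_le n \<rho> (A i) (g i) x" "0 < \<rho>"
  shows "jet_le n \<rho> (\<Sum>i\<in>I. A i) (\<lambda>x. \<Sum>i\<in>I. g i x) x"
  using assms(1,2)
proof (induction I rule: infinite_finite_induct)
  case (insert i I)
  then show ?case by (simp add: jet_le_add Ck_sum)
qed (use assms(3) in \<open>auto intro: jet_le_const\<close>)

lemma jet_le_power:
  assumes "Ck n g" "jet_le n \<rho> B g x" "0 < \<rho>"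
  shows "jet_le n \<rho> ((2 ^ n * B) ^ k) (\<lambda>x. g x ^ k) x"
proof (induction k)
  case 0
  then show ?case using jet_le_const[of 1 1] assms by simp
next
  case (Suc k)
  have "jet_le n \<rho> (2 ^ n * B * (2 ^ n * B) ^ k) (\<lambda>x. g x * g x ^ k) x"
    using assms Suc by (intro jet_le_mult Ck_power)
  then show ?case by simp
qed

text \<open>Reciprocals and compositions are differentiated once and treated by induction on the order. The recursions
  for the constants repeat these inductions: for the reciprocal, \<open>- g' / g ^ 2\<close> is a product of
  three factors.\<close>

primrec inverse_const :: "nat \<Rightarrow> real \<Rightarrow> real" where
  "inverse_const 0 L = 1"
| "inverse_const (Suc n) L = max 1 (2 ^ n * (2 ^ n * inverse_const n L) ^ 2 * L)"

lemma inverse_const_ge_1: "1 \<le> inverse_const n L"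
  by (cases n) auto

text \<open>The size of \<open>g\<close> is measured relative to its value at \<open>x\<close>, which makes the
  constant invariant under scaling \<open>g\<close>. Integrals of positive weights satisfy this hypothesis
  whenever the weights do.\<close>

lemma jet_le_inverse:
  assumes "0 < \<rho>" "Ck n g" "\<And>z. 0 < g z" "jet_le n \<rho> (L * g x) g x"
  shows "jet_le n \<rho> (inverse_const n L / g x) (\<lambda>z. inverse (g z)) x"
  using assms(2,4)
proof (induction n)
  case 0
  then show ?case using assms(3)[of x] by (simp add: divide_simps abs_of_pos)
next
  case (Suc n)
  let ?C = "inverse_const n L" and ?C' = "inverse_const (Suc n) L"
  have "jet_le n \<rho> (?C' / g x / \<rho>) (pd b (\<lambda>z. inverse (g z))) x" if b: "b \<in> Basis" for b
  proof -
    have d: "((\<lambda>z. inverse z) has_real_derivative - (inverse (g z) ^ Suc (Suc 0))) (at (g z))" for z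
      using assms(3)[of z] by (intro DERIV_inverse) auto
    have e: "pd b (\<lambda>z. inverse (g z)) = (\<lambda>z. (-1) * (inverse (g z) ^ 2 * pd b g z))"
      using pd_compose(1)[where H=inverse and g=g, OF d Ck_differentiable[OF Suc.prems(1)], of b]
      by (auto simp: fun_eq_iff numeral_2_eq_2)
    have c: "Ck n (\<lambda>z. inverse (g z))" "Ck n g" "Ck n (pd b g)"
      using assms(3) Ck_mono[OF Suc.prems(1), of n] Suc.prems(1) b by (auto intro: Ck_inverse simp: Ck_Suc)
    have i: "jet_le n \<rho> (?C / g x) (\<lambda>z. inverse (g z)) x"
      using c jet_le_mono_order[OF Suc.prems(2), of n] by (intro Suc.IH) auto
    have "jet_le n \<rho> (\<bar>-1\<bar> * (2 ^ n * (2 ^ n * (?C / g x)) ^ 2 * (L * g x / \<rho>)))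
        (\<lambda>z. (-1) * (inverse (g z) ^ 2 * pd b g z)) x"
      using c i Suc.prems assms(1) b by (intro jet_le_cmult jet_le_mult jet_le_power Ck_power Ck_mult) auto
    moreover have "\<bar>-1\<bar> * (2 ^ n * (2 ^ n * (?C / g x)) ^ 2 * (L * g x / \<rho>)) \<le> ?C' / g x / \<rho>"
    proof -
      have "\<bar>-1\<bar> * (2 ^ n * (2 ^ n * (?C / g x)) ^ 2 * (L * g x / \<rho>))
          = (2 ^ n * (2 ^ n * ?C) ^ 2 * L) / g x / \<rho>"
        using assms(3)[of x] by (simp add: power2_eq_square field_simps)
      also have "\<dots> \<le> ?C' / g x / \<rho>"
        using assms(3)[of x] assms(1) by (intro divide_right_mono) auto
      finally show ?thesis .
    qed
    ultimately show ?thesis using jet_le_mono assms(1) e by simp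
  qed
  moreover have "\<bar>inverse (g x)\<bar> \<le> ?C' / g x"
    using assms(3)[of x] inverse_const_ge_1[of "Suc n" L] by (simp add: divide_simps del: inverse_const.simps)
  ultimately show ?case by (simp del: inverse_const.simps)
qed

primrec compose_const :: "nat \<Rightarrow> real \<Rightarrow> real" where
  "compose_const 0 L = 1"
| "compose_const (Suc n) L = max 1 (2 ^ n * compose_const n L * L)"

lemma compose_const_ge_1: "1 \<le> compose_const n L"
  by (cases n) auto

text \<open>Only the derivatives of \<open>g\<close> are bounded in terms of \<open>L\<close>, while the value of
  \<open>g\<close> enters through \<open>H\<close> alone. For the exponential function this bounds all
  derivatives of \<open>exp \<circ> g\<close> by a multiple of \<open>exp (g x)\<close>, however large
  \<open>g x\<close> is.\<close>

lemma jet_le_compose: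
  fixes H :: "nat \<Rightarrow> real \<Rightarrow> real"
  assumes H: "\<And>j t. (H j has_real_derivative H (Suc j) t) (at t)" and \<rho>: "0 < \<rho>"
    and g: "Ck n g" "\<And>m b. n = Suc m \<Longrightarrow> b \<in> Basis \<Longrightarrow> jet_le m \<rho> (L / \<rho>) (pd b g) x"
    and B: "\<And>i. i \<le> n \<Longrightarrow> \<bar>H (j + i) (g x)\<bar> \<le> B"
  shows "jet_le n \<rho> (compose_const n L * B) (\<lambda>z. H j (g z)) x"
  using g B
proof (induction n arbitrary: j)
  case 0
  then show ?case using 0(3)[of 0] by simp
next
  case (Suc n)
  let ?C = "compose_const n L" and ?C' = "compose_const (Suc n) L"
  have B: "0 \<le> B" "\<bar>H j (g x)\<bar> \<le> B" using Suc.prems(3)[of 0] by auto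
  have "jet_le n \<rho> (?C' * B / \<rho>) (pd b (\<lambda>z. H j (g z))) x" if b: "b \<in> Basis" for b
  proof -
    have e: "pd b (\<lambda>z. H j (g z)) = (\<lambda>z. H (Suc j) (g z) * pd b g z)"
      using pd_compose(1)[where H="H j" and g=g, OF H Ck_differentiable[OF Suc.prems(1)]] by auto
    have c: "Ck n g" "Ck n (pd b g)"
      using Suc.prems(1) Ck_mono[OF Suc.prems(1), of n] b by (auto simp: Ck_Suc)
    have "jet_le n \<rho> (?C * B) (\<lambda>z. H (Suc j) (g z)) x"
    proof (rule Suc.IH[OF c(1)])
      show "jet_le m \<rho> (L / \<rho>) (pd b' g) x" if "n = Suc m" "b' \<in> Basis" for m b'
        using jet_le_mono_order[OF Suc.prems(2)[OF refl that(2)], of m] that by simp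
      show "\<bar>H (Suc j + i) (g x)\<bar> \<le> B" if "i \<le> n" for i
        using Suc.prems(3)[of "Suc i"] that by simp
    qed
    then have "jet_le n \<rho> (2 ^ n * (?C * B) * (L / \<rho>)) (\<lambda>z. H (Suc j) (g z) * pd b g z) x"
      using c Suc.prems(2)[OF refl b] \<rho> by (intro jet_le_mult Ck_compose[where H=H, OF H])
    moreover have "2 ^ n * (?C * B) * (L / \<rho>) \<le> ?C' * B / \<rho>"
    proof -
      have "2 ^ n * (?C * B) * (L / \<rho>) = (2 ^ n * ?C * L) * B / \<rho>" by simp
      also have "\<dots> \<le> ?C' * B / \<rho>"
        using B \<rho> by (intro divide_right_mono mult_right_mono) auto
      finally show ?thesis .
    qed
    ultimately show ?thesis using jet_le_mono \<rho> e by simp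
  qed
  moreover have "\<bar>H j (g x)\<bar> \<le> ?C' * B"
    using mult_right_mono[OF compose_const_ge_1[of "Suc n" L] B(1)] B(2) by linarith
  ultimately show ?case by (simp del: compose_const.simps)
qed

lemma jet_le_iff_iter_partial:
  "jet_le n 1 A f x \<longleftrightarrow>
     (\<forall>bs. set bs \<subseteq> Basis \<longrightarrow> length bs \<le> n \<longrightarrow> \<bar>iter_partial bs f x\<bar> \<le> A)"
proof (induction n arbitrary: f)
  case 0
  then show ?case by auto
next
  case (Suc n)
  show ?case
  proof
    assume *: "jet_le (Suc n) 1 A f x"
    show "\<forall>bs. set bs \<subseteq> Basis \<longrightarrow> length bs \<le> Suc n \<longrightarrow> \<bar>iter_partial bs f x\<bar> \<le> A"
    proof (intro allI impI)
      fix bs :: "'a list" assume "set bs \<subseteq> Basis" "length bs \<le> Suc n"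
      then show "\<bar>iter_partial bs f x\<bar> \<le> A"
        using * Suc by (cases bs rule: rev_cases) (auto simp: iter_partial_snoc)
    qed
  next
    assume *: "\<forall>bs. set bs \<subseteq> Basis \<longrightarrow> length bs \<le> Suc n \<longrightarrow> \<bar>iter_partial bs f x\<bar> \<le> A"
    have "\<bar>iter_partial bs (pd b f) x\<bar> \<le> A" if "b \<in> Basis" "set bs \<subseteq> Basis" "length bs \<le> n" for b bs
      using *[rule_format, of "bs @ [b]"] that by (simp add: iter_partial_snoc)
    then show "jet_le (Suc n) 1 A f x"
      using Suc *[rule_format, of "[]"] by auto
  qed
qed

section \<open>Integrals over a compact parameter set\<close>

lemma mean_value_pd:
  assumes d: "\<And>z. f differentiable at z"
    and B: "\<And>z b. z \<in> closed_segment x y \<Longrightarrow> b \<in> Basis \<Longrightarrow> \<bar>pd b f z\<bar> \<le> B"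
  shows "\<bar>f y - f x\<bar> \<le> real DIM('a) * B * norm (y - x :: 'a::euclidean_space)"
proof -
  have "norm (f y - f x) \<le> (real DIM('a) * B) * norm (y - x)"
  proof (rule differentiable_bound)
    show "(f has_derivative (\<lambda>h. \<Sum>b\<in>Basis. (h \<bullet> b) * pd b f z)) (at z within closed_segment x y)" for z
      using has_derivative_pd[OF d] has_derivative_at_withinI by blast
    show "onorm (\<lambda>h. \<Sum>b\<in>Basis. (h \<bullet> b) * pd b f z) \<le> real DIM('a) * B" if z: "z \<in> closed_segment x y" for z
    proof (rule onorm_le)
      fix h :: 'a
      have "norm (\<Sum>b\<in>Basis. (h \<bullet> b) * pd b f z) \<le> (\<Sum>b\<in>(Basis::'a set). norm h * B)"
      proof (rule sum_norm_le)
        fix b :: 'a assume b: "b \<in> Basis"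
        show "norm ((h \<bullet> b) * pd b f z) \<le> norm h * B"
          unfolding real_norm_def abs_mult using B[OF z b] Basis_le_norm[OF b, of h]
          by (intro mult_mono) auto
      qed
      then show "norm (\<Sum>b\<in>Basis. (h \<bullet> b) * pd b f z) \<le> real DIM('a) * B * norm h"
        by (simp add: ac_simps)
    qed
  qed auto
  then show ?thesis by simp
qed

locale compact_finite_measure = finite_measure \<mu>
  for \<mu> :: "'b::euclidean_space measure" and S :: "'b set" +
  assumes compact_S: "compact S"
    and sets_eq: "sets \<mu> = sets (restrict_space borel S)"
begin

lemma space_eq: "space \<mu> = S"
  using sets_eq_imp_space_eq[OF sets_eq] by (simp add: space_restrict_space)

lemma measurable_continuous: "continuous_on S h \<Longrightarrow> (h :: 'b \<Rightarrow> real) \<in> borel_measurable \<mu>"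
  using borel_measurable_continuous_on_restrict measurable_cong_sets[OF sets_eq refl] by blast

lemma integrable_continuous:
  assumes "continuous_on S (h :: 'b \<Rightarrow> real)"
  shows "integrable \<mu> h"
proof -
  have "bounded (h ` S)"
    using compact_S assms compact_continuous_image compact_imp_bounded by blast
  then obtain B where "\<And>y. y \<in> S \<Longrightarrow> norm (h y) \<le> B"
    by (auto simp: bounded_iff)
  then show ?thesis
    using measurable_continuous[OF assms] by (intro integrable_const_bound[of _ B]) (auto simp: space_eq)
qed

lemma continuous_slice:
  assumes "continuous_on (UNIV \<times> S) (\<lambda>(x, y). g x y)"
  shows "continuous_on S (g x)"
proof -
  have "continuous_on S (\<lambda>y. (x, y))" by (intro continuous_intros)
  from continuous_on_compose2[OF assms this] show ?thesis by auto
qed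

lemma family_integrable: "Ck_family n S g \<Longrightarrow> integrable \<mu> (g x)"
  using Ck_family_continuous continuous_slice integrable_continuous by blast

lemma bound_along_sequence:
  fixes g :: "'a::euclidean_space \<Rightarrow> 'b \<Rightarrow> real"
  assumes c: "continuous_on (UNIV \<times> S) (\<lambda>(x, y). g x y)" and X: "X \<longlonglongrightarrow> x"
  obtains r B where "x \<in> cball x r" "\<And>k. X k \<in> cball x r" "\<And>z y. z \<in> cball x r \<Longrightarrow> y \<in> S \<Longrightarrow> \<bar>g z y\<bar> \<le> B"
proof -
  have "bounded (range X)" using X convergent_imp_bounded by blast
  then obtain r where r: "\<And>k. X k \<in> cball x r" unfolding bounded_any_center[of _ x] by auto
  have "0 \<le> r" using order_trans[OF zero_le_dist] r[of 0] by simp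
  have "compact ((\<lambda>(x, y). g x y) ` (cball x r \<times> S))"
    using compact_S by (intro compact_continuous_image compact_Times continuous_on_subset[OF c]) auto
  then have "bounded ((\<lambda>(x, y). g x y) ` (cball x r \<times> S))" by (rule compact_imp_bounded)
  then obtain B where "\<And>z y. z \<in> cball x r \<Longrightarrow> y \<in> S \<Longrightarrow> \<bar>g z y\<bar> \<le> B"
    by (force simp: bounded_iff)
  then show ?thesis using that r \<open>0 \<le> r\<close> by auto
qed

lemma continuous_integral:
  fixes g :: "'a::euclidean_space \<Rightarrow> 'b \<Rightarrow> real"
  assumes c: "continuous_on (UNIV \<times> S) (\<lambda>(x, y). g x y)"
  shows "continuous_on UNIV (\<lambda>x. LINT y|\<mu>. g x y)"
  unfolding continuous_on_sequentially
proof (intro ballI allI impI, elim conjE)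
  fix x :: 'a and X :: "nat \<Rightarrow> 'a" assume X: "X \<longlonglongrightarrow> x"
  obtain r B where r: "x \<in> cball x r" "\<And>k. X k \<in> cball x r" "\<And>z y. z \<in> cball x r \<Longrightarrow> y \<in> S \<Longrightarrow> \<bar>g z y\<bar> \<le> B"
    using bound_along_sequence[OF c X] by blast
  have "(\<lambda>n. LINT y|\<mu>. g (X n) y) \<longlonglongrightarrow> (LINT y|\<mu>. g x y)"
  proof (rule integral_dominated_convergence[where w="\<lambda>_. B"])
    show "g x \<in> borel_measurable \<mu>" "\<And>i. g (X i) \<in> borel_measurable \<mu>"
      by (auto intro!: measurable_continuous continuous_slice c)
    show "AE y in \<mu>. norm (g (X i) y) \<le> B" for i
      using r(2,3) by (intro AE_I2) (auto simp: space_eq)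
    show "AE y in \<mu>. (\<lambda>i. g (X i) y) \<longlonglongrightarrow> g x y"
    proof (rule AE_I2)
      fix y assume "y \<in> space \<mu>"
      then have y: "y \<in> S" by (simp add: space_eq)
      have "(\<lambda>i. (\<lambda>(x, y). g x y) (X i, y)) \<longlonglongrightarrow> (\<lambda>(x, y). g x y) (x, y)"
        using c y by (intro continuous_on_tendsto_compose[OF c] tendsto_intros X) auto
      then show "(\<lambda>i. g (X i) y) \<longlonglongrightarrow> g x y" by simp
    qed
  qed simp
  then show "((\<lambda>x. LINT y|\<mu>. g x y) \<circ> X) \<longlonglongrightarrow> (LINT y|\<mu>. g x y)"
    by (simp add: comp_def)
qed

text \<open>Dominated convergence for the difference quotients. The mean value theorem bounds them along a convergent
  sequence, since the partial derivatives are bounded on a ball times the compact parameter set.\<close>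

lemma has_derivative_integral_family:
  fixes g :: "'a::euclidean_space \<Rightarrow> 'b \<Rightarrow> real"
  assumes g: "Ck_family (Suc n) S g"
  shows "((\<lambda>x. LINT y|\<mu>. g x y) has_derivative
     (\<lambda>h. \<Sum>b\<in>Basis. (h \<bullet> b) * (LINT y|\<mu>. pd b (\<lambda>x. g x y) x))) (at x)"
proof -
  define p where "p b z y = pd b (\<lambda>x. g x y) z" for b z y
  have p: "continuous_on (UNIV \<times> S) (\<lambda>(x, y). p b x y)" if "b \<in> Basis" for b
    using Ck_family_continuous[OF Ck_family_pd[OF g that]] by (simp add: p_def)
  have D: "((\<lambda>x. g x y) has_derivative (\<lambda>h. \<Sum>b\<in>Basis. (h \<bullet> b) * p b z y)) (at z)" if "y \<in> S" for y z
    unfolding p_def using g that by (intro has_derivative_pd) auto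
  define q where "q z y = (g z y - g x y - (\<Sum>b\<in>Basis. ((z - x) \<bullet> b) * p b x y)) / norm (z - x)" for z y
  have i: "integrable \<mu> (g z)" "b \<in> Basis \<Longrightarrow> integrable \<mu> (p b z)" for z b
    using g p family_integrable continuous_slice integrable_continuous by (blast, metis)
  have iq: "integrable \<mu> (q z)" for z
    unfolding q_def by (intro integrable_divide Bochner_Integration.integrable_diff
        Bochner_Integration.integrable_sum integrable_mult_right i)
  have lim: "(\<lambda>k. LINT y|\<mu>. q (X k) y) \<longlonglongrightarrow> 0" if X: "X \<longlonglongrightarrow> x" "\<And>k. X k \<noteq> x" for X
  proof -
    have "\<exists>r B. x \<in> cball x r \<and> (\<forall>k. X k \<in> cball x r) \<and> (\<forall>z y. z \<in> cball x r \<longrightarrow> y \<in> S \<longrightarrow> \<bar>p b z y\<bar> \<le> B)"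
      if "b \<in> Basis" for b
      using bound_along_sequence[OF p[OF that] X(1)] by metis
    then obtain r B where rB: "\<And>b. b \<in> Basis \<Longrightarrow> x \<in> cball x (r b)"
        "\<And>b k. b \<in> Basis \<Longrightarrow> X k \<in> cball x (r b)"
        "\<And>b z y. b \<in> Basis \<Longrightarrow> z \<in> cball x (r b) \<Longrightarrow> y \<in> S \<Longrightarrow> \<bar>p b z y\<bar> \<le> B b"
      by metis
    define B' where "B' = Max (B ` Basis)"
    have B': "\<bar>p b z y\<bar> \<le> B'" if "b \<in> Basis" "z \<in> closed_segment x (X k)" "y \<in> S" for b z y k
    proof -
      have "closed_segment x (X k) \<subseteq> cball x (r b)"
        using rB(1,2)[OF that(1)] by (intro closed_segment_subset) auto
      then have "\<bar>p b z y\<bar> \<le> B b" using rB(3) that by blast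
      also have "B b \<le> B'" unfolding B'_def using that by (intro Max_ge) auto
      finally show ?thesis .
    qed
    have qb: "norm (q (X k) y) \<le> 2 * (real DIM('a) * B')" if y: "y \<in> S" for k y
    proof -
      have "\<bar>g (X k) y - g x y\<bar> \<le> real DIM('a) * B' * norm (X k - x)"
        by (rule mean_value_pd[where f="\<lambda>x. g x y"])
          (use g y B'[OF _ _ y] in \<open>auto simp: p_def\<close>)
      moreover have "\<bar>\<Sum>b\<in>Basis. ((X k - x) \<bullet> b) * p b x y\<bar> \<le> real DIM('a) * B' * norm (X k - x)"
      proof -
        have "\<bar>\<Sum>b\<in>Basis. ((X k - x) \<bullet> b) * p b x y\<bar> \<le> (\<Sum>b\<in>(Basis::'a set). norm (X k - x) * B')"
          using B'[OF _ ends_in_segment(1) y] Basis_le_norm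
          by (intro sum_abs[THEN order_trans] sum_mono) (auto simp: abs_mult intro!: mult_mono)
        then show ?thesis by (simp add: ac_simps)
      qed
      ultimately have "\<bar>g (X k) y - g x y - (\<Sum>b\<in>Basis. ((X k - x) \<bullet> b) * p b x y)\<bar>
          \<le> 2 * (real DIM('a) * B') * norm (X k - x)" by linarith
      then show ?thesis using X(2)[of k] by (simp add: q_def divide_le_eq)
    qed
    have "(\<lambda>k. LINT y|\<mu>. q (X k) y) \<longlonglongrightarrow> (LINT y|\<mu>. 0)"
    proof (rule integral_dominated_convergence[where w="\<lambda>_. 2 * (real DIM('a) * B')"])
      show "\<And>i. q (X i) \<in> borel_measurable \<mu>" using iq by auto
      show "AE y in \<mu>. norm (q (X i) y) \<le> 2 * (real DIM('a) * B')" for i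
        using qb by (auto simp: space_eq)
      show "AE y in \<mu>. (\<lambda>i. q (X i) y) \<longlonglongrightarrow> 0"
      proof (rule AE_I2)
        fix y assume "y \<in> space \<mu>"
        then have y: "y \<in> S" by (simp add: space_eq)
        have "(\<lambda>z. q z y) \<midarrow>x\<rightarrow> 0"
          using D[OF y, of x] unfolding has_derivative_at2 q_def by (simp add: divide_inverse mult.commute diff_diff_eq)
        then show "(\<lambda>i. q (X i) y) \<longlonglongrightarrow> 0"
          using X unfolding tendsto_at_iff_sequentially comp_def by auto
      qed
    qed auto
    then show ?thesis by simp
  qed
  have e: "(LINT y|\<mu>. q z y) = (1 / norm (z - x)) * ((LINT y|\<mu>. g z y) - ((LINT y|\<mu>. g x y) +
      (\<Sum>b\<in>Basis. ((z - x) \<bullet> b) * (LINT y|\<mu>. p b x y))))" for z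
  proof -
    have "(LINT y|\<mu>. q z y) = ((LINT y|\<mu>. g z y) - (LINT y|\<mu>. g x y) -
       (LINT y|\<mu>. (\<Sum>b\<in>Basis. ((z - x) \<bullet> b) * p b x y))) / norm (z - x)"
      unfolding q_def by (simp add: i Bochner_Integration.integral_diff)
    also have "(LINT y|\<mu>. (\<Sum>b\<in>Basis. ((z - x) \<bullet> b) * p b x y))
        = (\<Sum>b\<in>Basis. ((z - x) \<bullet> b) * (LINT y|\<mu>. p b x y))"
      by (subst Bochner_Integration.integral_sum) (auto simp: i)
    finally show ?thesis by (simp add: diff_diff_eq)
  qed
  have "bounded_linear (\<lambda>h. \<Sum>b\<in>Basis. (h \<bullet> b) * (LINT y|\<mu>. p b x y))"
    by (intro bounded_linear_sum bounded_linear_mult_const bounded_linear_inner_left)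
  moreover have "(\<lambda>z. (1 / norm (z - x)) *\<^sub>R ((LINT y|\<mu>. g z y) - ((LINT y|\<mu>. g x y) +
      (\<Sum>b\<in>Basis. ((z - x) \<bullet> b) * (LINT y|\<mu>. p b x y))))) \<midarrow>x\<rightarrow> 0"
    unfolding real_scaleR_def e[symmetric] tendsto_at_iff_sequentially comp_def using lim by auto
  ultimately have "((\<lambda>x. LINT y|\<mu>. g x y) has_derivative
     (\<lambda>h. \<Sum>b\<in>Basis. (h \<bullet> b) * (LINT y|\<mu>. p b x y))) (at x)"
    unfolding has_derivative_at2 by blast
  then show ?thesis by (simp add: p_def)
qed

lemma pd_integral_family:
  fixes g :: "'a::euclidean_space \<Rightarrow> 'b \<Rightarrow> real"
  assumes "Ck_family (Suc n) S g" "b \<in> Basis"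
  shows "pd b (\<lambda>x. LINT y|\<mu>. g x y) = (\<lambda>x. LINT y|\<mu>. pd b (\<lambda>x. g x y) x)"
proof
  fix x
  have "pd b (\<lambda>x. LINT y|\<mu>. g x y) x = (\<Sum>a\<in>Basis. (b \<bullet> a) * (LINT y|\<mu>. pd a (\<lambda>x. g x y) x))"
    by (rule pd_eqI[OF has_derivative_integral_family[OF assms(1)]])
  also have "\<dots> = (\<Sum>a\<in>Basis. if a = b then LINT y|\<mu>. pd a (\<lambda>x. g x y) x else 0)"
    using assms(2) by (intro sum.cong) (auto simp: inner_Basis)
  also have "\<dots> = (LINT y|\<mu>. pd b (\<lambda>x. g x y) x)" using assms(2) by simp
  finally show "pd b (\<lambda>x. LINT y|\<mu>. g x y) x = (LINT y|\<mu>. pd b (\<lambda>x. g x y) x)" .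
qed

lemma Ck_integral:
  fixes g :: "'a::euclidean_space \<Rightarrow> 'b \<Rightarrow> real"
  assumes "Ck_family n S g"
  shows "Ck n (\<lambda>x. LINT y|\<mu>. g x y)"
  using assms
proof (induction n arbitrary: g)
  case 0
  then show ?case using continuous_integral by (auto simp: Ck_0)
next
  case (Suc n)
  show ?case
  proof (rule Ck_SucI)
    show "(\<lambda>x. LINT y|\<mu>. g x y) differentiable at x" for x
      using has_derivative_integral_family[OF Suc.prems] differentiable_def by blast
    show "Ck n (pd b (\<lambda>x. LINT y|\<mu>. g x y))" if "b \<in> Basis" for b
      unfolding pd_integral_family[OF Suc.prems that]
      using Suc.prems that by (intro Suc.IH) auto
  qed
qed

lemma jet_le_integral:
  fixes g :: "'a::euclidean_space \<Rightarrow> 'b \<Rightarrow> real"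
  assumes "Ck_family n S g" "integrable \<mu> A" "\<And>y. y \<in> S \<Longrightarrow> jet_le n \<rho> (A y) (\<lambda>x. g x y) x"
  shows "jet_le n \<rho> (LINT y|\<mu>. A y) (\<lambda>x. LINT y|\<mu>. g x y) x"
  using assms
proof (induction n arbitrary: g A)
  have v: "\<bar>LINT y|\<mu>. g x y\<bar> \<le> (LINT y|\<mu>. A y)"
    if "Ck_family n S g" "integrable \<mu> A" "\<And>y. y \<in> S \<Longrightarrow> jet_le n \<rho> (A y) (\<lambda>x. g x y) x"
    for A n and g :: "'a \<Rightarrow> 'b \<Rightarrow> real"
  proof -
    have "\<bar>LINT y|\<mu>. g x y\<bar> \<le> (LINT y|\<mu>. \<bar>g x y\<bar>)" by (rule integral_abs_bound)
    also have "\<dots> \<le> (LINT y|\<mu>. A y)"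
      using that jet_le_abs[OF that(3)] family_integrable[OF that(1)]
      by (intro integral_mono integrable_abs) (auto simp: space_eq)
    finally show ?thesis .
  qed
  {
    case 0
    then show ?case using v[OF 0] by simp
  next
    case (Suc n)
    have "jet_le n \<rho> ((LINT y|\<mu>. A y) / \<rho>) (pd b (\<lambda>x. LINT y|\<mu>. g x y)) x" if b: "b \<in> Basis" for b
    proof -
      have "jet_le n \<rho> (LINT y|\<mu>. A y / \<rho>) (\<lambda>x. LINT y|\<mu>. pd b (\<lambda>x. g x y) x) x"
        using Suc.prems b by (intro Suc.IH) auto
      then show ?thesis by (simp add: pd_integral_family[OF Suc.prems(1) b])
    qed
    then show ?case using v[OF Suc.prems] by simp
  }
qed

end

section \<open>Taylor polynomials\<close>

lemma smooth_fun_iff_Ck: "smooth_fun f \<longleftrightarrow> (\<forall>n. Ck n f)"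
  using smooth_fun_imp_Ck Ck_imp_smooth_fun by blast

lemma smooth_fun_pd: "smooth_fun f \<Longrightarrow> b \<in> Basis \<Longrightarrow> smooth_fun (pd b f)"
  unfolding smooth_fun_iff_Ck using Ck_pd by blast

lemma has_derivative_line:
  assumes "f differentiable at (p + t *\<^sub>R a)"
  shows "((\<lambda>t. f (p + t *\<^sub>R a)) has_real_derivative pd a f (p + t *\<^sub>R a)) (at t)"
proof -
  have F: "(f has_derivative frechet_derivative f (at (p + t *\<^sub>R a))) (at (p + t *\<^sub>R a))"
    using assms frechet_derivative_works by blast
  have "((\<lambda>t. p + t *\<^sub>R a) has_derivative (\<lambda>h. h *\<^sub>R a)) (at t)"
    by (auto intro!: derivative_eq_intros)
  from has_derivative_compose[OF this F]
  have "((\<lambda>t. f (p + t *\<^sub>R a)) has_derivative (\<lambda>h. frechet_derivative f (at (p + t *\<^sub>R a)) (h *\<^sub>R a))) (at t)" .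
  moreover have "frechet_derivative f (at (p + t *\<^sub>R a)) (h *\<^sub>R a) = pd a f (p + t *\<^sub>R a) * h" for h
    using linear_cmul[OF has_derivative_linear[OF F]] by (simp add: pd_def)
  ultimately show ?thesis by (simp add: has_field_derivative_def)
qed

text \<open>The second difference is symmetric in the two directions, while the mean value theorem, applied first in
  one direction and then in the other, expresses it by either mixed partial derivative.\<close>

lemma second_difference_mean_value:
  assumes f: "Ck (Suc (Suc 0)) f" and ab: "a \<in> Basis" "b \<in> Basis" and h: "0 < h"
  obtains s t where "0 < s" "s < h" "0 < t" "t < h"
    "f (x + h *\<^sub>R a + h *\<^sub>R b) - f (x + h *\<^sub>R a) - f (x + h *\<^sub>R b) + f x
       = h * h * pd b (pd a f) (x + s *\<^sub>R a + t *\<^sub>R b)"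
proof -
  have d: "f differentiable at z" "pd a f differentiable at z" for z
    using f ab by (auto simp: Ck_Suc)
  define \<Phi> where "\<Phi> t = f ((x + h *\<^sub>R b) + t *\<^sub>R a) - f (x + t *\<^sub>R a)" for t
  have "(\<Phi> has_real_derivative (pd a f ((x + h *\<^sub>R b) + t *\<^sub>R a) - pd a f (x + t *\<^sub>R a))) (at t)" for t
    unfolding \<Phi>_def by (intro DERIV_diff has_derivative_line d)
  then have "\<exists>s>0. s < h \<and> \<Phi> h - \<Phi> 0 = (h - 0) * (pd a f ((x + h *\<^sub>R b) + s *\<^sub>R a) - pd a f (x + s *\<^sub>R a))"
    by (intro MVT2 h)
  then obtain s where s: "0 < s" "s < h"
    "\<Phi> h - \<Phi> 0 = h * (pd a f ((x + h *\<^sub>R b) + s *\<^sub>R a) - pd a f (x + s *\<^sub>R a))" by auto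
  have "((\<lambda>t. pd a f ((x + s *\<^sub>R a) + t *\<^sub>R b)) has_real_derivative
      pd b (pd a f) ((x + s *\<^sub>R a) + t *\<^sub>R b)) (at t)" for t
    by (intro has_derivative_line d)
  then have "\<exists>t>0. t < h \<and> pd a f ((x + s *\<^sub>R a) + h *\<^sub>R b) - pd a f ((x + s *\<^sub>R a) + 0 *\<^sub>R b)
      = (h - 0) * pd b (pd a f) ((x + s *\<^sub>R a) + t *\<^sub>R b)"
    by (intro MVT2 h)
  then obtain t where "0 < t" "t < h" "pd a f ((x + s *\<^sub>R a) + h *\<^sub>R b) - pd a f (x + s *\<^sub>R a)
      = h * pd b (pd a f) ((x + s *\<^sub>R a) + t *\<^sub>R b)" by auto
  with s show ?thesis by (intro that[of s t]) (auto simp: \<Phi>_def algebra_simps)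
qed

lemma pd_commute:
  assumes f: "Ck (Suc (Suc 0)) f" and ab: "a \<in> Basis" "b \<in> Basis"
  shows "pd a (pd b f) = pd b (pd a f)"
proof
  fix x
  have "\<exists>p q. dist p x \<le> 2 * h \<and> dist q x \<le> 2 * h \<and> pd b (pd a f) p = pd a (pd b f) q" if h: "0 < h" for h
  proof -
    obtain s t where st: "0 < s" "s < h" "0 < t" "t < h"
      "f (x + h *\<^sub>R a + h *\<^sub>R b) - f (x + h *\<^sub>R a) - f (x + h *\<^sub>R b) + f x
       = h * h * pd b (pd a f) (x + s *\<^sub>R a + t *\<^sub>R b)"
      by (rule second_difference_mean_value[OF f ab h])
    obtain s' t' where st': "0 < s'" "s' < h" "0 < t'" "t' < h"
      "f (x + h *\<^sub>R b + h *\<^sub>R a) - f (x + h *\<^sub>R b) - f (x + h *\<^sub>R a) + f x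
       = h * h * pd a (pd b f) (x + s' *\<^sub>R b + t' *\<^sub>R a)"
      by (rule second_difference_mean_value[OF f ab(2,1) h])
    have "h * h * pd b (pd a f) (x + s *\<^sub>R a + t *\<^sub>R b) = h * h * pd a (pd b f) (x + s' *\<^sub>R b + t' *\<^sub>R a)"
      unfolding st(5)[symmetric] st'(5)[symmetric] by (simp add: algebra_simps)
    then have "pd b (pd a f) (x + s *\<^sub>R a + t *\<^sub>R b) = pd a (pd b f) (x + s' *\<^sub>R b + t' *\<^sub>R a)"
      using h by simp
    moreover have "dist (x + s *\<^sub>R c + t *\<^sub>R e) x \<le> 2 * h"
      if "0 < s" "s < h" "0 < t" "t < h" "c \<in> Basis" "e \<in> Basis" for s t c e
      using norm_triangle_ineq[of "s *\<^sub>R c" "t *\<^sub>R e"] that by (simp add: dist_norm add.assoc)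
    ultimately show ?thesis using st(1-4) st'(1-4) ab
      by (intro exI[of _ "x + s *\<^sub>R a + t *\<^sub>R b"] exI[of _ "x + s' *\<^sub>R b + t' *\<^sub>R a"]) simp
  qed
  then have "\<exists>p q. dist p x \<le> 2 * inverse (real (Suc n)) \<and> dist q x \<le> 2 * inverse (real (Suc n)) \<and>
      pd b (pd a f) p = pd a (pd b f) q" for n
    by simp
  then obtain p q where pq: "\<And>n. dist (p n) x \<le> 2 * inverse (real (Suc n))"
      "\<And>n. dist (q n) x \<le> 2 * inverse (real (Suc n))"
      "\<And>n. pd b (pd a f) (p n) = pd a (pd b f) (q n)"
    by metis
  have z: "(\<lambda>n. 2 * inverse (real (Suc n))) \<longlonglongrightarrow> 0"
    using tendsto_mult_right_zero[OF LIMSEQ_inverse_real_of_nat] by simp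
  have l: "r \<longlonglongrightarrow> x" if "\<And>n. dist (r n) x \<le> 2 * inverse (real (Suc n))" for r
  proof (rule tendstoI)
    fix e :: real assume "0 < e"
    with order_tendstoD(2)[OF z] have "\<forall>\<^sub>F n in sequentially. 2 * inverse (real (Suc n)) < e" by blast
    then show "\<forall>\<^sub>F n in sequentially. dist (r n) x < e"
      by eventually_elim (use that le_less_trans in blast)
  qed
  have c: "continuous_on UNIV (pd a (pd b f))" "continuous_on UNIV (pd b (pd a f))"
    using f ab by (auto simp: Ck_Suc Ck_0)
  have "(\<lambda>n. pd b (pd a f) (p n)) \<longlonglongrightarrow> pd b (pd a f) x" "(\<lambda>n. pd a (pd b f) (q n)) \<longlonglongrightarrow> pd a (pd b f) x"
    by (auto intro!: continuous_on_tendsto_compose[OF c(2)] continuous_on_tendsto_compose[OF c(1)] l pq(1,2))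
  then show "pd a (pd b f) x = pd b (pd a f) x"
    unfolding pq(3) using LIMSEQ_unique by blast
qed

lemma pd_diff:
  assumes "f differentiable at x" "g differentiable at x"
  shows "pd b (\<lambda>x. f x - g x) x = pd b f x - pd b g x"
proof -
  have "((\<lambda>x. f x - g x) has_derivative
      (\<lambda>h. frechet_derivative f (at x) h - frechet_derivative g (at x) h)) (at x)"
    using assms by (intro has_derivative_diff) (auto simp: frechet_derivative_works)
  from pd_eqI[OF this] show ?thesis by (simp add: pd_def)
qed

lemma pd_sum:
  assumes "\<And>i. i \<in> I \<Longrightarrow> f i differentiable at x"
  shows "pd b (\<lambda>x. \<Sum>i\<in>I. f i x) x = (\<Sum>i\<in>I. pd b (f i) x)"
proof -
  have "((\<lambda>x. \<Sum>i\<in>I. f i x) has_derivative (\<lambda>h. \<Sum>i\<in>I. frechet_derivative (f i) (at x) h)) (at x)"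
    using assms by (intro has_derivative_sum) (auto simp: frechet_derivative_works)
  from pd_eqI[OF this] show ?thesis by (simp add: pd_def)
qed

text \<open>The \<open>j\<close>-th derivative of \<open>t \<mapsto> f (y + t h)\<close> at \<open>t = 0\<close>.\<close>

primrec directional_deriv :: "nat \<Rightarrow> ('a::euclidean_space \<Rightarrow> real) \<Rightarrow> 'a \<Rightarrow> 'a \<Rightarrow> real" where
  "directional_deriv 0 f y h = f y"
| "directional_deriv (Suc j) f y h = (\<Sum>b\<in>Basis. (h \<bullet> b) * directional_deriv j (pd b f) y h)"

definition taylor :: "nat \<Rightarrow> ('a::euclidean_space \<Rightarrow> real) \<Rightarrow> 'a \<Rightarrow> 'a \<Rightarrow> real" where
  "taylor m f y x = (\<Sum>j<m. directional_deriv j f y (x - y) / fact j)"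

lemma Ck_family_displacement: "Ck_family n S (\<lambda>x y. (x - y) \<bullet> b)"
  unfolding inner_diff_left
  by (intro Ck_family_diff Ck_imp_family Ck_inner Ck_family_parameter continuous_intros)

lemma Ck_family_directional_deriv:
  assumes "smooth_fun f"
  shows "Ck_family n S (\<lambda>x y. directional_deriv j f y (x - y))"
  using assms
proof (induction j arbitrary: f)
  case 0
  have "continuous_on S f"
    using 0 Ck_continuous continuous_on_subset unfolding smooth_fun_iff_Ck by blast
  then show ?case by (simp add: Ck_family_parameter)
next
  case (Suc j)
  then show ?case
    by (auto intro!: Ck_family_sum Ck_family_mult Ck_family_displacement smooth_fun_pd)
qed

lemma Ck_family_taylor:
  assumes "smooth_fun f"
  shows "Ck_family n S (\<lambda>x y. taylor m f y x)"
  unfolding taylor_def divide_inverse mult.commute[of _ "inverse _"]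
  by (intro Ck_family_sum Ck_family_cmult Ck_family_directional_deriv assms)

lemma Ck_taylor: "smooth_fun f \<Longrightarrow> Ck n (taylor m f y)"
  using Ck_family_section[OF Ck_family_taylor[of f n UNIV m], of y] by simp

text \<open>Since partial derivatives commute, each of the \<open>Suc j\<close> factors of the homogeneous polynomial
  contributes the same term to its derivative.\<close>

lemma pd_directional_deriv:
  assumes "smooth_fun f" "b \<in> Basis"
  shows "pd b (\<lambda>x. directional_deriv (Suc j) f y (x - y)) x = real (Suc j) * directional_deriv j (pd b f) y (x - y)"
  using assms
proof (induction j arbitrary: f x)
  have dd: "(\<lambda>x. directional_deriv j f y (x - y)) differentiable at x" if "smooth_fun f" for j f x
    using Ck_family_section[OF Ck_family_directional_deriv[OF that, of "Suc 0" UNIV j], of y]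
    by (simp add: Ck_Suc)
  have di: "(\<lambda>x. (x - y) \<bullet> a) differentiable at x" for a x
    by (auto intro!: derivative_intros)
  have pi: "pd b (\<lambda>x. (x - y) \<bullet> a) x = b \<bullet> a" for a x
    by (rule pd_eqI) (auto intro!: derivative_eq_intros)
  have step: "pd b (\<lambda>x. directional_deriv (Suc j) f y (x - y)) x
      = (\<Sum>a\<in>Basis. ((x - y) \<bullet> a) * pd b (\<lambda>x. directional_deriv j (pd a f) y (x - y)) x)
        + directional_deriv j (pd b f) y (x - y)" if f: "smooth_fun f" for f j x
  proof -
    have "pd b (\<lambda>x. directional_deriv (Suc j) f y (x - y)) x
      = (\<Sum>a\<in>Basis. pd b (\<lambda>x. ((x - y) \<bullet> a) * directional_deriv j (pd a f) y (x - y)) x)"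
      unfolding directional_deriv.simps
      by (intro pd_sum differentiable_mult di dd smooth_fun_pd f)
    also have "\<dots> = (\<Sum>a\<in>Basis. ((x - y) \<bullet> a) * pd b (\<lambda>x. directional_deriv j (pd a f) y (x - y)) x
        + (b \<bullet> a) * directional_deriv j (pd a f) y (x - y))"
      by (intro sum.cong refl) (simp add: pd_mult di dd smooth_fun_pd f pi)
    also have "\<dots> = (\<Sum>a\<in>Basis. ((x - y) \<bullet> a) * pd b (\<lambda>x. directional_deriv j (pd a f) y (x - y)) x)
        + (\<Sum>a\<in>Basis. if a = b then directional_deriv j (pd a f) y (x - y) else 0)"
      unfolding sum.distrib
      by (intro arg_cong2[where f="(+)"] sum.cong refl) (use assms(2) in \<open>auto simp: inner_Basis\<close>)
    also have "(\<Sum>a\<in>Basis. if a = b then directional_deriv j (pd a f) y (x - y) else 0)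
        = directional_deriv j (pd b f) y (x - y)"
      using assms(2) by simp
    finally show ?thesis .
  qed
  {
    case 0
    then show ?case by (subst step) auto
  next
    case (Suc j)
    have "pd b (\<lambda>x. directional_deriv (Suc (Suc j)) f y (x - y)) x
      = (\<Sum>a\<in>Basis. ((x - y) \<bullet> a) * (real (Suc j) * directional_deriv j (pd b (pd a f)) y (x - y)))
        + directional_deriv (Suc j) (pd b f) y (x - y)"
      unfolding step[OF Suc.prems(1)] using Suc.prems
      by (intro arg_cong2[where f="(+)"] sum.cong refl arg_cong2[where f="(*)"] Suc.IH smooth_fun_pd)
    also have "(\<Sum>a\<in>Basis. ((x - y) \<bullet> a) * (real (Suc j) * directional_deriv j (pd b (pd a f)) y (x - y)))
        = (\<Sum>a\<in>Basis. real (Suc j) * (((x - y) \<bullet> a) * directional_deriv j (pd a (pd b f)) y (x - y)))"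
      using Suc.prems by (intro sum.cong refl) (auto simp: pd_commute[of f b] smooth_fun_iff_Ck)
    also have "\<dots> = real (Suc j) * directional_deriv (Suc j) (pd b f) y (x - y)"
      by (simp add: sum_distrib_left)
    finally show ?case by (simp add: algebra_simps)
  }
qed

text \<open>Differentiation turns Taylor polynomials of \<open>f\<close> into Taylor polynomials, of one degree less,
  of the derivatives of \<open>f\<close>. The estimates below are inductions on the degree through this
  identity, without any manipulation of coefficients.\<close>

lemma pd_taylor:
  assumes f: "smooth_fun f" and b: "b \<in> Basis"
  shows "pd b (taylor (Suc m) f y) = taylor m (pd b f) y"
proof
  fix x
  have d: "(\<lambda>x. directional_deriv j f y (x - y)) differentiable at x" for j x
    using Ck_family_section[OF Ck_family_directional_deriv[OF f, of "Suc 0" UNIV j], of y]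
    by (simp add: Ck_Suc)
  have q: "pd b (\<lambda>x. directional_deriv j f y (x - y) / fact j) x
      = inverse (fact j) * pd b (\<lambda>x. directional_deriv j f y (x - y)) x" for j
    using pd_mult[of "\<lambda>x. inverse (fact j)" x, OF _ d[of j x], of b]
    by (simp add: divide_inverse mult.commute)
  have "pd b (taylor (Suc m) f y) x = (\<Sum>j<Suc m. pd b (\<lambda>x. directional_deriv j f y (x - y) / fact j) x)"
    unfolding taylor_def[abs_def] by (intro pd_sum) (auto simp: divide_inverse intro!: differentiable_mult d)
  also have "\<dots> = (\<Sum>j<m. pd b (\<lambda>x. directional_deriv (Suc j) f y (x - y) / fact (Suc j)) x)"
    by (subst sum.lessThan_Suc_shift) (simp del: fact_Suc directional_deriv.simps(2) add: directional_deriv.simps(1))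
  also have "\<dots> = (\<Sum>j<m. directional_deriv j (pd b f) y (x - y) / fact j)"
    unfolding q pd_directional_deriv[OF f b] by (intro sum.cong refl) (simp add: field_simps del: of_nat_Suc)
  finally show "pd b (taylor (Suc m) f y) x = taylor m (pd b f) y x" by (simp add: taylor_def)
qed

lemma taylor_0 [simp]: "taylor 0 f y x = 0"
  by (simp add: taylor_def)

lemma taylor_center: "taylor (Suc m) f y y = f y"
  unfolding taylor_def by (subst sum.lessThan_Suc_shift) simp

text \<open>The remainder vanishes at \<open>y\<close>, and its derivatives are remainders of one degree less. On the
  scale \<open>r\<close> of the distance to the centre, the mean value theorem gains the factor
  \<open>r\<close> that each derivative costs.\<close>

lemma jet_le_taylor_remainder:
  fixes x y :: "'a::euclidean_space"
  assumes "smooth_fun f" "\<And>z. z \<in> closed_segment y x \<Longrightarrow> jet_le m 1 B f z" "norm (x - y) \<le> r" "0 < r"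
  shows "jet_le m r (real DIM('a) ^ m * B * r ^ m) (\<lambda>z. f z - taylor m f y z) x"
  using assms(1-3)
proof (induction m arbitrary: f x)
  case 0
  then show ?case using jet_le_abs[OF 0(2)[of x]] by simp
next
  case (Suc m)
  let ?d = "real DIM('a)"
  let ?A = "?d ^ m * B * r ^ m"
  define g where "g z = f z - taylor (Suc m) f y z" for z
  have B: "0 \<le> B" using jet_le_nonneg[OF Suc.prems(2)[of x]] by simp
  have fd: "f differentiable at z" "taylor (Suc m) f y differentiable at z" for z
    using Suc.prems(1) Ck_taylor[OF Suc.prems(1), of "Suc 0"]
    by (auto simp: smooth_fun_iff_Ck Ck_Suc intro: Ck_differentiable)
  have pg: "pd b g = (\<lambda>z. pd b f z - taylor m (pd b f) y z)" if "b \<in> Basis" for b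
    unfolding g_def[abs_def] pd_taylor[OF Suc.prems(1) that, symmetric] by (intro ext pd_diff fd)
  have jg: "jet_le m r ?A (pd b g) z" if z: "z \<in> closed_segment y x" and b: "b \<in> Basis" for z b
    unfolding pg[OF b]
  proof (rule Suc.IH[OF smooth_fun_pd[OF Suc.prems(1) b]])
    have "closed_segment y z \<subseteq> closed_segment y x" using z by (simp add: closed_segment_subset)
    then show "jet_le m 1 B (pd b f) w" if "w \<in> closed_segment y z" for w
      using jet_le_pd[OF Suc.prems(2) b] that by auto
    show "norm (z - y) \<le> r"
      using segment_bound1[OF z] Suc.prems(3) by (simp add: norm_minus_commute)
  qed
  have "\<bar>g x - g y\<bar> \<le> ?d * ?A * norm (x - y)"
  proof (rule mean_value_pd)
    show "g differentiable at z" for z unfolding g_def[abs_def] by (intro differentiable_diff fd)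
    show "\<bar>pd b g z\<bar> \<le> ?A" if "z \<in> closed_segment y x" "b \<in> Basis" for z b
      using jet_le_abs[OF jg[OF that]] .
  qed
  also have "\<dots> \<le> ?d * ?A * r" using B Suc.prems(3) assms(4) by (intro mult_left_mono) auto
  finally have "\<bar>g x\<bar> \<le> ?d ^ Suc m * B * r ^ Suc m" by (simp add: g_def taylor_center ac_simps)
  moreover have "jet_le m r (?d ^ Suc m * B * r ^ Suc m / r) (pd b g) x" if b: "b \<in> Basis" for b
  proof (rule jet_le_mono[OF jg[OF _ b]])
    have "1 * ?A \<le> ?d * ?A"
      using B assms(4) DIM_ge_Suc0[where 'a='a] by (intro mult_right_mono) auto
    then show "?A \<le> ?d ^ Suc m * B * r ^ Suc m / r"
      using assms(4) by (simp add: ac_simps)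
  qed (use assms(4) in auto)
  ultimately show ?case by (simp add: g_def[abs_def])
qed

text \<open>In the recursion, the first summand bounds the value at the new centre, the second the variation along a
  segment on which the distances to the centres grow by a factor of at most \<open>3\<close>, and the third
  makes the constants increasing.\<close>

primrec recenter_const :: "real \<Rightarrow> nat \<Rightarrow> real" where
  "recenter_const d 0 = 0"
| "recenter_const d (Suc m) = d ^ Suc m * 2 ^ Suc m + d * recenter_const d m * 3 ^ m + recenter_const d m"

lemma recenter_const_nonneg: "0 \<le> d \<Longrightarrow> 0 \<le> recenter_const d m"
  by (induction m) auto

text \<open>Whitney's compatibility of Taylor polynomials at two centres. The difference is a polynomial whose value
  at \<open>y\<close> is a Taylor remainder and whose derivatives are differences of the same kind, so an
  induction on the degree and the mean value theorem suffice.\<close>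

lemma jet_le_taylor_recenter:
  fixes x y p :: "'a::euclidean_space"
  assumes "smooth_fun f" "\<And>z. z \<in> closed_segment p y \<Longrightarrow> jet_le m 1 B f z"
    "norm (x - y) \<le> r" "norm (x - p) \<le> r" "0 < r"
  shows "jet_le m r (recenter_const (real DIM('a)) m * B * r ^ m) (\<lambda>z. taylor m f y z - taylor m f p z) x"
  using assms
proof (induction m arbitrary: f x r)
  case 0
  then show ?case by simp
next
  case (Suc m)
  let ?d = "real DIM('a)"
  let ?C = "recenter_const ?d m" and ?C' = "recenter_const ?d (Suc m)"
  define Q where "Q z = taylor (Suc m) f y z - taylor (Suc m) f p z" for z
  have B: "0 \<le> B" using jet_le_nonneg[OF Suc.prems(2)[of p]] by simp
  note r = Suc.prems(3-5)
  have yp: "norm (y - p) \<le> 2 * r"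
    using r norm_triangle_ineq4[of "x - p" "x - y"] by simp
  have fd: "taylor (Suc m) f w differentiable at z" for z w
    using Ck_taylor[OF Suc.prems(1), of "Suc 0"] by (auto simp: Ck_Suc)
  have pQ: "pd b Q = (\<lambda>z. taylor m (pd b f) y z - taylor m (pd b f) p z)" if "b \<in> Basis" for b
    unfolding Q_def[abs_def] pd_taylor[OF Suc.prems(1) that, symmetric] by (intro ext pd_diff fd)
  have jQ: "jet_le m t (?C * B * t ^ m) (pd b Q) z"
    if b: "b \<in> Basis" and "norm (z - y) \<le> t" "norm (z - p) \<le> t" "0 < t" for z b t
    unfolding pQ[OF b] using jet_le_pd[OF Suc.prems(2) b]
    by (intro Suc.IH smooth_fun_pd[OF Suc.prems(1) b] that) auto
  have "\<bar>Q x - Q y\<bar> \<le> ?d * (?C * B * (3 * r) ^ m) * norm (x - y)"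
  proof (rule mean_value_pd)
    show "Q differentiable at z" for z unfolding Q_def[abs_def] by (intro differentiable_diff fd)
    fix z b assume z: "z \<in> closed_segment y x" and b: "b \<in> (Basis :: 'a set)"
    have zy: "norm (z - y) \<le> r"
      using segment_bound1[OF z] r by (simp add: norm_minus_commute)
    then have "norm (z - p) \<le> 3 * r"
      using yp norm_triangle_ineq[of "z - y" "y - p"] by simp
    then show "\<bar>pd b Q z\<bar> \<le> ?C * B * (3 * r) ^ m"
      using zy r by (intro jet_le_abs[OF jQ[OF b]]) auto
  qed
  also have "\<dots> \<le> ?d * (?C * B * (3 * r) ^ m) * r"
    using r B by (intro mult_left_mono) (auto simp: recenter_const_nonneg)
  finally have 1: "\<bar>Q x - Q y\<bar> \<le> ?d * ?C * 3 ^ m * B * r ^ Suc m"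
    by (simp add: power_mult_distrib ac_simps)
  (* At y, the value of Q is the remainder at y of the Taylor polynomial centred at p. *)
  have "jet_le (Suc m) (2 * r) (?d ^ Suc m * B * (2 * r) ^ Suc m) (\<lambda>z. f z - taylor (Suc m) f p z) y"
    using Suc.prems yp by (intro jet_le_taylor_remainder) auto
  from jet_le_abs[OF this] have 2: "\<bar>Q y\<bar> \<le> ?d ^ Suc m * 2 ^ Suc m * B * r ^ Suc m"
    unfolding Q_def taylor_center power_mult_distrib by (simp only: ac_simps)
  have "?C' * B * r ^ Suc m = ?d ^ Suc m * 2 ^ Suc m * B * r ^ Suc m + ?d * ?C * 3 ^ m * B * r ^ Suc m + ?C * B * r ^ Suc m"
    unfolding recenter_const.simps by (simp only: distrib_right)
  moreover have "0 \<le> ?C * B * r ^ Suc m" using B r by (simp add: recenter_const_nonneg)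
  ultimately have "\<bar>Q x\<bar> \<le> ?C' * B * r ^ Suc m" using 1 2 by linarith
  moreover have "jet_le m r (?C' * B * r ^ Suc m / r) (pd b Q) x" if b: "b \<in> Basis" for b
  proof (rule jet_le_mono[OF jQ[OF b]])
    have "?C \<le> ?C'" by (simp add: recenter_const_nonneg)
    then have "?C * (B * r ^ m) \<le> ?C' * (B * r ^ m)" using B r by (intro mult_right_mono) auto
    then show "?C * B * r ^ m \<le> ?C' * B * r ^ Suc m / r" using r by (simp only: ac_simps) simp
  qed (use r in auto)
  ultimately show ?case by (simp add: Q_def[abs_def] del: recenter_const.simps)
qed

lemma directional_deriv_bound:
  fixes h y :: "'a::euclidean_space"
  assumes "jet_le j 1 B f y"
  shows "\<bar>directional_deriv j f y h\<bar> \<le> (real DIM('a) * norm h) ^ j * B"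
  using assms
proof (induction j arbitrary: f)
  case (Suc j)
  have B: "0 \<le> B" using jet_le_nonneg[OF Suc.prems] .
  have "\<bar>directional_deriv (Suc j) f y h\<bar> \<le> (\<Sum>b\<in>(Basis::'a set). norm h * ((real DIM('a) * norm h) ^ j * B))"
    unfolding directional_deriv.simps
  proof (rule order_trans[OF sum_abs], rule sum_mono)
    fix b :: 'a assume b: "b \<in> Basis"
    show "\<bar>h \<bullet> b * directional_deriv j (pd b f) y h\<bar> \<le> norm h * ((real DIM('a) * norm h) ^ j * B)"
      unfolding abs_mult using Basis_le_norm[OF b, of h] Suc b by (intro mult_mono) auto
  qed
  then show ?case by (simp add: ac_simps)
qed simp

lemma jet_le_taylor:
  fixes x p :: "'a::euclidean_space"
  assumes "smooth_fun f" "jet_le m 1 B f p" "norm (x - p) \<le> R" "1 \<le> R"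
  shows "jet_le m 1 (real m * (real DIM('a) * R) ^ m * B) (taylor m f p) x"
  using assms(1,2)
proof (induction m arbitrary: f)
  case (Suc m)
  have B: "0 \<le> B" using jet_le_nonneg[OF Suc.prems(2)] .
  have dR: "1 \<le> real DIM('a) * R"
    using mult_mono[of 1 "real DIM('a)" 1 R] assms(4) DIM_ge_Suc0[where 'a='a] by simp
  have "\<bar>taylor (Suc m) f p x\<bar> \<le> (\<Sum>j<Suc m. (real DIM('a) * R) ^ Suc m * B)"
    unfolding taylor_def
  proof (rule order_trans[OF sum_abs], rule sum_mono)
    fix j assume j: "j \<in> {..<Suc m}"
    have "\<bar>directional_deriv j f p (x - p) / fact j\<bar> \<le> \<bar>directional_deriv j f p (x - p)\<bar>"
      by (simp add: divide_le_eq mult_le_cancel_left1 fact_ge_1 abs_divide)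
    also have "\<dots> \<le> (real DIM('a) * norm (x - p)) ^ j * B"
      using jet_le_mono_order[OF Suc.prems(2), of j] j by (intro directional_deriv_bound) simp
    also have "\<dots> \<le> (real DIM('a) * R) ^ j * B"
      using assms B by (intro mult_right_mono power_mono mult_left_mono) auto
    also have "\<dots> \<le> (real DIM('a) * R) ^ Suc m * B"
      using j B dR by (intro mult_right_mono power_increasing) auto
    finally show "\<bar>directional_deriv j f p (x - p) / fact j\<bar> \<le> (real DIM('a) * R) ^ Suc m * B" .
  qed
  moreover have "jet_le m 1 (real (Suc m) * (real DIM('a) * R) ^ Suc m * B) (taylor m (pd b f) p) x"
    if b: "b \<in> Basis" for b
  proof (rule jet_le_mono)
    show "jet_le m 1 (real m * (real DIM('a) * R) ^ m * B) (taylor m (pd b f) p) x"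
      using Suc b by (intro Suc.IH smooth_fun_pd) auto
    show "real m * (real DIM('a) * R) ^ m * B \<le> real (Suc m) * (real DIM('a) * R) ^ Suc m * B"
      using B dR by (intro mult_right_mono mult_mono power_increasing) auto
  qed auto
  ultimately show ?case by (simp add: pd_taylor[OF Suc.prems(1)] del: of_nat_Suc power_Suc)
qed simp

section \<open>A smooth step function\<close>

text \<open>The functions \<open>p (1 / t) exp (- 1 / t)\<close>, extended by \<open>0\<close>, are closed under
  differentiation. This gives smoothness of \<open>exp (- 1 / t)\<close> at \<open>0\<close> with an
  explicit sequence of derivatives.\<close>

definition flat_fun :: "real poly \<Rightarrow> real \<Rightarrow> real" where
  "flat_fun p t = (if 0 < t then poly p (inverse t) * exp (- inverse t) else 0)"

lemma poly_times_exp_minus_tendsto_0: "((\<lambda>u::real. poly p u * exp (- u)) \<longlongrightarrow> 0) at_top"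
proof -
  have "((\<lambda>u::real. \<Sum>i\<le>degree p. coeff p i * (u ^ i / exp u)) \<longlongrightarrow> (\<Sum>i\<le>degree p. coeff p i * 0)) at_top"
    by (intro tendsto_sum tendsto_mult_left tendsto_power_div_exp_0)
  then show ?thesis
    by (simp add: poly_altdef sum_distrib_right exp_minus divide_inverse mult.assoc)
qed

lemma has_derivative_flat:
  "(flat_fun p has_real_derivative flat_fun ([:0, 0, 1:] * (p - pderiv p)) t) (at t)"
proof -
  let ?q = "[:0, 0, 1:] * (p - pderiv p)"
  consider "0 < t" | "t < 0" | "t = 0" by linarith
  then show ?thesis
  proof cases
    case 1
    have "((\<lambda>t. poly p (inverse t) * exp (- inverse t)) has_real_derivative flat_fun ?q t) (at t)"
      unfolding flat_fun_def using 1
      by (auto intro!: derivative_eq_intros poly_DERIV[THEN DERIV_chain2] simp: power2_eq_square algebra_simps)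
    moreover have "\<forall>\<^sub>F t in nhds t. flat_fun p t = poly p (inverse t) * exp (- inverse t)"
      using eventually_nhds_in_open[of "{0<..}" t] 1 by (auto simp: flat_fun_def elim!: eventually_mono)
    ultimately show ?thesis by (subst DERIV_cong_ev[OF refl _ refl])
  next
    case 2
    have "((\<lambda>t. 0) has_real_derivative flat_fun ?q t) (at t)" using 2 by (simp add: flat_fun_def)
    moreover have "\<forall>\<^sub>F t in nhds t. flat_fun p t = 0"
      using eventually_nhds_in_open[of "{..<0}" t] 2 by (auto simp: flat_fun_def elim!: eventually_mono)
    ultimately show ?thesis by (subst DERIV_cong_ev[OF refl _ refl])
  next
    case 3
    have "((\<lambda>t. poly (pCons 0 p) (inverse t) * exp (- inverse t)) \<longlongrightarrow> 0) (at_right 0)"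
      by (rule filterlim_compose[OF poly_times_exp_minus_tendsto_0 filterlim_inverse_at_top_right])
    then have "((\<lambda>h. flat_fun p h / h) \<longlongrightarrow> 0) (at_right 0)"
      by (rule Lim_transform_eventually)
        (auto simp: flat_fun_def eventually_at_right_less divide_inverse ac_simps intro!: eventually_mono[OF eventually_at_right_less])
    moreover have "((\<lambda>h. flat_fun p h / h) \<longlongrightarrow> 0) (at_left 0)"
      by (rule Lim_transform_eventually[OF tendsto_const])
        (auto simp: flat_fun_def eventually_at_filter)
    ultimately have "((\<lambda>h. flat_fun p h / h) \<longlongrightarrow> 0) (at 0)"
      using filterlim_split_at by blast
    then show ?thesis using 3 by (simp add: DERIV_def flat_fun_def)
  qed
qed

primrec flat_deriv :: "nat \<Rightarrow> real poly" where
  "flat_deriv 0 = 1"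
| "flat_deriv (Suc j) = [:0, 0, 1:] * (flat_deriv j - pderiv (flat_deriv j))"

lemma flat_deriv_chain: "(flat_fun (flat_deriv j) has_real_derivative flat_fun (flat_deriv (Suc j)) t) (at t)"
  unfolding flat_deriv.simps by (rule has_derivative_flat)

definition expflat :: "real \<Rightarrow> real" where
  "expflat = flat_fun 1"

lemma expflat_eq: "expflat t = (if 0 < t then exp (- inverse t) else 0)"
  by (simp add: expflat_def flat_fun_def)

lemma Ck_expflat: "Ck n g \<Longrightarrow> Ck n (\<lambda>x. expflat (g x))"
  using Ck_compose[of "\<lambda>j. flat_fun (flat_deriv j)" n g 0] flat_deriv_chain by (simp add: expflat_def)

lemma Ck_ident: "Ck n (\<lambda>x::real. x)"
  using Ck_inner[of n "1::real"] by simp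

definition step :: "real \<Rightarrow> real" where
  "step t = expflat t * inverse (expflat t + expflat (1 - t))"

lemma step_nonpos: "t \<le> 0 \<Longrightarrow> step t = 0" and step_ge_1: "1 \<le> t \<Longrightarrow> step t = 1"
  by (auto simp: step_def expflat_eq)

lemma Ck_step: "Ck n step"
  unfolding step_def
  by (intro Ck_mult Ck_inverse Ck_add Ck_expflat Ck_diff Ck_const Ck_ident)
    (auto simp: expflat_eq add_pos_nonneg add_nonneg_pos)

text \<open>As an explicit sequence of real derivatives, this matches the hypothesis on the outer function in the
  composition bounds.\<close>

definition step_deriv :: "nat \<Rightarrow> real \<Rightarrow> real" where
  "step_deriv j = (pd 1 ^^ j) step"

lemma step_deriv_0 [simp]: "step_deriv 0 = step"
  by (simp add: step_deriv_def)

lemma Ck_step_deriv: "Ck n (step_deriv j)"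
proof (induction j arbitrary: n)
  case (Suc j)
  then show ?case using Ck_pd[OF Suc[of "Suc n"], of 1] by (simp add: step_deriv_def)
qed (simp add: Ck_step)

lemma step_deriv_chain: "(step_deriv j has_real_derivative step_deriv (Suc j) t) (at t)"
proof -
  have "(step_deriv j has_derivative (\<lambda>h. h * pd 1 (step_deriv j) t)) (at t)"
    using has_derivative_pd[OF Ck_differentiable[OF Ck_step_deriv[of "Suc 0" j]], of t] by simp
  then show ?thesis
    by (simp add: has_field_derivative_def step_deriv_def mult.commute[of _ "pd _ _ _"])
qed

lemma step_deriv_outside:
  "(t < 0 \<longrightarrow> step_deriv j t = 0) \<and> (1 < t \<longrightarrow> step_deriv j t = (if j = 0 then 1 else 0))"
proof (induction j arbitrary: t)
  case 0
  then show ?case by (simp add: step_nonpos step_ge_1)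
next
  case (Suc j)
  have "step_deriv (Suc j) t = 0" if "open S" "t \<in> S" "\<And>s. s \<in> S \<Longrightarrow> step_deriv j s = c" for S c
  proof -
    have "\<forall>\<^sub>F s in nhds t. step_deriv j s = c"
      using eventually_nhds_in_open[OF that(1,2)] by (rule eventually_mono) (rule that)
    then have "(step_deriv j has_real_derivative step_deriv (Suc j) t) (at t)
        \<longleftrightarrow> ((\<lambda>s. c) has_real_derivative step_deriv (Suc j) t) (at t)"
      by (intro DERIV_cong_ev) auto
    then have "((\<lambda>s. c) has_real_derivative step_deriv (Suc j) t) (at t)"
      using step_deriv_chain by blast
    then show ?thesis using DERIV_unique DERIV_const by blast
  qed
  from this[of "{..<0}"] this[of "{1<..}"] show ?case using Suc by auto
qed

lemma step_deriv_bounded: obtains M where "M \<ge> 1" "\<And>j t. j \<le> n \<Longrightarrow> \<bar>step_deriv j t\<bar> \<le> M"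
proof -
  have "\<exists>M. \<forall>t\<in>{0..1}. \<bar>step_deriv j t\<bar> \<le> M" for j
  proof -
    have "compact (step_deriv j ` {0..1})"
      by (intro compact_continuous_image continuous_on_subset[OF Ck_continuous[OF Ck_step_deriv]]) auto
    then show ?thesis using compact_imp_bounded by (fastforce simp: bounded_iff)
  qed
  then obtain m where m: "\<And>j t. t \<in> {0..1} \<Longrightarrow> \<bar>step_deriv j t\<bar> \<le> m j" by metis
  define M where "M = max 1 (Max (m ` {..n}))"
  have "\<bar>step_deriv j t\<bar> \<le> M" if "j \<le> n" for j t
  proof (cases "t \<in> {0..1}")
    case True
    have "m j \<le> Max (m ` {..n})" using that by (intro Max_ge) auto
    then show ?thesis using m[OF True, of j] by (simp add: M_def)
  next
    case False
    then have "t < 0 \<or> 1 < t" by auto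
    then have "\<bar>step_deriv j t\<bar> \<le> 1" using step_deriv_outside[of t j] by (auto split: if_splits)
    then show ?thesis by (simp add: M_def)
  qed
  then show ?thesis using that[of M] by (simp add: M_def)
qed

section \<open>Averages over a convex set\<close>

lemma lborel_integral_affine:
  fixes f :: "'a::euclidean_space \<Rightarrow> real"
  assumes "f \<in> borel_measurable borel" "c \<noteq> 0"
  shows "(LINT x|lborel. f x) = \<bar>c\<bar> ^ DIM('a) * (LINT x|lborel. f (t + c *\<^sub>R x))"
proof -
  have "(LINT x|lborel. f x) = (LINT x|density (distr lborel borel (\<lambda>x. t + c *\<^sub>R x)) (\<lambda>_. \<bar>c\<bar> ^ DIM('a)). f x)"
    using lborel_affine[OF assms(2), of t] by simp
  also have "\<dots> = (LINT x|distr lborel borel (\<lambda>x. t + c *\<^sub>R x). \<bar>c\<bar> ^ DIM('a) * f x)"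
    using assms by (subst integral_density) auto
  also have "\<dots> = (LINT x|lborel. \<bar>c\<bar> ^ DIM('a) * f (t + c *\<^sub>R x))"
    using assms by (subst integral_distr) auto
  finally show ?thesis by simp
qed

lemma compact_finite_measure_lborel:
  assumes K: "compact (K :: 'a::euclidean_space set)"
  shows "compact_finite_measure (restrict_space lborel K) K"
proof (intro compact_finite_measure.intro compact_finite_measure_axioms.intro finite_measureI)
  show "emeasure (restrict_space lborel K) (space (restrict_space lborel K)) \<noteq> \<infinity>"
    using emeasure_compact_finite[OF K] K
    by (subst emeasure_restrict_space) (auto simp: space_restrict_space compact_imp_closed borel_closed)
  show "compact K" by fact
  show "sets (restrict_space lborel K) = sets (restrict_space borel K)"
    by (rule sets_restrict_space_cong) simp
qed

lemma integral_over_compact: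
  assumes "compact (K :: 'a::euclidean_space set)"
  shows "(LINT y|restrict_space lborel K. h y) = (LINT y|lborel. indicator K y * h y :: real)"
  using assms by (subst integral_restrict_space) (auto simp: compact_imp_closed borel_closed)

text \<open>Convexity makes Lebesgue measure on \<open>K\<close> doubling, however thin \<open>K\<close> is:
  contracting \<open>K\<close> by the factor \<open>1/2\<close> towards \<open>p\<close> maps
  \<open>K\<close> into itself. Comparing the part of the integral far from \<open>p\<close> with its image
  under this contraction bounds it by half of the whole integral.\<close>

lemma integral_concentrates_near_point:
  fixes p :: "'a::euclidean_space"
  assumes K: "compact K" "convex K" "p \<in> K" and \<rho>: "0 < \<rho>" and q: "2 ^ DIM('a) * (3 / 4) ^ q \<le> (1 / 2 :: real)"
  shows "(LINT y|restrict_space lborel K. inverse ((norm (y - p) + \<rho>) ^ q))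
     \<le> 2 * measure lborel (K \<inter> cball p \<rho>) * inverse (\<rho> ^ q)"
proof -
  define \<phi> where "\<phi> y = inverse ((norm (y - p) + \<rho>) ^ q)" for y
  have pos: "0 < norm (y - p) + \<rho>" for y using \<rho> norm_ge_zero[of "y - p"] by linarith
  have \<phi>0: "0 \<le> \<phi> y" for y using pos[of y] by (simp add: \<phi>_def)
  have m\<phi>: "\<phi> \<in> borel_measurable borel" unfolding \<phi>_def by measurable
  have Kb: "K \<in> sets borel" "closed K" using K(1) compact_imp_closed borel_closed by blast+
  have \<phi>le: "\<phi> y \<le> inverse (\<rho> ^ q)" for y
    unfolding \<phi>_def using \<rho> by (intro le_imp_inverse_le power_mono) auto
  have fin: "emeasure lborel A < \<infinity>" if "A \<subseteq> K" for A
    using emeasure_mono[OF that, of lborel] Kb emeasure_compact_finite[OF K(1)] by (auto simp: less_top[symmetric] top_unique)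
  have int: "integrable lborel (\<lambda>y. indicator A y * \<phi> y)" if "A \<in> sets borel" "A \<subseteq> K" for A
  proof (rule Bochner_Integration.integrable_bound)
    show "integrable lborel (\<lambda>y. inverse (\<rho> ^ q) * indicator A y :: real)"
      using that fin[OF that(2)] by (intro integrable_mult_right integrable_real_indicator) auto
    show "AE y in lborel. norm (indicator A y * \<phi> y) \<le> norm (inverse (\<rho> ^ q) * indicator A y :: real)"
      using \<phi>0 \<phi>le \<rho> by (intro AE_I2) (auto simp: indicator_def)
  qed (use that m\<phi> in measurable)
  define I where "I = (LINT y|lborel. indicator K y * \<phi> y)"
  define N where "N = K \<inter> cball p \<rho>"
  define F where "F = K - cball p \<rho>"
  have NF: "N \<in> sets borel" "F \<in> sets borel" "N \<subseteq> K" "F \<subseteq> K"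
    using Kb by (auto simp: N_def F_def)
  have "I = (LINT y|lborel. indicator N y * \<phi> y) + (LINT y|lborel. indicator F y * \<phi> y)"
    unfolding I_def Bochner_Integration.integral_add[OF int[OF NF(1,3)] int[OF NF(2,4)], symmetric]
    by (intro Bochner_Integration.integral_cong) (auto simp: N_def F_def indicator_def)
  also have "(LINT y|lborel. indicator N y * \<phi> y) \<le> (LINT y|lborel. inverse (\<rho> ^ q) * indicator N y)"
    using \<phi>0 \<phi>le \<rho> NF fin[OF NF(3)]
    by (intro integral_mono int NF integrable_mult_right integrable_real_indicator) (auto simp: indicator_def)
  also have "\<dots> = measure lborel N * inverse (\<rho> ^ q)" using NF by simp
  also have "(LINT y|lborel. indicator F y * \<phi> y)
      = 2 ^ DIM('a) * (LINT z|lborel. indicator F (- p + 2 *\<^sub>R z) * \<phi> (- p + 2 *\<^sub>R z))"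
    using NF m\<phi> by (subst lborel_integral_affine[where c=2 and t="- p"]) auto
  also have "\<dots> \<le> 2 ^ DIM('a) * (LINT z|lborel. (3 / 4) ^ q * (indicator K z * \<phi> z))"
  proof (intro mult_left_mono integral_mono_AE' AE_I2)
    show "integrable lborel (\<lambda>z. (3 / 4) ^ q * (indicator K z * \<phi> z))"
      using Kb by (intro integrable_mult_right int) auto
    fix z
    show "0 \<le> (3 / 4) ^ q * (indicator K z * \<phi> z)" using \<phi>0 by simp
    show "indicator F (- p + 2 *\<^sub>R z) * \<phi> (- p + 2 *\<^sub>R z) \<le> (3 / 4) ^ q * (indicator K z * \<phi> z)"
    proof (cases "- p + 2 *\<^sub>R z \<in> F")
      case True
      have "z = (1 / 2) *\<^sub>R p + (1 / 2) *\<^sub>R (- p + 2 *\<^sub>R z)" by (simp add: algebra_simps)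
      moreover have "(1 / 2) *\<^sub>R p + (1 / 2) *\<^sub>R (- p + 2 *\<^sub>R z) \<in> K"
        using True K by (intro convexD) (auto simp: F_def)
      ultimately have z: "z \<in> K" by simp
      have e: "norm (- p + 2 *\<^sub>R z - p) = 2 * norm (z - p)"
        using norm_scaleR[of 2 "z - p"] by (simp add: algebra_simps scaleR_2)
      (* With t the distance from z to p, this gives t + \<rho> \<le> 3 / 4 * (2 t + \<rho>), and the
         power q of the factor 3 / 4 beats the Jacobian of the contraction. *)
      have "\<rho> < 2 * norm (z - p)"
        using True e by (auto simp: F_def dist_norm norm_minus_commute)
      then have "(norm (z - p) + \<rho>) ^ q \<le> ((3 / 4) * (2 * norm (z - p) + \<rho>)) ^ q"
        using \<rho> by (intro power_mono) auto
      then have "(norm (z - p) + \<rho>) ^ q \<le> (3 / 4) ^ q * (2 * norm (z - p) + \<rho>) ^ q"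
        unfolding power_mult_distrib .
      moreover have "0 < (norm (z - p) + \<rho>) ^ q" "0 < (2 * norm (z - p) + \<rho>) ^ q"
        using \<rho> by (auto intro!: zero_less_power add_nonneg_pos)
      ultimately have "\<phi> (- p + 2 *\<^sub>R z) \<le> (3 / 4) ^ q * \<phi> z"
        unfolding \<phi>_def e by (simp add: field_simps)
      then show ?thesis using True z by simp
    qed (use \<phi>0 in simp)
  qed simp
  also have "\<dots> = (2 ^ DIM('a) * (3 / 4) ^ q) * I" by (simp add: I_def)
  also have "\<dots> \<le> 1 / 2 * I"
    using q \<phi>0 by (intro mult_right_mono) (auto simp: I_def intro!: integral_nonneg)
  finally have "I \<le> 2 * measure lborel N * inverse (\<rho> ^ q)" by simp
  then show ?thesis by (simp add: I_def N_def \<phi>_def integral_over_compact K(1))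
qed

text \<open>The squared distance, regularized so that its negative powers are smooth also on \<open>K\<close>. The sum
  over the basis makes it visibly a polynomial in the displacement.\<close>

definition sqdist :: "real \<Rightarrow> 'a::euclidean_space \<Rightarrow> 'a \<Rightarrow> real" where
  "sqdist \<delta> x y = (\<Sum>b\<in>Basis. ((x - y) \<bullet> b) * ((x - y) \<bullet> b)) + \<delta> ^ 2"

lemma sqdist_eq: "sqdist \<delta> x y = norm (x - y) ^ 2 + \<delta> ^ 2"
  unfolding sqdist_def by (simp add: euclidean_inner[symmetric] power2_norm_eq_inner)

lemma sqdist_pos: "0 < \<delta> \<Longrightarrow> 0 < sqdist \<delta> x y"
  by (simp add: sqdist_eq add_nonneg_pos)

lemma Ck_family_sqdist: "Ck_family n S (sqdist \<delta>)"
  unfolding sqdist_def[abs_def]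
  by (intro Ck_family_add Ck_family_sum Ck_family_mult Ck_family_displacement Ck_family_parameter) auto

lemma Ck_displacement: "Ck n (\<lambda>x. (x - y) \<bullet> b)"
  unfolding inner_diff_left by (intro Ck_diff Ck_inner Ck_const)

lemma jet_le_displacement:
  assumes "norm (x - y) \<le> r" "0 < r" "b \<in> Basis"
  shows "jet_le n r r (\<lambda>x. (x - y) \<bullet> b) x"
proof (cases n)
  case 0
  then show ?thesis using Basis_le_norm[OF assms(3), of "x - y"] assms(1) by simp
next
  case (Suc m)
  have "pd a (\<lambda>x. (x - y) \<bullet> b) = (\<lambda>x. a \<bullet> b)" for a
    by (intro ext pd_eqI) (auto intro!: derivative_eq_intros)
  moreover have "\<bar>a \<bullet> b\<bar> \<le> 1" if "a \<in> Basis" for a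
    using that assms(3) by (simp add: inner_Basis)
  ultimately show ?thesis
    using Suc Basis_le_norm[OF assms(3), of "x - y"] assms by (auto intro!: jet_le_const)
qed

lemma jet_le_sqdist:
  assumes "norm (x - y) \<le> r" "\<bar>\<delta>\<bar> \<le> r" "0 < r"
  shows "jet_le n r ((real DIM('a) * 2 ^ n + 1) * r ^ 2) (\<lambda>x. sqdist \<delta> x y) (x :: 'a::euclidean_space)"
proof -
  have "jet_le n r ((\<Sum>b\<in>(Basis::'a set). 2 ^ n * r * r) + r ^ 2) (\<lambda>x. sqdist \<delta> x y) x"
    unfolding sqdist_def
    using assms abs_le_square_iff[of \<delta> r]
    by (intro jet_le_add jet_le_sum jet_le_mult Ck_sum Ck_mult Ck_displacement Ck_const jet_le_displacement jet_le_const)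
      auto
  then show ?thesis by (simp add: algebra_simps power2_eq_square)
qed

definition weight :: "nat \<Rightarrow> real \<Rightarrow> 'a::euclidean_space \<Rightarrow> 'a \<Rightarrow> real" where
  "weight N \<delta> x y = inverse (sqdist \<delta> x y) ^ N"

lemma weight_pos: "0 < \<delta> \<Longrightarrow> 0 < weight N \<delta> x y"
  by (simp add: weight_def sqdist_pos)

lemma Ck_family_weight: "0 < \<delta> \<Longrightarrow> Ck_family n S (weight N \<delta>)"
  unfolding weight_def[abs_def]
  by (intro Ck_family_power Ck_family_inverse Ck_family_sqdist sqdist_pos)

definition weight_const :: "nat \<Rightarrow> nat \<Rightarrow> real \<Rightarrow> real" where
  "weight_const n N d = (2 ^ n * inverse_const n (d * 2 ^ n + 1)) ^ N"

lemma weight_const_ge_1: "1 \<le> weight_const n N d"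
  unfolding weight_const_def by (intro one_le_power mult_ge1_I inverse_const_ge_1) simp

lemma jet_le_weight:
  fixes x y :: "'a::euclidean_space"
  assumes \<delta>: "0 < \<delta>"
  shows "jet_le n (sqrt (sqdist \<delta> x y)) (weight_const n N (real DIM('a)) * weight N \<delta> x y) (\<lambda>x. weight N \<delta> x y) x"
proof -
  let ?C = "inverse_const n (real DIM('a) * 2 ^ n + 1)"
  define r where "r = sqrt (sqdist \<delta> x y)"
  have r: "0 < r" "r ^ 2 = sqdist \<delta> x y" "norm (x - y) \<le> r" "\<delta> \<le> r"
    using sqdist_pos[OF \<delta>, of x y] \<delta> unfolding r_def sqdist_eq
    by (auto intro!: real_le_rsqrt)
  have c: "Ck n (\<lambda>x. sqdist \<delta> x y)" "Ck n (\<lambda>x. inverse (sqdist \<delta> x y))"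
    using Ck_family_section[OF Ck_family_sqdist, of y UNIV n \<delta>] sqdist_pos[OF \<delta>]
    by (auto intro!: Ck_inverse)
  have "jet_le n r (?C / sqdist \<delta> x y) (\<lambda>x. inverse (sqdist \<delta> x y)) x"
    using jet_le_sqdist[of x y r \<delta> n] r \<delta> c sqdist_pos[OF \<delta>] by (intro jet_le_inverse) auto
  then have "jet_le n r ((2 ^ n * (?C / sqdist \<delta> x y)) ^ N) (\<lambda>x. weight N \<delta> x y) x"
    unfolding weight_def using r c by (intro jet_le_power)
  then show ?thesis
    by (simp add: r_def weight_def weight_const_def power_mult_distrib divide_inverse mult.assoc)
qed

definition total_weight :: "nat \<Rightarrow> real \<Rightarrow> 'a::euclidean_space set \<Rightarrow> 'a \<Rightarrow> real" where
  "total_weight N \<delta> K x = (LINT y|restrict_space lborel K. weight N \<delta> x y)"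

definition average :: "nat \<Rightarrow> real \<Rightarrow> 'a::euclidean_space set \<Rightarrow> ('a \<Rightarrow> 'a \<Rightarrow> real) \<Rightarrow> 'a \<Rightarrow> real" where
  "average N \<delta> K g x = (LINT y|restrict_space lborel K. g x y * weight N \<delta> x y)
     * inverse (total_weight N \<delta> K x)"

definition average_const :: "nat \<Rightarrow> nat \<Rightarrow> real \<Rightarrow> real" where
  "average_const n N d = 2 ^ n * (2 ^ n * weight_const n N d * (2 * 9 ^ (2 * N))) * inverse_const n (weight_const n N d)"

lemma average_const_ge_1: "1 \<le> average_const n N d"
  unfolding average_const_def
  by (intro mult_ge1_I weight_const_ge_1 inverse_const_ge_1 one_le_power) auto

context
  fixes K :: "'a::euclidean_space set" and \<delta> :: real and N :: nat
  assumes K: "compact K" "convex K" "0 < measure lborel K" and \<delta>: "0 < \<delta>"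
begin

interpretation compact_finite_measure "restrict_space lborel K" K
  using K(1) by (rule compact_finite_measure_lborel)

lemma total_weight_pos: "0 < total_weight N \<delta> K x"
proof -
  have "bounded K" using K(1) by (rule compact_imp_bounded)
  then obtain R where R: "\<And>y. y \<in> K \<Longrightarrow> dist x y \<le> R" by (auto simp: bounded_any_center[of _ x])
  define c where "c = inverse (R ^ 2 + \<delta> ^ 2) ^ N"
  have c: "0 < c" using \<delta> by (simp add: c_def add_nonneg_pos)
  have "c \<le> weight N \<delta> x y" if "y \<in> K" for y
    unfolding c_def weight_def sqdist_eq using R[OF that] \<delta>
    by (intro power_mono le_imp_inverse_le add_right_mono) (auto simp: dist_norm add_nonneg_pos)
  then have "(LINT y|restrict_space lborel K. c) \<le> (LINT y|restrict_space lborel K. weight N \<delta> x y)"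
    by (intro integral_mono family_integrable[OF Ck_family_weight[OF \<delta>, of 0]]) (auto simp: space_eq)
  moreover have "(LINT y|restrict_space lborel K. c) = c * measure lborel K"
    using K(1) by (subst integral_over_compact) (auto simp: mult.commute compact_imp_closed)
  ultimately show ?thesis
    using mult_pos_pos[OF c K(3)] unfolding total_weight_def by linarith
qed

lemma Ck_total_weight: "Ck n (total_weight N \<delta> K)"
  unfolding total_weight_def[abs_def] by (intro Ck_integral Ck_family_weight \<delta>)

lemma Ck_average: "Ck_family n K g \<Longrightarrow> Ck n (average N \<delta> K g)"
  unfolding average_def[abs_def]
  by (intro Ck_mult Ck_inverse Ck_total_weight total_weight_pos Ck_integral Ck_family_mult Ck_family_weight \<delta>)

lemma average_diff_const:
  assumes "Ck_family n K g"
  shows "average N \<delta> K (\<lambda>x y. g x y - h x) x = average N \<delta> K g x - h x"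
proof -
  have "(LINT y|restrict_space lborel K. (g x y - h x) * weight N \<delta> x y)
     = (LINT y|restrict_space lborel K. g x y * weight N \<delta> x y) - h x * total_weight N \<delta> K x"
    unfolding left_diff_distrib total_weight_def
    by (subst Bochner_Integration.integral_diff)
      (auto intro!: integrable_mult_right family_integrable[OF Ck_family_weight[OF \<delta>, of 0]]
         family_integrable[OF Ck_family_mult[OF assms Ck_family_weight[OF \<delta>]]])
  then show ?thesis
    using total_weight_pos[of x] by (simp add: average_def left_diff_distrib)
qed

lemma average_ge:
  assumes "Ck_family n K g" "\<And>y. y \<in> K \<Longrightarrow> a \<le> g x y"
  shows "a \<le> average N \<delta> K g x"
proof -
  have "(LINT y|restrict_space lborel K. a * weight N \<delta> x y) \<le> (LINT y|restrict_space lborel K. g x y * weight N \<delta> x y)"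
    using assms(2) weight_pos[OF \<delta>, THEN less_imp_le]
    by (intro integral_mono integrable_mult_right family_integrable[OF Ck_family_weight[OF \<delta>, of 0]]
         family_integrable[OF Ck_family_mult[OF assms(1) Ck_family_weight[OF \<delta>]]])
      (auto simp: space_eq intro!: mult_right_mono)
  then show ?thesis
    using total_weight_pos[of x] unfolding average_def
    by (simp add: total_weight_def[symmetric] field_simps)
qed

text \<open>The regularized distance from \<open>x\<close> to \<open>y\<close> is comparable to the distance from
  \<open>p\<close> to \<open>y\<close> plus the regularized distance from \<open>x\<close> to
  \<open>p\<close>, where \<open>p\<close> is the point of \<open>K\<close> nearest to \<open>x\<close>. The
  moment is therefore controlled by the volume of \<open>K\<close> near \<open>p\<close>, and so is the
  total weight from below.\<close>

lemma moment_le: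
  assumes p: "p \<in> K" "\<And>y. y \<in> K \<Longrightarrow> norm (x - p) \<le> norm (x - y)"
    and a: "a \<le> 2 * N" "2 ^ DIM('a) * (3 / 4) ^ (2 * N - a) \<le> (1 / 2 :: real)"
  shows "(LINT y|restrict_space lborel K. sqrt (sqdist \<delta> x y) ^ a * weight N \<delta> x y)
     \<le> 2 * 9 ^ (2 * N) * sqrt (sqdist \<delta> x p) ^ a * total_weight N \<delta> K x"
proof -
  define \<rho> where "\<rho> = sqrt (sqdist \<delta> x p)"
  define V where "V = measure lborel (K \<inter> cball p \<rho>)"
  define r where "r y = sqrt (sqdist \<delta> x y)" for y
  have r: "0 < r y" "r y ^ 2 = sqdist \<delta> x y" "norm (x - y) \<le> r y" "\<delta> \<le> r y" for y
    using sqdist_pos[OF \<delta>, of x y] \<delta> unfolding r_def sqdist_eq by (auto intro!: real_le_rsqrt)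
  have \<rho>: "0 < \<rho>" "norm (x - p) \<le> \<rho>" "\<delta> \<le> \<rho>" using r[of p] by (auto simp: r_def \<rho>_def)
  have \<rho>r: "\<rho> \<le> r y" if "y \<in> K" for y
    unfolding \<rho>_def r_def sqdist_eq using p(2)[OF that] by (intro real_sqrt_le_mono add_right_mono power_mono) auto
  have w: "weight N \<delta> x y = inverse (r y ^ (2 * N))" for y
    unfolding weight_def r(2)[symmetric] power_inverse by (simp add: power_mult)
  let ?b = "2 * N - a"
  have rw: "r y ^ a * weight N \<delta> x y = inverse (r y ^ ?b)" for y
  proof -
    have "r y ^ (2 * N) = r y ^ a * r y ^ ?b" using a(1) by (simp flip: power_add)
    then show ?thesis using r(1)[of y] by (simp add: w)
  qed
  have "continuous_on K r" unfolding r_def sqdist_eq by (intro continuous_intros)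
  then have cr: "continuous_on K (\<lambda>y. inverse (r y ^ ?b))"
    using r(1) by (intro continuous_on_inverse continuous_on_power) (auto simp: order_less_le)
  have "norm (y - p) + \<rho> \<noteq> 0" for y using \<rho>(1) norm_ge_zero[of "y - p"] by linarith
  then have c\<rho>: "continuous_on K (\<lambda>y. 3 ^ ?b * inverse ((norm (y - p) + \<rho>) ^ ?b))"
    by (intro continuous_on_mult continuous_on_inverse continuous_on_power continuous_intros) auto
  have "r y ^ a * weight N \<delta> x y \<le> 3 ^ ?b * inverse ((norm (y - p) + \<rho>) ^ ?b)" if y: "y \<in> K" for y
  proof -
    have "norm (y - p) \<le> norm (x - y) + norm (x - p)"
      using norm_triangle_ineq4[of "x - p" "x - y"] by simp
    also have "\<dots> \<le> 2 * r y" using r(3)[of y] p(2)[OF y] by simp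
    finally have "(norm (y - p) + \<rho>) ^ ?b \<le> (3 * r y) ^ ?b"
      using \<rho>r[OF y] \<rho> by (intro power_mono) auto
    moreover have "0 < (norm (y - p) + \<rho>) ^ ?b" using \<rho> by (intro zero_less_power add_nonneg_pos) auto
    ultimately show ?thesis using r(1)[of y] by (simp add: rw power_mult_distrib field_simps)
  qed
  then have "(LINT y|restrict_space lborel K. r y ^ a * weight N \<delta> x y)
      \<le> (LINT y|restrict_space lborel K. 3 ^ ?b * inverse ((norm (y - p) + \<rho>) ^ ?b))"
    using cr c\<rho> unfolding rw by (intro integral_mono integrable_continuous) (auto simp: space_eq)
  also have "\<dots> = 3 ^ ?b * (LINT y|restrict_space lborel K. inverse ((norm (y - p) + \<rho>) ^ ?b))" by simp
  also have "\<dots> \<le> 3 ^ ?b * (2 * V * inverse (\<rho> ^ ?b))"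
    unfolding V_def using K p a \<rho> by (intro mult_left_mono integral_concentrates_near_point) auto
  finally have up: "(LINT y|restrict_space lborel K. r y ^ a * weight N \<delta> x y) \<le> 3 ^ ?b * (2 * V * inverse (\<rho> ^ ?b))" .
  have "(LINT y|restrict_space lborel K. inverse ((3 * \<rho>) ^ (2 * N)) * indicator (cball p \<rho>) y)
      \<le> total_weight N \<delta> K x"
    unfolding total_weight_def
  proof (intro integral_mono family_integrable[OF Ck_family_weight[OF \<delta>, of 0]] integrable_mult_right)
    have "cball p \<rho> \<inter> space (restrict_space lborel K) \<in> sets (restrict_space lborel K)"
      unfolding sets_restrict_space space_restrict_space by (rule image_eqI[of _ _ "cball p \<rho>"]) auto
    then show "integrable (restrict_space lborel K) (indicator (cball p \<rho>) :: 'a \<Rightarrow> real)"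
      by (subst integrable_indicator_iff) (auto simp: less_top[symmetric])
    fix y
    show "inverse ((3 * \<rho>) ^ (2 * N)) * indicator (cball p \<rho>) y \<le> weight N \<delta> x y"
    proof (cases "y \<in> cball p \<rho>")
      case True
      then have "norm (p - y) \<le> \<rho>" by (simp add: dist_norm)
      then have "norm (x - y) \<le> 2 * \<rho>" using \<rho>(2) norm_triangle_ineq[of "x - p" "p - y"] by simp
      then have "sqdist \<delta> x y \<le> (2 * \<rho>) ^ 2 + \<rho> ^ 2"
        unfolding sqdist_eq using \<rho> \<delta> by (intro add_mono power_mono) auto
      also have "\<dots> \<le> (3 * \<rho>) ^ 2" by (simp add: power2_eq_square)
      finally have "r y \<le> 3 * \<rho>"
        using \<rho>(1) power2_le_imp_le[of "r y" "3 * \<rho>"] by (simp add: r(2))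
      then have "r y ^ (2 * N) \<le> (3 * \<rho>) ^ (2 * N)"
        using r(1)[of y] by (intro power_mono) auto
      then have "inverse ((3 * \<rho>) ^ (2 * N)) \<le> weight N \<delta> x y"
        unfolding w using r(1)[of y] by (intro le_imp_inverse_le zero_less_power)
      then show ?thesis using True by simp
    qed (use weight_pos[OF \<delta>, of N x y] in simp)
  qed
  moreover have "(LINT y|restrict_space lborel K. inverse ((3 * \<rho>) ^ (2 * N)) * indicator (cball p \<rho>) y)
      = inverse ((3 * \<rho>) ^ (2 * N)) * V"
  proof -
    have "(LINT y|restrict_space lborel K. inverse ((3 * \<rho>) ^ (2 * N)) * indicator (cball p \<rho>) y)
        = (LINT y|lborel. inverse ((3 * \<rho>) ^ (2 * N)) * indicator (K \<inter> cball p \<rho>) y)"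
      unfolding integral_over_compact[OF K(1)]
      by (intro Bochner_Integration.integral_cong) (auto simp: indicator_def)
    then show ?thesis using K(1) by (simp add: V_def compact_imp_closed)
  qed
  ultimately have lo: "V \<le> (3 * \<rho>) ^ (2 * N) * total_weight N \<delta> K x"
    using \<rho>(1) by (simp add: field_simps)
  have "\<rho> ^ (2 * N) = \<rho> ^ a * \<rho> ^ ?b" using a(1) by (simp flip: power_add)
  then have e: "inverse (\<rho> ^ ?b) * \<rho> ^ (2 * N) = \<rho> ^ a" using \<rho>(1) by simp
  have "3 ^ ?b * (2 * V * inverse (\<rho> ^ ?b))
      \<le> 3 ^ (2 * N) * (2 * ((3 * \<rho>) ^ (2 * N) * total_weight N \<delta> K x) * inverse (\<rho> ^ ?b))"
    using lo \<rho>(1) by (intro mult_mono mult_left_mono mult_right_mono power_increasing) (auto simp: V_def)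
  also have "\<dots> = 2 * 9 ^ (2 * N) * (inverse (\<rho> ^ ?b) * \<rho> ^ (2 * N)) * total_weight N \<delta> K x"
    by (simp add: power_mult_distrib ac_simps flip: power_mult_distrib[of 3 3])
  finally show ?thesis using up unfolding e unfolding \<rho>_def r_def by linarith
qed

text \<open>Averaging with weights that decay like a high power of the distance behaves like averaging over the ball
  of radius comparable to the distance from \<open>x\<close> to \<open>K\<close>: bounds in terms of the
  distance to the points of \<open>K\<close> become bounds in terms of the distance to \<open>K\<close>.\<close>

lemma jet_le_average:
  assumes g: "Ck_family n K g" and p: "p \<in> K" "\<And>y. y \<in> K \<Longrightarrow> norm (x - p) \<le> norm (x - y)"
    and a: "a \<le> 2 * N" "2 ^ DIM('a) * (3 / 4) ^ (2 * N - a) \<le> (1 / 2 :: real)"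
    and jg: "\<And>y. y \<in> K \<Longrightarrow> jet_le n (sqrt (sqdist \<delta> x y)) (A * sqrt (sqdist \<delta> x y) ^ a) (\<lambda>x. g x y) x"
  shows "jet_le n (sqrt (sqdist \<delta> x p)) (average_const n N (real DIM('a)) * A * sqrt (sqdist \<delta> x p) ^ a) (average N \<delta> K g) x"
proof -
  let ?Cw = "weight_const n N (real DIM('a))"
  let ?W = "total_weight N \<delta> K"
  define \<rho> where "\<rho> = sqrt (sqdist \<delta> x p)"
  define r where "r y = sqrt (sqdist \<delta> x y)" for y
  have r: "0 < r y" for y using sqdist_pos[OF \<delta>, of x y] by (simp add: r_def)
  have \<rho>: "0 < \<rho>" using r[of p] by (simp add: r_def \<rho>_def)
  have Cw: "1 \<le> ?Cw" by (rule weight_const_ge_1)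
  have A: "0 \<le> A"
    using jet_le_nonneg[OF jg[OF p(1)]] zero_less_power[OF r[of p], of a]
    by (simp add: r_def zero_le_mult_iff)
  have \<rho>r: "\<rho> \<le> r y" if "y \<in> K" for y
    unfolding \<rho>_def r_def sqdist_eq using p(2)[OF that] by (intro real_sqrt_le_mono add_right_mono power_mono) auto
  have iw: "integrable (restrict_space lborel K) (weight N \<delta> x)"
    by (rule family_integrable[OF Ck_family_weight[OF \<delta>, of 0]])
  have irw: "integrable (restrict_space lborel K) (\<lambda>y. r y ^ a * weight N \<delta> x y)"
    unfolding r_def sqdist_eq
    by (intro integrable_continuous continuous_on_mult continuous_intros
        continuous_slice[OF Ck_family_continuous[OF Ck_family_weight[OF \<delta>, of 0]]])
  have "jet_le n \<rho> (LINT y|restrict_space lborel K. 2 ^ n * A * ?Cw * (r y ^ a * weight N \<delta> x y))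
      (\<lambda>x. LINT y|restrict_space lborel K. g x y * weight N \<delta> x y) x"
  proof (rule jet_le_integral)
    fix y assume y: "y \<in> K"
    have "jet_le n (r y) (2 ^ n * (A * r y ^ a) * (?Cw * weight N \<delta> x y)) (\<lambda>x. g x y * weight N \<delta> x y) x"
      using jg[OF y] jet_le_weight[OF \<delta>, of n x y N] r Ck_family_section[OF g y]
        Ck_family_section[OF Ck_family_weight[OF \<delta>, of n K N] y]
      by (intro jet_le_mult) (auto simp: r_def)
    then show "jet_le n \<rho> (2 ^ n * A * ?Cw * (r y ^ a * weight N \<delta> x y)) (\<lambda>x. g x y * weight N \<delta> x y) x"
      using jet_le_mono_scale \<rho> \<rho>r[OF y] by (simp add: ac_simps)
  qed (auto intro!: Ck_family_mult g Ck_family_weight \<delta> irw)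
  moreover have "(LINT y|restrict_space lborel K. 2 ^ n * A * ?Cw * (r y ^ a * weight N \<delta> x y))
      \<le> 2 ^ n * A * ?Cw * (2 * 9 ^ (2 * N) * \<rho> ^ a * ?W x)"
    using moment_le[OF p a] A Cw by (simp add: r_def \<rho>_def mult_left_mono)
  ultimately have num: "jet_le n \<rho> (2 ^ n * A * ?Cw * (2 * 9 ^ (2 * N) * \<rho> ^ a * ?W x))
      (\<lambda>x. LINT y|restrict_space lborel K. g x y * weight N \<delta> x y) x"
    using jet_le_mono \<rho> by blast
  have "jet_le n \<rho> (LINT y|restrict_space lborel K. ?Cw * weight N \<delta> x y) ?W x"
    unfolding total_weight_def[abs_def]
  proof (rule jet_le_integral)
    show "jet_le n \<rho> (?Cw * weight N \<delta> x y) (\<lambda>x. weight N \<delta> x y) x" if "y \<in> K" for y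
      using jet_le_mono_scale[OF jet_le_weight[OF \<delta>]] \<rho> \<rho>r[OF that] by (simp add: r_def)
  qed (auto intro!: Ck_family_weight \<delta> iw)
  then have "jet_le n \<rho> (?Cw * ?W x) ?W x"
    unfolding integral_mult_right_zero total_weight_def .
  then have "jet_le n \<rho> (inverse_const n ?Cw / ?W x) (\<lambda>z. inverse (?W z)) x"
    by (rule jet_le_inverse[OF \<rho> Ck_total_weight total_weight_pos])
  then have "jet_le n \<rho> (2 ^ n * (2 ^ n * A * ?Cw * (2 * 9 ^ (2 * N) * \<rho> ^ a * ?W x)) * (inverse_const n ?Cw / ?W x))
      (average N \<delta> K g) x"
    unfolding average_def[abs_def] using num
    by (intro jet_le_mult \<rho> Ck_inverse Ck_total_weight total_weight_pos Ck_integral Ck_family_mult g Ck_family_weight \<delta>)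
  moreover have "2 ^ n * (2 ^ n * A * ?Cw * (2 * 9 ^ (2 * N) * \<rho> ^ a * ?W x)) * (inverse_const n ?Cw / ?W x)
      = average_const n N (real DIM('a)) * A * \<rho> ^ a"
    using total_weight_pos[of x] by (simp add: average_const_def)
  ultimately show ?thesis by (simp add: \<rho>_def)
qed

end

section \<open>Extension from a convex set of arbitrary shape\<close>

lemma jet_le_exists: "Ck n f \<Longrightarrow> \<exists>A. jet_le n \<rho> A f x" if "0 < \<rho>"
proof (induction n arbitrary: f)
  case 0
  show ?case by auto
next
  case (Suc n)
  have "\<exists>A. jet_le n \<rho> A (pd b f) x" if "b \<in> Basis" for b
    using Suc that by (auto simp: Ck_Suc)
  then obtain A where A: "\<And>b. b \<in> Basis \<Longrightarrow> jet_le n \<rho> (A b) (pd b f) x" by metis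
  define A' where "A' = max \<bar>f x\<bar> (Max (A ` Basis) * \<rho>)"
  have "jet_le n \<rho> (A' / \<rho>) (pd b f) x" if b: "b \<in> Basis" for b
  proof (rule jet_le_mono[OF A[OF b] _ \<open>0 < \<rho>\<close>])
    have "A b \<le> Max (A ` Basis)" using b by (intro Max_ge) auto
    also have "\<dots> \<le> A' / \<rho>" using \<open>0 < \<rho>\<close> by (simp add: A'_def pos_le_divide_eq)
    finally show "A b \<le> A' / \<rho>" .
  qed
  moreover have "\<bar>f x\<bar> \<le> A'" by (simp add: A'_def)
  ultimately show ?case by (intro exI[of _ A']) simp
qed

definition thicken :: "real \<Rightarrow> 'a::euclidean_space set \<Rightarrow> 'a set" where
  "thicken t K = {x + y | x y. x \<in> K \<and> y \<in> cball 0 t}"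

lemma mem_thicken: "z \<in> thicken t K \<longleftrightarrow> (\<exists>x\<in>K. dist x z \<le> t)"
proof
  assume "\<exists>x\<in>K. dist x z \<le> t"
  then obtain x where "x \<in> K" "dist x z \<le> t" by blast
  then have "z = x + (z - x)" "z - x \<in> cball 0 t"
    by (simp_all add: dist_norm norm_minus_commute)
  with \<open>x \<in> K\<close> show "z \<in> thicken t K" unfolding thicken_def by blast
next
  assume "z \<in> thicken t K"
  then obtain x y where "z = x + y" "x \<in> K" "norm y \<le> t" by (auto simp: thicken_def)
  then show "\<exists>x\<in>K. dist x z \<le> t" by (intro bexI[of _ x]) (auto simp: dist_norm)
qed

lemma compact_thicken: "compact K \<Longrightarrow> compact (thicken t K)"
  unfolding thicken_def by (intro compact_sums) auto

lemma convex_thicken: "convex K \<Longrightarrow> convex (thicken t K)"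
proof -
  assume "convex K"
  moreover have "thicken t K = (\<Union>x\<in>K. \<Union>y\<in>cball 0 t. {x + y})"
    unfolding thicken_def by blast
  ultimately show ?thesis using convex_sums[of K "cball 0 t"] by simp
qed

text \<open>Bounds on a compact set persist, with an arbitrarily small loss, on a neighbourhood whose size depends on
  \<open>f\<close>. The extension may use this neighbourhood, provided that no constant depends on its size.\<close>

lemma jet_le_thicken:
  assumes K: "compact K" and e: "0 < e"
  shows "Ck n f \<Longrightarrow> (\<And>x. x \<in> K \<Longrightarrow> jet_le n 1 B f x) \<Longrightarrow>
    \<exists>r>0. \<forall>x\<in>K. \<forall>z. dist x z \<le> r \<longrightarrow> jet_le n 1 (B + e) f z"
proof (induction n arbitrary: f)
  have v: "\<exists>r>0. \<forall>x\<in>K. \<forall>z. dist x z \<le> r \<longrightarrow> \<bar>f z\<bar> \<le> B + e"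
    if f: "continuous_on UNIV f" "\<And>x. x \<in> K \<Longrightarrow> \<bar>f x\<bar> \<le> B" for f :: "'a \<Rightarrow> real"
  proof -
    let ?K1 = "thicken 1 K"
    have "compact ?K1" using K by (rule compact_thicken)
    then have "uniformly_continuous_on ?K1 f"
      using f(1) continuous_on_subset by (intro compact_uniformly_continuous) blast+
    then obtain d where d: "d > 0" "\<And>x z. x \<in> ?K1 \<Longrightarrow> z \<in> ?K1 \<Longrightarrow> dist z x < d \<Longrightarrow> dist (f z) (f x) < e"
      using e unfolding uniformly_continuous_on_def by metis
    have "\<bar>f z\<bar> \<le> B + e" if x: "x \<in> K" and z: "dist x z \<le> min 1 (d / 2)" for x z
    proof -
      have "x \<in> ?K1" using x by (force simp: mem_thicken)
      moreover have "z \<in> ?K1" using x z by (auto simp: mem_thicken)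
      ultimately have "dist (f z) (f x) < e" using z d(1) by (intro d(2)) (auto simp: dist_commute)
      then show ?thesis using f(2)[OF x] by (simp add: dist_real_def)
    qed
    then show ?thesis using d(1) by (intro exI[of _ "min 1 (d / 2)"]) auto
  qed
  {
    case 0
    then show ?case using v[of f] by (simp add: Ck_0)
  next
    case (Suc n)
    obtain r0 where r0: "r0 > 0" "\<And>x z. x \<in> K \<Longrightarrow> dist x z \<le> r0 \<Longrightarrow> \<bar>f z\<bar> \<le> B + e"
      using v[OF Ck_continuous[OF Suc.prems(1)]] jet_le_abs[OF Suc.prems(2)] by metis
    have "\<exists>r>0. \<forall>x\<in>K. \<forall>z. dist x z \<le> r \<longrightarrow> jet_le n 1 (B + e) (pd b f) z" if b: "b \<in> Basis" for b
      using Suc.prems jet_le_pd[OF Suc.prems(2) b] b by (intro Suc.IH) (auto simp: Ck_Suc)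
    then obtain r where r: "\<And>b. b \<in> Basis \<Longrightarrow> r b > 0"
      "\<And>b x z. b \<in> Basis \<Longrightarrow> x \<in> K \<Longrightarrow> dist x z \<le> r b \<Longrightarrow> jet_le n 1 (B + e) (pd b f) z" by metis
    define r' where "r' = min r0 (Min (r ` Basis))"
    have "0 < r'" using r(1) r0 by (simp add: r'_def)
    moreover have "r' \<le> r b" if "b \<in> Basis" for b
      unfolding r'_def using that by (intro min.coboundedI2 Min_le) auto
    ultimately show ?case
      using r0 r(2) by (intro exI[of _ r']) (force simp: r'_def)
  }
qed

text \<open>Near the hull \<open>K0\<close> of \<open>X\<close> the extension is \<open>f\<close> itself, elsewhere
  the average \<open>G\<close> of the Taylor polynomials of \<open>f\<close> at the points of
  \<open>K\<close>, a thickening of \<open>K0\<close> by \<open>\<delta>\<close>. The transition takes place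
  where the distance to \<open>K\<close> is comparable to \<open>\<delta>\<close>, through a cutoff
  \<open>\<eta>\<close> of the average \<open>\<kappa>\<close> of the regularized squared distances to the
  points of \<open>K\<close>, a smooth function comparable to the squared distance to \<open>K\<close> plus
  \<open>\<delta> ^ 2\<close>. A second cutoff \<open>\<theta>\<close>, on the scale of the diameter, makes
  the support compact.

  To estimate derivatives at a point \<open>x\<close>, the Taylor polynomial \<open>T\<close> at the point
  of \<open>K\<close> nearest to \<open>x\<close> is subtracted: on the scale \<open>\<rho>\<close> of the
  distance to \<open>K\<close>, both \<open>f - T\<close> and \<open>G - T\<close> have size
  \<open>\<rho> ^ s\<close>, which absorbs the loss of a factor \<open>1 / \<rho>\<close> in each derivative
  of \<open>\<eta>\<close> and of the weights. As these estimates hold for every \<open>\<rho>\<close>, the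
  constants depend neither on \<open>\<delta>\<close> nor on the shape of \<open>X\<close>.\<close>

lemma whitney_extension:
  assumes "0 \<le> D"
  shows "\<exists>C\<ge>0. \<exists>R>0. \<forall>(X :: 'a::euclidean_space set) f B.
       compact X \<longrightarrow> X \<noteq> {} \<longrightarrow> (\<forall>x\<in>X. \<forall>y\<in>X. dist x y \<le> D) \<longrightarrow> smooth_fun f \<longrightarrow>
       (\<forall>x\<in>convex hull X. jet_le s 1 B f x) \<longrightarrow>
       (\<exists>F x0. Ck s F \<and> (\<forall>x\<in>X. F x = f x) \<and> (\<forall>x. x \<notin> cball x0 R \<longrightarrow> F x = 0) \<and>
         (\<forall>x. jet_le s 1 (C * (B + 1)) F x))"
proof -
  let ?d = "real DIM('a)"
  define L where "L = ?d * 2 ^ s + 1"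
  have L: "1 \<le> L" by (simp add: L_def)
  (* The weights decay fast enough for the moments of order 2 (for \<kappa>) and s (for G). *)
  obtain q0 where q0: "(3 / 4) ^ q0 < (1 / 2) / 2 ^ DIM('a :: euclidean_space) * (1::real)"
    using real_arch_pow_inv[of "(1 / 2) / 2 ^ DIM('a) * (1::real)" "3 / 4"] by auto
  define N where "N = q0 + s + 2"
  have Na: "a \<le> 2 * N" "2 ^ DIM('a) * (3 / 4) ^ (2 * N - a) \<le> (1 / 2 :: real)" if "a \<le> s + 2" for a
  proof -
    have "(3 / 4 :: real) ^ (2 * N - a) \<le> (3 / 4) ^ q0"
      using that by (intro power_decreasing) (auto simp: N_def)
    also have "\<dots> \<le> (1 / 2) / 2 ^ DIM('a)" using q0 by simp
    finally show "2 ^ DIM('a) * (3 / 4) ^ (2 * N - a) \<le> (1 / 2 :: real)" by (simp add: field_simps)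
  qed (use that in \<open>auto simp: N_def\<close>)
  let ?C1 = "average_const s N ?d"
  let ?C3 = "recenter_const ?d s"
  obtain M where M: "M \<ge> 1" "\<And>j t. j \<le> s \<Longrightarrow> \<bar>step_deriv j t\<bar> \<le> M"
    using step_deriv_bounded[of s] by metis
  define C0 where "C0 = ?C1 * L"
  have C0: "1 \<le> C0" unfolding C0_def by (intro mult_ge1_I average_const_ge_1 L)
  define C\<eta> where "C\<eta> = compose_const s (C0 * (C0 + 1))"
  define L\<theta> where "L\<theta> = 2 + 4 * L"
  define C\<theta> where "C\<theta> = compose_const s L\<theta>"
  have C\<eta>\<theta>: "1 \<le> C\<eta>" "1 \<le> C\<theta>" by (simp_all add: C\<eta>_def C\<theta>_def compose_const_ge_1)
  (* Where the argument of the step is negative, all derivatives of the cutoff vanish,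
     whatever the derivatives of its argument are. *)
  have cut0: "jet_le s \<rho> 0 (\<lambda>z. step (g z)) x" if \<rho>: "0 < \<rho>" and g: "Ck s g" "g x < 0"
    for g :: "'a \<Rightarrow> real" and \<rho> x
  proof -
    obtain A where A: "jet_le s \<rho> A g x" using jet_le_exists[OF \<rho> g(1)] by blast
    have "jet_le s \<rho> (compose_const s A * 0) (\<lambda>z. step_deriv 0 (g z)) x"
    proof (rule jet_le_compose[where H=step_deriv, OF step_deriv_chain \<rho> g(1)])
      show "jet_le m \<rho> (A / \<rho>) (pd b g) x" if "s = Suc m" "b \<in> Basis" for m b
        using A that by simp
      show "\<bar>step_deriv (0 + i) (g x)\<bar> \<le> 0" for i
        using step_deriv_outside[of "g x" i] g(2) by simp
    qed
    then show ?thesis by simp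
  qed
  define R where "R = D + 1"
  have R: "1 \<le> R" using assms by (simp add: R_def)
  define A1 where "A1 = real s * (?d * (2 * R)) ^ s"
  define A2 where "A2 = 2 ^ s * (1 + C\<eta> * M) * (?C1 * ?C3) + 2 ^ s * (C\<eta> * M) * ?d ^ s"
  define C where "C = 2 ^ s * (C\<theta> * M) * (A1 + A2 * (2 * R + 1) ^ s)"
  have nn: "0 \<le> C\<eta> * M" "0 \<le> C\<theta> * M" using C\<eta>\<theta> M by auto
  have A: "0 \<le> A1" "0 \<le> A2" using nn R average_const_ge_1[of s N ?d] by (auto simp: A1_def A2_def recenter_const_nonneg)
  then have C: "0 \<le> C" using nn R by (auto simp: C_def)
  have "\<exists>F x0. Ck s F \<and> (\<forall>x\<in>X. F x = f x) \<and> (\<forall>x. x \<notin> cball x0 (2 * R) \<longrightarrow> F x = 0) \<and>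
         (\<forall>x. jet_le s 1 (C * (B + 1)) F x)"
    if X: "compact X" "X \<noteq> {}" "\<And>x y. x \<in> X \<Longrightarrow> y \<in> X \<Longrightarrow> dist x y \<le> D"
      and f: "smooth_fun f" and Bf: "\<And>x. x \<in> convex hull X \<Longrightarrow> jet_le s 1 B f x"
    for X :: "'a set" and f B
  proof -
    define K0 where "K0 = convex hull X"
    have K0: "compact K0" "convex K0" "X \<subseteq> K0"
      using X(1) by (auto simp: K0_def compact_convex_hull hull_inc)
    obtain x0 where x0: "x0 \<in> X" using X(2) by blast
    have fC: "Ck n f" for n using f by (simp add: smooth_fun_iff_Ck)
    obtain r0' where r0': "0 < r0'" "\<And>x z. x \<in> K0 \<Longrightarrow> dist x z \<le> r0' \<Longrightarrow> jet_le s 1 (B + 1) f z"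
      using jet_le_thicken[OF K0(1) zero_less_one fC, of s B] Bf unfolding K0_def by blast
    define r0 where "r0 = min 1 r0'"
    have r0: "0 < r0" "r0 \<le> 1" and jf: "\<And>x z. x \<in> K0 \<Longrightarrow> dist x z \<le> r0 \<Longrightarrow> jet_le s 1 (B + 1) f z"
      using r0' by (auto simp: r0_def)
    have Bp: "0 \<le> B + 1" using jet_le_nonneg[OF jf[of x0 x0]] x0 K0 r0 by auto
    (* The support of \<eta> lies within distance (C0 + 1) \<delta> of K0, where the bounds on f hold. *)
    define \<delta> where "\<delta> = r0 / (C0 + 1)"
    have \<delta>: "0 < \<delta>" "(C0 + 1) * \<delta> = r0" using r0 C0 by (auto simp: \<delta>_def)
    then have \<delta>r0: "\<delta> \<le> r0" using mult_right_mono[of 1 "C0 + 1" \<delta>] C0 by simp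
    define K where "K = thicken \<delta> K0"
    have KK: "compact K" "convex K" by (simp_all add: K_def compact_thicken convex_thicken K0)
    have XK: "X \<subseteq> K" using K0(3) \<delta> by (force simp: K_def mem_thicken)
    have "ball x0 \<delta> \<subseteq> K" using x0 K0(3) by (force simp: K_def mem_thicken)
    then have "measure lborel (ball x0 \<delta>) \<le> measure lborel K"
      using KK emeasure_compact_finite[OF KK(1)]
      by (intro measure_mono_fmeasurable) (auto simp: fmeasurable_def compact_imp_closed)
    then have Km: "0 < measure lborel K" using content_ball_pos[OF \<delta>(1), of x0] by (simp add: measure_def)
    have jK: "jet_le s 1 (B + 1) f z" if "z \<in> K" for z
      using that jf \<delta>r0 unfolding K_def mem_thicken by force
    define \<kappa> where "\<kappa> = average N \<delta> K (sqdist \<delta>)"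
    define G where "G = average N \<delta> K (\<lambda>x y. taylor s f y x)"
    define \<eta> where "\<eta> x = step (C0 + 1 - \<kappa> x * inverse (\<delta> ^ 2))" for x
    define \<theta> where "\<theta> x = step (2 - inverse (R ^ 2) * sqdist 0 x x0)" for x
    define F where "F x = \<theta> x * (\<eta> x * f x + (1 - \<eta> x) * G x)" for x
    have c\<kappa>: "Ck s \<kappa>" unfolding \<kappa>_def by (rule Ck_average[OF KK Km \<delta>(1) Ck_family_sqdist])
    have cG: "Ck s G" unfolding G_def by (rule Ck_average[OF KK Km \<delta>(1) Ck_family_taylor[OF f]])
    have cg\<eta>: "Ck s (\<lambda>x. C0 + 1 - \<kappa> x * inverse (\<delta> ^ 2))"
      by (intro Ck_diff Ck_const Ck_mult c\<kappa>)
    have c\<eta>: "Ck s \<eta>" unfolding \<eta>_def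
      using Ck_compose[where H=step_deriv and j=0, OF step_deriv_chain cg\<eta>] by simp
    have csq: "Ck s (\<lambda>x. sqdist 0 x x0)" using Ck_family_section[OF Ck_family_sqdist, of x0 UNIV] by simp
    have cg\<theta>: "Ck s (\<lambda>x. 2 - inverse (R ^ 2) * sqdist 0 x x0)"
      by (intro Ck_diff Ck_const Ck_mult csq)
    have c\<theta>: "Ck s \<theta>" unfolding \<theta>_def
      using Ck_compose[where H=step_deriv and j=0, OF step_deriv_chain cg\<theta>] by simp
    have cF: "Ck s F" unfolding F_def
      by (intro Ck_mult Ck_add Ck_diff Ck_const c\<eta> c\<theta> cG fC)
    have j\<kappa>: "jet_le s (sqrt (sqdist \<delta> x p)) (C0 * sqdist \<delta> x p) \<kappa> x"
      if p: "p \<in> K" "\<And>y. y \<in> K \<Longrightarrow> norm (x - p) \<le> norm (x - y)" for x p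
    proof -
      have "jet_le s (sqrt (sqdist \<delta> x p)) (?C1 * L * sqrt (sqdist \<delta> x p) ^ 2) \<kappa> x"
        unfolding \<kappa>_def
      proof (rule jet_le_average[OF KK Km \<delta>(1) Ck_family_sqdist p Na])
        fix y
        show "jet_le s (sqrt (sqdist \<delta> x y)) (L * sqrt (sqdist \<delta> x y) ^ 2) (\<lambda>x. sqdist \<delta> x y) x"
          unfolding L_def using sqdist_pos[OF \<delta>(1), of x y] \<delta>(1)
          by (intro jet_le_sqdist) (auto simp: sqdist_eq intro!: real_le_rsqrt)
      qed auto
      then show ?thesis using sqdist_pos[OF \<delta>(1), of x p] by (simp add: C0_def)
    qed
    have F_X: "F x = f x" if x: "x \<in> X" for x
    proof -
      have "jet_le s (sqrt (sqdist \<delta> x x)) (C0 * sqdist \<delta> x x) \<kappa> x"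
        using x XK by (intro j\<kappa>) auto
      then have "\<kappa> x \<le> C0 * \<delta> ^ 2" using jet_le_abs by (fastforce simp: sqdist_eq)
      then have "\<eta> x = 1" unfolding \<eta>_def using \<delta>(1) by (intro step_ge_1) (simp add: field_simps)
      moreover have "norm (x - x0) ^ 2 \<le> R ^ 2"
        using X(3)[OF x x0] by (intro power_mono) (auto simp: R_def dist_norm)
      then have "\<theta> x = 1" unfolding \<theta>_def sqdist_eq using R by (intro step_ge_1) (simp add: field_simps)
      ultimately show ?thesis by (simp add: F_def)
    qed
    have F_0: "F x = 0" if "x \<notin> cball x0 (2 * R)" for x
    proof -
      have "2 * R \<le> norm (x - x0)" using that by (simp add: dist_norm norm_minus_commute)
      then have "(2 * R) ^ 2 \<le> norm (x - x0) ^ 2" using R by (intro power_mono) auto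
      then have "2 ^ 2 * R ^ 2 \<le> norm (x - x0) ^ 2" unfolding power_mult_distrib .
      moreover have "2 * R ^ 2 \<le> 2 ^ 2 * R ^ 2" by (intro mult_right_mono) auto
      ultimately have "2 * R ^ 2 \<le> norm (x - x0) ^ 2" by linarith
      then have "\<theta> x = 0" unfolding \<theta>_def sqdist_eq using R by (intro step_nonpos) (simp add: field_simps)
      then show ?thesis by (simp add: F_def)
    qed
    have "jet_le s 1 (C * (B + 1)) F x" for x
    proof (cases "norm (x - x0) \<le> 2 * R")
      case False
      then have "(2 * R) ^ 2 < norm (x - x0) ^ 2" using R by (intro power_strict_mono) auto
      then have "2 ^ 2 * R ^ 2 < norm (x - x0) ^ 2" unfolding power_mult_distrib .
      moreover have "2 * R ^ 2 \<le> 2 ^ 2 * R ^ 2" by (intro mult_right_mono) auto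
      ultimately have "2 * R ^ 2 < norm (x - x0) ^ 2" by linarith
      then have "jet_le s 1 0 \<theta> x" unfolding \<theta>_def
        using R by (intro cut0 cg\<theta>) (auto simp: sqdist_eq field_simps)
      moreover have c: "Ck s (\<lambda>x. \<eta> x * f x + (1 - \<eta> x) * G x)"
        by (intro Ck_mult Ck_add Ck_diff Ck_const c\<eta> cG fC)
      moreover obtain A where "jet_le s 1 A (\<lambda>x. \<eta> x * f x + (1 - \<eta> x) * G x) x"
        using jet_le_exists[OF zero_less_one c] by blast
      ultimately have "jet_le s 1 (2 ^ s * 0 * A) F x"
        unfolding F_def by (intro jet_le_mult c\<theta>) auto
      then show ?thesis using C Bp by (auto elim!: jet_le_mono)
    next
      case True
      obtain p where p: "p \<in> K" "\<And>y. y \<in> K \<Longrightarrow> dist x p \<le> dist x y"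
        using distance_attains_inf[of K x] KK XK x0 compact_imp_closed by auto
      then have p': "\<And>y. y \<in> K \<Longrightarrow> norm (x - p) \<le> norm (x - y)" by (simp add: dist_norm)
      define \<rho> where "\<rho> = sqrt (sqdist \<delta> x p)"
      have \<rho>: "0 < \<rho>" "\<rho> ^ 2 = norm (x - p) ^ 2 + \<delta> ^ 2" "norm (x - p) \<le> \<rho>"
        using sqdist_pos[OF \<delta>(1), of x p] by (auto simp: \<rho>_def sqdist_eq intro!: real_le_rsqrt)
      have xp: "norm (x - p) \<le> 2 * R" using p'[of x0] x0 XK True by force
      have "\<rho> \<le> norm (x - p) + \<delta>"
        unfolding \<rho>_def sqdist_eq using \<delta>(1) sqrt_sum_squares_le_sum[of "norm (x - p)" \<delta>] by simp
      then have \<rho>R: "\<rho> \<le> 2 * R + 1" using xp \<delta>r0 r0 by simp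
      define T where "T = taylor s f p"
      have cT: "Ck s T" unfolding T_def by (rule Ck_taylor[OF f])
      have jT: "jet_le s 1 (A1 * (B + 1)) T x"
        unfolding A1_def T_def using f jK[OF p(1)] xp R by (intro jet_le_taylor) auto
      have jGT: "jet_le s \<rho> (?C1 * (?C3 * (B + 1)) * \<rho> ^ s) (\<lambda>x. G x - T x) x"
      proof -
        have e: "(\<lambda>x. G x - T x) = average N \<delta> K (\<lambda>x y. taylor s f y x - T x)"
          unfolding G_def using average_diff_const[OF KK Km \<delta>(1) Ck_family_taylor[OF f, of 0 K s], where N=N and h=T] by (simp add: fun_eq_iff)
        show ?thesis unfolding e \<rho>_def
        proof (rule jet_le_average[OF KK Km \<delta>(1) _ p(1) p' Na])
          show "Ck_family s K (\<lambda>x y. taylor s f y x - T x)"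
            by (intro Ck_family_diff Ck_family_taylor f Ck_imp_family cT)
          fix y assume y: "y \<in> K"
          have "norm (x - y) \<le> sqrt (sqdist \<delta> x y)" by (auto simp: sqdist_eq intro!: real_le_rsqrt)
          moreover have "closed_segment p y \<subseteq> K" using p(1) y KK by (simp add: closed_segment_subset)
          ultimately show "jet_le s (sqrt (sqdist \<delta> x y)) (?C3 * (B + 1) * sqrt (sqdist \<delta> x y) ^ s)
              (\<lambda>x. taylor s f y x - T x) x"
            unfolding T_def using f p'[OF y] sqdist_pos[OF \<delta>(1), of x y] jK
            by (intro jet_le_taylor_recenter) auto
        qed auto
      qed
      (* The derivatives of \<kappa> / \<delta>^2 are bounded on the scale \<rho> only where \<rho> is
         comparable to \<delta>; farther away \<eta> vanishes identically. *)
      have j\<eta>: "jet_le s \<rho> (C\<eta> * M) \<eta> x \<and> (jet_le s \<rho> 0 \<eta> x \<or> x \<in> thicken r0 K0)"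
      proof (cases "norm (x - p) ^ 2 \<le> C0 * \<delta> ^ 2")
        case near: True
        have "C0 * \<delta> ^ 2 \<le> C0 ^ 2 * \<delta> ^ 2"
          using C0 by (intro mult_right_mono) (auto simp: power2_eq_square)
        with near have "norm (x - p) ^ 2 \<le> (C0 * \<delta>) ^ 2" unfolding power_mult_distrib by linarith
        then have n1: "norm (x - p) \<le> C0 * \<delta>"
          using C0 \<delta>(1) by (elim power2_le_imp_le) auto
        obtain q where q: "q \<in> K0" "dist q p \<le> \<delta>" using p(1) by (auto simp: K_def mem_thicken)
        have "dist q x \<le> dist q p + dist x p" by (metis dist_commute dist_triangle)
        also have "\<dots> \<le> (C0 + 1) * \<delta>" using q n1 by (simp add: dist_norm algebra_simps)
        finally have t: "x \<in> thicken r0 K0" using q(1) \<delta>(2) by (auto simp: mem_thicken)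
        have "jet_le s \<rho> (\<bar>inverse (\<delta> ^ 2)\<bar> * (C0 * sqdist \<delta> x p)) (\<lambda>x. inverse (\<delta> ^ 2) * \<kappa> x) x"
          unfolding \<rho>_def using sqdist_pos[OF \<delta>(1), of x p] by (intro jet_le_cmult j\<kappa> c\<kappa> p(1) p') auto
        moreover have "\<bar>inverse (\<delta> ^ 2)\<bar> * (C0 * sqdist \<delta> x p) \<le> C0 * (C0 + 1)"
        proof -
          have "sqdist \<delta> x p \<le> (C0 + 1) * \<delta> ^ 2" using near by (simp add: sqdist_eq algebra_simps)
          then have "C0 * sqdist \<delta> x p \<le> C0 * ((C0 + 1) * \<delta> ^ 2)" using C0 by (intro mult_left_mono) auto
          then show ?thesis using \<delta>(1) by (simp add: field_simps)
        qed
        ultimately have k: "jet_le s \<rho> (C0 * (C0 + 1)) (\<lambda>x. inverse (\<delta> ^ 2) * \<kappa> x) x"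
          using jet_le_mono \<rho>(1) by blast
        have "jet_le s \<rho> (C\<eta> * M) (\<lambda>z. step_deriv 0 (C0 + 1 - \<kappa> z * inverse (\<delta> ^ 2))) x"
        unfolding C\<eta>_def
        proof (rule jet_le_compose[where H=step_deriv, OF step_deriv_chain \<rho>(1) cg\<eta>])
          fix m b assume m: "s = Suc m" and b: "b \<in> (Basis :: 'a set)"
          have c: "Ck (Suc m) (\<lambda>x. inverse (\<delta> ^ 2) * \<kappa> x)" using c\<kappa> m by (auto intro: Ck_cmult)
          have "pd b (\<lambda>x. C0 + 1 - \<kappa> x * inverse (\<delta> ^ 2)) = (\<lambda>x. (-1) * pd b (\<lambda>x. inverse (\<delta> ^ 2) * \<kappa> x) x)"
            using pd_diff[of "\<lambda>_. C0 + 1", OF _ Ck_differentiable[OF c], of _ b]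
            by (auto simp: fun_eq_iff mult.commute)
          moreover have "jet_le m \<rho> (\<bar>-1\<bar> * (C0 * (C0 + 1) / \<rho>)) (\<lambda>x. (-1) * pd b (\<lambda>x. inverse (\<delta> ^ 2) * \<kappa> x) x) x"
            using k m b c \<rho>(1) by (intro jet_le_cmult) (auto simp: Ck_Suc)
          ultimately show "jet_le m \<rho> (C0 * (C0 + 1) / \<rho>) (pd b (\<lambda>x. C0 + 1 - \<kappa> x * inverse (\<delta> ^ 2))) x"
            by simp
        qed (use M in auto)
        then show ?thesis using t by (simp add: \<eta>_def[abs_def])
      next
        case far: False
        have "sqdist \<delta> x p \<le> \<kappa> x" unfolding \<kappa>_def
        proof (rule average_ge[OF KK Km \<delta>(1) Ck_family_sqdist[of 0]])
          show "sqdist \<delta> x p \<le> sqdist \<delta> x y" if "y \<in> K" for y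
            unfolding sqdist_eq using p'[OF that] by (intro add_right_mono power_mono) auto
        qed
        moreover have "(C0 + 1) * \<delta> ^ 2 < sqdist \<delta> x p" using far by (simp add: sqdist_eq algebra_simps)
        ultimately have "(C0 + 1) * \<delta> ^ 2 < \<kappa> x" by simp
        then have "jet_le s \<rho> 0 \<eta> x" unfolding \<eta>_def
          using \<delta>(1) by (intro cut0 cg\<eta> \<rho>) (simp add: field_simps)
        then show ?thesis using jet_le_mono nn(1) \<rho>(1) by blast
      qed
      have j\<eta>f: "jet_le s \<rho> (2 ^ s * (C\<eta> * M) * (?d ^ s * (B + 1) * \<rho> ^ s)) (\<lambda>x. \<eta> x * (f x - T x)) x"
      proof (cases "x \<in> thicken r0 K0")
        case True
        have "p \<in> thicken r0 K0" using p(1) \<delta>r0 by (force simp: K_def mem_thicken)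
        then have "\<And>z. z \<in> closed_segment p x \<Longrightarrow> z \<in> thicken r0 K0" using True convex_thicken[OF K0(2)] closed_segment_subset by blast
        then have "\<And>z. z \<in> closed_segment p x \<Longrightarrow> jet_le s 1 (B + 1) f z"
          unfolding mem_thicken using jf by meson
        then have "jet_le s \<rho> (?d ^ s * (B + 1) * \<rho> ^ s) (\<lambda>z. f z - T z) x"
          unfolding T_def using f \<rho> by (intro jet_le_taylor_remainder) auto
        then show ?thesis using j\<eta> \<rho> by (intro jet_le_mult Ck_diff c\<eta> cT fC) auto
      next
        case False
        then have 0: "jet_le s \<rho> 0 \<eta> x" using j\<eta> by blast
        have c: "Ck s (\<lambda>x. f x - T x)" by (intro Ck_diff cT fC)
        obtain A where "jet_le s \<rho> A (\<lambda>x. f x - T x) x" using jet_le_exists[OF \<rho>(1) c] by blast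
        then have "jet_le s \<rho> (2 ^ s * 0 * A) (\<lambda>x. \<eta> x * (f x - T x)) x"
          using 0 c \<rho>(1) by (intro jet_le_mult c\<eta>)
        then show ?thesis using nn Bp \<rho>(1) by (auto elim!: jet_le_mono)
      qed
      have "jet_le s \<rho> (2 ^ s * (1 + C\<eta> * M) * (?C1 * (?C3 * (B + 1)) * \<rho> ^ s)
           + 2 ^ s * (C\<eta> * M) * (?d ^ s * (B + 1) * \<rho> ^ s)) (\<lambda>x. (1 - \<eta> x) * (G x - T x) + \<eta> x * (f x - T x)) x"
      proof (rule jet_le_add[OF _ _ _ j\<eta>f])
        show "jet_le s \<rho> (2 ^ s * (1 + C\<eta> * M) * (?C1 * (?C3 * (B + 1)) * \<rho> ^ s)) (\<lambda>x. (1 - \<eta> x) * (G x - T x)) x"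
          using j\<eta> jGT \<rho>(1)
          by (intro jet_le_mult jet_le_diff[where f="\<lambda>x. 1"] jet_le_const Ck_diff Ck_const c\<eta> cG cT) auto
      qed (intro Ck_mult Ck_diff Ck_const c\<eta> cG cT fC)+
      also have "2 ^ s * (1 + C\<eta> * M) * (?C1 * (?C3 * (B + 1)) * \<rho> ^ s)
           + 2 ^ s * (C\<eta> * M) * (?d ^ s * (B + 1) * \<rho> ^ s) = A2 * (B + 1) * \<rho> ^ s"
        unfolding A2_def distrib_right by (simp only: ac_simps)
      finally have "jet_le s 1 (A2 * (B + 1) * (2 * R + 1) ^ s) (\<lambda>x. (1 - \<eta> x) * (G x - T x) + \<eta> x * (f x - T x)) x"
        using \<rho>(1) \<rho>R R by (intro jet_le_unit_scale[of s \<rho>]) auto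
      then have inner: "jet_le s 1 (A1 * (B + 1) + A2 * (B + 1) * (2 * R + 1) ^ s)
          (\<lambda>x. T x + ((1 - \<eta> x) * (G x - T x) + \<eta> x * (f x - T x))) x"
        using jT by (intro jet_le_add Ck_add Ck_mult Ck_diff Ck_const c\<eta> cG cT fC)
      have "jet_le s 1 (C\<theta> * M) (\<lambda>z. step_deriv 0 (2 - inverse (R ^ 2) * sqdist 0 z x0)) x"
      unfolding C\<theta>_def
      proof (rule jet_le_compose[where H=step_deriv, OF step_deriv_chain zero_less_one cg\<theta>])
        have "jet_le s (2 * R) (L * (2 * R) ^ 2) (\<lambda>x. sqdist 0 x x0) x"
          unfolding L_def using True R by (intro jet_le_sqdist) auto
        then have "jet_le s 1 (L * (2 * R) ^ 2) (\<lambda>x. sqdist 0 x x0) x"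
          using R by (elim jet_le_mono_scale) auto
        then have "jet_le s 1 (2 + \<bar>inverse (R ^ 2)\<bar> * (L * (2 * R) ^ 2)) (\<lambda>x. 2 - inverse (R ^ 2) * sqdist 0 x x0) x"
          by (intro jet_le_diff jet_le_cmult jet_le_const Ck_const Ck_cmult csq) auto
        moreover have "2 + \<bar>inverse (R ^ 2)\<bar> * (L * (2 * R) ^ 2) = L\<theta>"
          using R by (simp add: L\<theta>_def power_mult_distrib field_simps)
        ultimately have "jet_le s 1 L\<theta> (\<lambda>x. 2 - inverse (R ^ 2) * sqdist 0 x x0) x"
          by simp
        then show "jet_le m 1 (L\<theta> / 1) (pd b (\<lambda>x. 2 - inverse (R ^ 2) * sqdist 0 x x0)) x"
          if "s = Suc m" "b \<in> Basis" for m b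
          using that by simp
      qed (use M in auto)
      then have "jet_le s 1 (C\<theta> * M) \<theta> x" by (simp add: \<theta>_def[abs_def])
      then have "jet_le s 1 (2 ^ s * (C\<theta> * M) * (A1 * (B + 1) + A2 * (B + 1) * (2 * R + 1) ^ s))
          (\<lambda>x. \<theta> x * (T x + ((1 - \<eta> x) * (G x - T x) + \<eta> x * (f x - T x)))) x"
        using inner by (intro jet_le_mult c\<theta> Ck_add Ck_mult Ck_diff Ck_const c\<eta> cG cT fC) auto
      moreover have "(\<lambda>x. \<theta> x * (T x + ((1 - \<eta> x) * (G x - T x) + \<eta> x * (f x - T x)))) = F"
        by (auto simp: F_def fun_eq_iff algebra_simps)
      moreover have "2 ^ s * (C\<theta> * M) * (A1 * (B + 1) + A2 * (B + 1) * (2 * R + 1) ^ s) = C * (B + 1)"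
        unfolding C_def distrib_left by (simp add: algebra_simps)
      ultimately show ?thesis by simp
    qed
    then show ?thesis using cF F_X F_0 by blast
  qed
  moreover have "0 < 2 * R" using R by simp
  ultimately show ?thesis using C by (intro exI[of _ C] exI[of _ "2 * R"] conjI allI impI) auto
qed

section \<open>Classical derivatives as weak derivatives\<close>

lemma continuous_integrable_compact_support:
  fixes h :: "'a::euclidean_space \<Rightarrow> real"
  assumes "continuous_on UNIV h" "\<And>x. x \<notin> cball c R \<Longrightarrow> h x = 0"
  shows "integrable lborel h"
proof -
  have "integrable lborel (\<lambda>x. indicator (cball c R) x *\<^sub>R h x)"
    using assms(1) continuous_on_subset by (intro borel_integrable_compact) auto
  moreover have "(\<lambda>x. indicator (cball c R) x *\<^sub>R h x) = h"
    using assms(2) by (auto simp: indicator_def fun_eq_iff)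
  ultimately show ?thesis by simp
qed

lemma pd_vanishes_outside:
  assumes "\<And>x. x \<notin> cball c R \<Longrightarrow> h x = 0" "x \<notin> cball c R"
  shows "pd b h x = 0"
proof -
  have "((\<lambda>x. 0) has_derivative (\<lambda>x. 0)) (at x)" by simp
  then have "(h has_derivative (\<lambda>x. 0)) (at x)"
    by (rule has_derivative_transform_within_open[where s="- cball c R"])
      (use assms in auto)
  then show ?thesis by (rule pd_eqI)
qed

text \<open>The integral of the translates of \<open>h\<close> in the direction \<open>b\<close> is constant.
  Differentiating it under the integral sign gives the claim.\<close>

lemma integral_pd_eq_0:
  fixes h :: "'a::euclidean_space \<Rightarrow> real"
  assumes h: "Ck (Suc 0) h" and van: "\<And>x. x \<notin> cball c R \<Longrightarrow> h x = 0" and b: "b \<in> Basis"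
  shows "(LINT x|lborel. pd b h x) = 0"
proof -
  (* Translating h by less than 1 keeps its support inside this ball. *)
  define S where "S = cball c (R + 1)"
  have S: "compact S" by (simp add: S_def)
  interpret compact_finite_measure "restrict_space lborel S" S
    using S by (rule compact_finite_measure_lborel)
  define g where "g t x = h (x + t *\<^sub>R b)" for t :: real and x
  have hc: "continuous_on UNIV h" "continuous_on UNIV (pd b h)"
    using h b by (auto simp: Ck_Suc Ck_0)
  have d: "((\<lambda>t. g t x) has_real_derivative pd b h (x + t *\<^sub>R b)) (at t)" for t x
    unfolding g_def using h by (intro has_derivative_line) (simp add: Ck_Suc)
  have p: "pd 1 (\<lambda>t. g t x) t = pd b h (x + t *\<^sub>R b)" for t x
    using pd_eqI[OF d[unfolded has_field_derivative_def], of 1] by simp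
  have cc: "continuous_on (UNIV \<times> S) (\<lambda>(t, x). k (x + t *\<^sub>R b))" if "continuous_on UNIV k" for k :: "'a \<Rightarrow> real"
    using that by (auto simp: case_prod_beta intro!: continuous_on_compose2[of UNIV k] continuous_intros)
  have g: "Ck_family (Suc 0) S g"
    using cc[OF hc(1)] cc[OF hc(2)] d
    by (auto simp: p g_def[symmetric] has_field_derivative_def intro: differentiableI)
  have restr: "(LINT x|restrict_space lborel S. k x) = (LINT x|lborel. k x)"
    if "\<And>x. x \<notin> S \<Longrightarrow> k x = 0" for k :: "'a \<Rightarrow> real"
    unfolding integral_over_compact[OF S]
    by (intro Bochner_Integration.integral_cong) (use that in \<open>auto simp: indicator_def\<close>)
  have const: "(LINT x|restrict_space lborel S. g t x) = (LINT x|lborel. h x)" if t: "\<bar>t\<bar> < 1" for t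
  proof -
    have "g t x = 0" if x: "x \<notin> S" for x
    proof -
      have "R + 1 < dist c x" using x by (simp add: S_def)
      also have "\<dots> \<le> dist c (x + t *\<^sub>R b) + dist (x + t *\<^sub>R b) x" by (rule dist_triangle)
      also have "dist (x + t *\<^sub>R b) x \<le> 1" using t b by (simp add: dist_norm)
      finally show ?thesis unfolding g_def by (intro van) auto
    qed
    then have "(LINT x|restrict_space lborel S. g t x) = (LINT x|lborel. g t x)" by (rule restr)
    also have "\<dots> = (LINT x|lborel. h x)"
      using lborel_integral_affine[of h 1 "t *\<^sub>R b"] hc(1)
      by (simp add: g_def add.commute borel_measurable_continuous_onI)
    finally show ?thesis .
  qed
  define F where "F t = (LINT x|restrict_space lborel S. g t x)" for t
  have "(F has_derivative (\<lambda>z. \<Sum>a\<in>Basis. (z \<bullet> a) * (LINT x|restrict_space lborel S. pd a (\<lambda>t. g t x) 0))) (at 0)"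
    unfolding F_def by (rule has_derivative_integral_family[OF g])
  from pd_eqI[OF this, of 1] have "pd 1 F 0 = (LINT x|restrict_space lborel S. pd b h x)"
    by (simp add: p)
  moreover have "pd 1 F 0 = 0"
  proof -
    have "((\<lambda>t::real. (LINT x|lborel. h x)) has_derivative (\<lambda>t. 0)) (at 0)" by simp
    then have "(F has_derivative (\<lambda>t. 0)) (at 0)"
      by (rule has_derivative_transform_within_open[where s="{-1<..<1}"]) (auto simp: F_def const)
    then show ?thesis by (rule pd_eqI)
  qed
  moreover have "(LINT x|restrict_space lborel S. pd b h x) = (LINT x|lborel. pd b h x)"
    by (rule restr, rule pd_vanishes_outside[OF van]) (auto simp: S_def)
  ultimately show ?thesis by simp
qed

lemma integration_by_parts:
  fixes f g :: "'a::euclidean_space \<Rightarrow> real"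
  assumes f: "Ck (Suc 0) f" "\<And>x. x \<notin> cball c R \<Longrightarrow> f x = 0" and g: "Ck (Suc 0) g" and b: "b \<in> Basis"
  shows "(LINT x|lborel. f x * pd b g x) = - (LINT x|lborel. pd b f x * g x)"
proof -
  have c: "continuous_on UNIV f" "continuous_on UNIV g" "continuous_on UNIV (pd b f)" "continuous_on UNIV (pd b g)"
    using f g b by (auto simp: Ck_Suc Ck_0)
  have i: "integrable lborel (\<lambda>x. f x * pd b g x)" "integrable lborel (\<lambda>x. pd b f x * g x)"
    using f(2) pd_vanishes_outside[OF f(2)]
    by (auto intro!: continuous_integrable_compact_support[where c=c and R=R] continuous_on_mult c)
  have "(LINT x|lborel. pd b (\<lambda>x. f x * g x) x) = 0"
    by (rule integral_pd_eq_0[where c=c and R=R, OF Ck_mult[OF f(1) g] _ b]) (use f(2) in simp)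
  also have "pd b (\<lambda>x. f x * g x) = (\<lambda>x. f x * pd b g x + pd b f x * g x)"
    using f g by (auto simp: fun_eq_iff Ck_Suc intro!: pd_mult)
  finally show ?thesis using i by simp
qed

text \<open>The order of the derivatives is reversed, in accordance with the definition of iterated partial
  derivatives, in which the head of the list is applied last.\<close>

lemma integration_by_parts_iterated:
  fixes f g :: "'a::euclidean_space \<Rightarrow> real"
  assumes "Ck (length bs) f" "\<And>x. x \<notin> cball c R \<Longrightarrow> f x = 0" "smooth_fun g" "set bs \<subseteq> Basis"
  shows "(LINT x|lborel. f x * iter_partial bs g x) = (-1) ^ length bs * (LINT x|lborel. iter_partial (rev bs) f x * g x)"
  using assms(1,2,4)
proof (induction bs arbitrary: f)
  case (Cons b bs)
  have "Ck (Suc 0) (iter_partial bs g)"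
    using Ck_iter_partial[OF smooth_fun_imp_Ck[OF assms(3), of "Suc (length bs)"], of bs] Cons.prems by simp
  moreover have "Ck (Suc 0) f" using Cons.prems(1) by (rule Ck_mono) simp
  ultimately have "(LINT x|lborel. f x * pd b (iter_partial bs g) x) = - (LINT x|lborel. pd b f x * iter_partial bs g x)"
    using Cons.prems by (intro integration_by_parts[where c=c and R=R]) auto
  also have "(LINT x|lborel. pd b f x * iter_partial bs g x)
      = (-1) ^ length bs * (LINT x|lborel. iter_partial (rev bs) (pd b f) x * g x)"
    using Cons.prems pd_vanishes_outside[OF Cons.prems(2)] by (intro Cons.IH) (auto simp: Ck_Suc)
  finally show ?case by (simp add: pd_def[abs_def] iter_partial_snoc)
qed simp

section \<open>Uniqueness of weak derivatives\<close>

lemma Ck_prod: "(\<And>i. i \<in> I \<Longrightarrow> Ck n (g i)) \<Longrightarrow> Ck n (\<lambda>x. \<Prod>i\<in>I. g i x)"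
proof (induction I rule: infinite_finite_induct)
  case (insert i I)
  then show ?case by (simp add: Ck_mult)
qed (auto simp: Ck_const)

definition box_bump :: "nat \<Rightarrow> 'a::euclidean_space \<Rightarrow> 'a \<Rightarrow> 'a \<Rightarrow> real" where
  "box_bump n a b x = (\<Prod>c\<in>Basis. expflat (real (Suc n) * (x \<bullet> c - a \<bullet> c)) * expflat (real (Suc n) * (b \<bullet> c - x \<bullet> c)))"

lemma expflat_bounds: "0 \<le> expflat t" "expflat t \<le> 1"
  by (auto simp: expflat_eq)

lemma box_bump_bounds: "0 \<le> box_bump n a b x" "box_bump n a b x \<le> 1"
  unfolding box_bump_def
  by (auto intro!: prod_nonneg prod_le_1 mult_nonneg_nonneg expflat_bounds mult_le_one)

lemma box_bump_outside: "x \<notin> box a b \<Longrightarrow> box_bump n a b x = 0"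
  unfolding box_bump_def mem_box
  by (auto simp: expflat_eq zero_less_mult_iff intro!: prod_zero)

lemma test_fun_box_bump: "test_fun (box_bump n a b)"
proof -
  have "Ck m (box_bump n a b)" for m
    unfolding box_bump_def[abs_def]
    by (intro Ck_prod Ck_mult Ck_expflat Ck_cmult Ck_diff Ck_inner Ck_const)
  moreover have "{x. box_bump n a b x \<noteq> 0} \<subseteq> box a b" using box_bump_outside by blast
  ultimately show ?thesis
    unfolding test_fun_def using bounded_box bounded_subset Ck_imp_smooth_fun by blast
qed

lemma expflat_tendsto: "0 < t \<Longrightarrow> (\<lambda>n. expflat (real (Suc n) * t)) \<longlonglongrightarrow> 1"
proof -
  assume t: "0 < t"
  have "(\<lambda>n. exp (- (inverse (real (Suc n)) * inverse t))) \<longlonglongrightarrow> exp (- (0 * inverse t))"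
    by (intro tendsto_exp tendsto_minus tendsto_mult LIMSEQ_inverse_real_of_nat tendsto_const)
  then show ?thesis using t by (simp add: expflat_eq del: of_nat_Suc)
qed

lemma box_bump_tendsto: "(\<lambda>n. box_bump n a b x) \<longlonglongrightarrow> indicator (box a b) x"
proof (cases "x \<in> box a b")
  case True
  have "(\<lambda>n. box_bump n a b x) \<longlonglongrightarrow> (\<Prod>c\<in>(Basis::'a set). 1 * 1)"
    unfolding box_bump_def using True
    by (intro tendsto_prod tendsto_mult expflat_tendsto) (auto simp: mem_box)
  then show ?thesis using True by simp
qed (simp add: box_bump_outside)

text \<open>The densities of the positive and the negative part agree on all boxes, which generate the Borel sets.\<close>

lemma AE_zero_if_box_integrals_zero:
  fixes g :: "'a::euclidean_space \<Rightarrow> real"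
  assumes [measurable]: "g \<in> borel_measurable borel"
    and int: "\<And>a b. integrable lborel (\<lambda>x. indicator (box a b) x * g x)"
    and z: "\<And>a b. (LINT x|lborel. indicator (box a b) x * g x) = 0"
  shows "AE x in lborel. g x = 0"
proof -
  have e: "emeasure (density lborel (\<lambda>x. ennreal (g x))) (box a b) = ennreal (LINT x|lborel. indicator (box a b) x * max 0 (g x))"
    "emeasure (density lborel (\<lambda>x. ennreal (- g x))) (box a b) = ennreal (LINT x|lborel. indicator (box a b) x * max 0 (- g x))"
    "(LINT x|lborel. indicator (box a b) x * max 0 (g x)) = (LINT x|lborel. indicator (box a b) x * max 0 (- g x))" for a b
  proof -
    have i: "integrable lborel (\<lambda>x. indicator (box a b) x * max 0 (g x))" "integrable lborel (\<lambda>x. indicator (box a b) x * max 0 (- g x))"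
      by (rule Bochner_Integration.integrable_bound[OF int[of a b]]; auto simp: indicator_def)+
    have n: "emeasure (density lborel (\<lambda>x. ennreal (k x))) (box a b) = ennreal (LINT x|lborel. indicator (box a b) x * max 0 (k x))"
      if "integrable lborel (\<lambda>x. indicator (box a b) x * max 0 (k x))" "k \<in> borel_measurable borel" for k :: "'a \<Rightarrow> real"
    proof -
      have "emeasure (density lborel (\<lambda>x. ennreal (k x))) (box a b) = (\<integral>\<^sup>+x. ennreal (k x) * indicator (box a b) x \<partial>lborel)"
        using that(2) by (intro emeasure_density) auto
      also have "\<dots> = (\<integral>\<^sup>+x. ennreal (indicator (box a b) x * max 0 (k x)) \<partial>lborel)"
        by (intro nn_integral_cong) (auto simp: indicator_def max_def ennreal_neg)
      also have "\<dots> = ennreal (LINT x|lborel. indicator (box a b) x * max 0 (k x))"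
        using that(1) by (intro nn_integral_eq_integral) auto
      finally show ?thesis .
    qed
    show "emeasure (density lborel (\<lambda>x. ennreal (g x))) (box a b) = ennreal (LINT x|lborel. indicator (box a b) x * max 0 (g x))"
      "emeasure (density lborel (\<lambda>x. ennreal (- g x))) (box a b) = ennreal (LINT x|lborel. indicator (box a b) x * max 0 (- g x))"
      by (rule n[OF i(1)], simp, rule n[OF i(2)], simp)
    have "(LINT x|lborel. indicator (box a b) x * max 0 (g x)) - (LINT x|lborel. indicator (box a b) x * max 0 (- g x))
        = (LINT x|lborel. indicator (box a b) x * g x)"
      unfolding Bochner_Integration.integral_diff[OF i, symmetric]
      by (intro Bochner_Integration.integral_cong) (auto simp: indicator_def max_def)
    then show "(LINT x|lborel. indicator (box a b) x * max 0 (g x)) = (LINT x|lborel. indicator (box a b) x * max 0 (- g x))"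
      using z by simp
  qed
  let ?E = "range (\<lambda>(a, b). box a b :: 'a set)"
  let ?A = "\<lambda>n::nat. box (- (real n *\<^sub>R One)) (real n *\<^sub>R One) :: 'a set"
  have "density lborel (\<lambda>x. ennreal (g x)) = density lborel (\<lambda>x. ennreal (- g x))"
  proof (rule measure_eqI_generator_eq)
    show "Int_stable ?E" by (auto simp: Int_stable_def box_Int_box)
    show "?E \<subseteq> Pow UNIV" "sets (density lborel (\<lambda>x. ennreal (g x))) = sigma_sets UNIV ?E"
      "sets (density lborel (\<lambda>x. ennreal (- g x))) = sigma_sets UNIV ?E"
      by (simp_all add: borel_eq_box)
    show "range ?A \<subseteq> ?E" "(\<Union>i. ?A i) = UNIV" unfolding UN_box_eq_UNIV by auto
  qed (use e in auto)
  then have "AE x in lborel. ennreal (g x) = ennreal (- g x)"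
    by (intro sigma_finite_measure.density_unique[OF sigma_finite_lborel]) auto
  then show ?thesis
  proof eventually_elim
    case (elim x)
    then show ?case
      by (metis ennreal_eq_0_iff linorder_le_cases neg_0_le_iff_le order_antisym neg_le_0_iff_le)
  qed
qed

lemma integrable_square_integrable_mult:
  assumes "square_integrable f" "square_integrable g"
  shows "integrable lebesgue (\<lambda>x. f x * g x)"
proof (rule Bochner_Integration.integrable_bound)
  show "integrable lebesgue (\<lambda>x. (f x)\<^sup>2 + (g x)\<^sup>2)"
    using assms by (auto simp: square_integrable_def)
  show "(\<lambda>x. f x * g x) \<in> borel_measurable lebesgue"
    using assms by (auto simp: square_integrable_def)
  show "AE x in lebesgue. norm (f x * g x) \<le> norm ((f x)\<^sup>2 + (g x)\<^sup>2)"
  proof (rule AE_I2)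
    fix x
    have "2 * (\<bar>f x\<bar> * \<bar>g x\<bar>) \<le> (f x)\<^sup>2 + (g x)\<^sup>2"
      using sum_squares_bound[of "\<bar>f x\<bar>" "\<bar>g x\<bar>"] by simp
    moreover have "0 \<le> \<bar>f x\<bar> * \<bar>g x\<bar>" by simp
    ultimately show "norm (f x * g x) \<le> norm ((f x)\<^sup>2 + (g x)\<^sup>2)"
      unfolding real_norm_def abs_mult by linarith
  qed
qed

lemma square_integrable_diff:
  assumes "square_integrable f" "square_integrable g"
  shows "square_integrable (\<lambda>x. f x - g x)"
proof -
  have "integrable lebesgue (\<lambda>x. (f x)\<^sup>2 - 2 * (f x * g x) + (g x)\<^sup>2)"
    using assms integrable_square_integrable_mult[OF assms]
    by (intro Bochner_Integration.integrable_add Bochner_Integration.integrable_diff integrable_mult_right)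
      (auto simp: square_integrable_def)
  moreover have "(\<lambda>x. (f x)\<^sup>2 - 2 * (f x * g x) + (g x)\<^sup>2) = (\<lambda>x. (f x - g x)\<^sup>2)"
    by (auto simp: power2_diff)
  ultimately show ?thesis using assms by (auto simp: square_integrable_def)
qed

lemma square_integrable_bounded_support:
  fixes h :: "'a::euclidean_space \<Rightarrow> real"
  assumes [measurable]: "h \<in> borel_measurable borel" and "A \<in> sets borel" "bounded A" "\<And>x. \<bar>h x\<bar> \<le> B * indicator A x"
  shows "square_integrable h" "(LINT x|lebesgue. (h x)\<^sup>2) \<le> B\<^sup>2 * measure lborel A"
proof -
  have sq: "(h x)\<^sup>2 \<le> B\<^sup>2 * indicator A x" for x
    using assms(4)[of x] power_mono[of "\<bar>h x\<bar>" B 2] by (cases "x \<in> A") auto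
  have iA: "integrable lborel (\<lambda>x. B\<^sup>2 * indicator A x :: real)"
    using assms(2) emeasure_bounded_finite[OF assms(3)]
    by (intro integrable_mult_right integrable_real_indicator) auto
  have i: "integrable lborel (\<lambda>x. (h x)\<^sup>2)"
    by (rule Bochner_Integration.integrable_bound[OF iA]) (use sq in auto)
  then show "square_integrable h"
    unfolding square_integrable_def by (simp add: integrable_completion measurable_completion)
  have "(LINT x|lebesgue. (h x)\<^sup>2) = (LINT x|lborel. (h x)\<^sup>2)" by (simp add: integral_completion)
  also have "\<dots> \<le> (LINT x|lborel. B\<^sup>2 * indicator A x)" by (intro integral_mono i iA sq)
  finally show "(LINT x|lebesgue. (h x)\<^sup>2) \<le> B\<^sup>2 * measure lborel A" using assms(2) by simp
qed

text \<open>Test functions approximate the indicator of every box, so a function orthogonal to all of them has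
  vanishing integral over every box.\<close>

lemma AE_zero_if_orthogonal_to_test_funs:
  fixes g :: "'a::euclidean_space \<Rightarrow> real"
  assumes g: "square_integrable g" and z: "\<And>\<psi>. test_fun \<psi> \<Longrightarrow> (LINT x|lebesgue. g x * \<psi> x) = 0"
  shows "AE x in lebesgue. g x = 0"
proof -
  obtain g' where g'[measurable]: "g' \<in> borel_measurable borel" and ae: "AE x in lborel. g x = g' x"
    using completion_ex_borel_measurable_real[of g lborel] g by (auto simp: square_integrable_def)
  have ae': "AE x in lebesgue. g x = g' x" using ae by (rule AE_completion)
  have "integrable lebesgue (\<lambda>x. (g x)\<^sup>2)" using g by (simp add: square_integrable_def)
  then have "integrable lebesgue (\<lambda>x. (g' x)\<^sup>2)"
    by (rule integrable_cong_AE_imp)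
      (use ae' in \<open>auto simp: measurable_completion elim!: eventually_mono\<close>)
  then have sq: "integrable lborel (\<lambda>x. (g' x)\<^sup>2)" by (simp add: integrable_completion)
  have int: "integrable lborel (\<lambda>x. indicator (box a b) x * g' x)" for a b
  proof (rule Bochner_Integration.integrable_bound)
    show "integrable lborel (\<lambda>x. indicator (box a b) x + (g' x)\<^sup>2)"
      using emeasure_bounded_finite[OF bounded_box[of a b]]
      by (intro Bochner_Integration.integrable_add sq integrable_real_indicator) auto
    have "\<bar>t\<bar> \<le> 1 + t\<^sup>2" for t :: real
      using sum_squares_bound[of "\<bar>t\<bar>" 1] by simp
    then show "AE x in lborel. norm (indicator (box a b) x * g' x) \<le> norm (indicator (box a b) x + (g' x)\<^sup>2)"
      by (intro AE_I2) (auto simp: indicator_def)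
  qed simp
  have "(LINT x|lborel. indicator (box a b) x * g' x) = 0" for a b
  proof -
    have bm[measurable]: "box_bump n a b \<in> borel_measurable borel" for n
      using test_fun_box_bump[of n a b] Ck_continuous[OF smooth_fun_imp_Ck]
      by (auto simp: test_fun_def intro: borel_measurable_continuous_onI)
    have "(LINT x|lborel. box_bump n a b x * g' x) = 0" for n
    proof -
      have [measurable]: "box_bump n a b \<in> borel_measurable lebesgue" "g \<in> borel_measurable lebesgue"
          "g' \<in> borel_measurable lebesgue"
        using bm[of n] g g' by (auto simp: square_integrable_def measurable_completion)
      have "(LINT x|lborel. box_bump n a b x * g' x) = (LINT x|lebesgue. box_bump n a b x * g' x)"
        by (simp add: integral_completion)
      also have "\<dots> = (LINT x|lebesgue. g x * box_bump n a b x)"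
        by (rule integral_cong_AE; (measurable)?) (use ae' in \<open>auto elim!: eventually_mono\<close>)
      finally show ?thesis using z[OF test_fun_box_bump] by simp
    qed
    moreover have "(\<lambda>n. LINT x|lborel. box_bump n a b x * g' x) \<longlonglongrightarrow> (LINT x|lborel. indicator (box a b) x * g' x)"
    proof (rule integral_dominated_convergence[where w="\<lambda>x. \<bar>indicator (box a b) x * g' x\<bar>"])
      show "integrable lborel (\<lambda>x. \<bar>indicator (box a b) x * g' x\<bar>)" using int by (rule integrable_abs)
      show "AE x in lborel. (\<lambda>n. box_bump n a b x * g' x) \<longlonglongrightarrow> indicator (box a b) x * g' x"
        by (intro AE_I2 tendsto_mult box_bump_tendsto tendsto_const)
      show "AE x in lborel. norm (box_bump n a b x * g' x) \<le> \<bar>indicator (box a b) x * g' x\<bar>" for n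
      proof (rule AE_I2)
        fix x
        have "\<bar>box_bump n a b x\<bar> \<le> \<bar>indicator (box a b) x\<bar>"
          using box_bump_bounds[of n a b x] box_bump_outside[of x a b n] by (auto simp: indicator_def)
        then show "norm (box_bump n a b x * g' x) \<le> \<bar>indicator (box a b) x * g' x\<bar>"
          unfolding real_norm_def abs_mult by (rule mult_right_mono) simp
      qed
    qed auto
    ultimately show ?thesis using LIMSEQ_unique by (simp add: tendsto_const_iff)
  qed
  then have "AE x in lborel. g' x = 0" by (intro AE_zero_if_box_integrals_zero int g')
  then have "AE x in lebesgue. g' x = 0" by (rule AE_completion)
  with ae' show ?thesis by eventually_elim simp
qed

lemma exists_list_of_multiplicities:
  assumes "finite A" "\<And>b. b \<notin> A \<Longrightarrow> k b = 0"
  shows "\<exists>bs. \<forall>b. count_list bs b = k b"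
proof -
  have r: "count_list (replicate n a) b = (if a = b then n else 0)" for n and a b :: 'a
    by (induction n) auto
  have "\<exists>bs. \<forall>b. count_list bs b = (if b \<in> A then k b else 0)"
    using assms(1)
  proof induction
    case (insert a A)
    then obtain bs where "\<forall>b. count_list bs b = (if b \<in> A then k b else 0)" by blast
    then show ?case using insert.hyps
      by (intro exI[of _ "bs @ replicate (k a) a"]) (auto simp: r)
  qed (auto intro: exI[of _ "[]"])
  then show ?thesis using assms(2) by (metis (full_types))
qed

lemma multi_index_list:
  fixes k :: "'a::euclidean_space \<Rightarrow> nat"
  assumes "k \<in> multi_indices s"
  defines "bs \<equiv> SOME bs. \<forall>b. count_list bs b = k b"
  shows "set bs \<subseteq> Basis" "length bs = (\<Sum>b\<in>Basis. k b)" "length bs \<le> s"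
proof -
  have k: "\<And>b. b \<notin> Basis \<Longrightarrow> k b = 0" "(\<Sum>b\<in>Basis. k b) \<le> s"
    using assms(1) by (auto simp: multi_indices_def)
  have c: "\<forall>b. count_list bs b = k b"
    unfolding bs_def using exists_list_of_multiplicities[OF finite_Basis k(1)] by (rule someI_ex)
  show "set bs \<subseteq> Basis" using c k(1) by (metis count_list_0_iff subsetI)
  then have "sum (count_list bs) Basis = length bs" by (rule sum_count_set) simp
  then show "length bs = (\<Sum>b\<in>Basis. k b)" using c by simp
  then show "length bs \<le> s" using k(2) by simp
qed

text \<open>The norm is defined through an arbitrary choice of weak derivatives. The classical derivatives are weak
  derivatives by partial integration, and by uniqueness the chosen ones agree with them almost everywhere.\<close>

lemma sobolev_norm_Ck_compact_support:
  fixes U :: "'a::euclidean_space \<Rightarrow> real"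
  assumes U: "Ck s U" "\<And>x. x \<notin> cball c R \<Longrightarrow> U x = 0" "\<And>x. jet_le s 1 A U x" and R: "0 \<le> R"
  shows "U \<in> sobolev_space s"
    "sobolev_norm s U \<le> sqrt (real (card (multi_indices s :: ('a \<Rightarrow> nat) set)) * measure lborel (cball (0::'a) R)) * A"
proof -
  have A: "0 \<le> A" using jet_le_nonneg[OF U(3)] .
  define l where "l k = (SOME bs. \<forall>b. count_list bs b = k b)" for k :: "'a \<Rightarrow> nat"
  define V where "V k = iter_partial (rev (l k)) U" for k
  have van: "iter_partial bs U x = 0" if "x \<notin> cball c R" for x and bs :: "'a list"
    using that
  proof (induction bs arbitrary: x)
    case (Cons b bs)
    from pd_vanishes_outside[OF Cons.IH Cons.prems] show ?case by (simp add: pd_def)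
  qed (use U(2) in simp)
  have V: "square_integrable (V k)" "(LINT x|lebesgue. (V k x)\<^sup>2) \<le> A\<^sup>2 * measure lborel (cball (0::'a) R)"
    "is_weak_deriv k U (V k)" if k: "k \<in> multi_indices s" for k
  proof -
    have l: "set (l k) \<subseteq> Basis" "length (l k) = (\<Sum>b\<in>Basis. k b)" "length (l k) \<le> s"
      using multi_index_list[OF k] by (simp_all add: l_def)
    have cV: "continuous_on UNIV (V k)"
      using Ck_iter_partial[OF U(1), of "rev (l k)"] l Ck_continuous unfolding V_def by auto
    have mV[measurable]: "V k \<in> borel_measurable borel" using cV by (rule borel_measurable_continuous_onI)
    have bV: "\<bar>V k x\<bar> \<le> A * indicator (cball c R) x" for x
      using U(3)[of x] l van[of x "rev (l k)"] A
      unfolding jet_le_iff_iter_partial V_def by (cases "x \<in> cball c R") auto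
    have vol: "measure lborel (cball c R) = measure lborel (cball (0::'a) R)"
      using R by (simp add: content_cball)
    show "square_integrable (V k)" "(LINT x|lebesgue. (V k x)\<^sup>2) \<le> A\<^sup>2 * measure lborel (cball (0::'a) R)"
      using square_integrable_bounded_support[OF mV _ _ bV] vol by auto
    show "is_weak_deriv k U (V k)"
      unfolding is_weak_deriv_def
    proof (intro allI impI)
      fix \<psi> :: "'a \<Rightarrow> real" assume \<psi>: "test_fun \<psi>"
      then have s: "smooth_fun \<psi>" by (simp add: test_fun_def)
      have c: "continuous_on UNIV U" "continuous_on UNIV \<psi>" "continuous_on UNIV (iter_partial (l k) \<psi>)"
        using Ck_continuous[OF U(1)] Ck_continuous[OF smooth_fun_imp_Ck[OF s]]
          Ck_continuous[OF Ck_iter_partial[OF smooth_fun_imp_Ck[OF s] l(1) order_refl]] by auto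
      have m: "U \<in> borel_measurable borel" "\<psi> \<in> borel_measurable borel" "iter_partial (l k) \<psi> \<in> borel_measurable borel"
        using c by (auto intro: borel_measurable_continuous_onI)
      have "(LINT x|lborel. U x * iter_partial (l k) \<psi> x) = (-1) ^ length (l k) * (LINT x|lborel. V k x * \<psi> x)"
        unfolding V_def using Ck_mono[OF U(1) l(3)] U(2) s l(1) by (rule integration_by_parts_iterated)
      then show "(LINT x|lebesgue. U x * multi_deriv k \<psi> x)
          = (-1) ^ (\<Sum>b\<in>Basis. k b) * (LINT x|lebesgue. V k x * \<psi> x)"
        using m mV by (simp add: multi_deriv_def l_def[symmetric] l(2) integral_completion)
    qed
  qed
  have "\<bar>U x\<bar> \<le> A * indicator (cball c R) x" for x
    using U(2) jet_le_abs[OF U(3)] A by (cases "x \<in> cball c R") auto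
  from square_integrable_bounded_support(1)[OF _ _ _ this]
  have "square_integrable U"
    using Ck_continuous[OF U(1)] by (auto intro: borel_measurable_continuous_onI)
  then show "U \<in> sobolev_space s" unfolding sobolev_space_def using V by auto
  have "(LINT x|lebesgue. weak_deriv k U x * weak_deriv k U x) \<le> A\<^sup>2 * measure lborel (cball (0::'a) R)"
    if k: "k \<in> multi_indices s" for k
  proof -
    have w: "square_integrable (weak_deriv k U)" "is_weak_deriv k U (weak_deriv k U)"
      using someI[of "\<lambda>g. square_integrable g \<and> is_weak_deriv k U g", OF conjI[OF V(1,3)[OF k]]]
      by (auto simp: weak_deriv_def)
    have "AE x in lebesgue. weak_deriv k U x - V k x = 0"
    proof (rule AE_zero_if_orthogonal_to_test_funs)
      show "square_integrable (\<lambda>x. weak_deriv k U x - V k x)" using w V[OF k] by (intro square_integrable_diff)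
      fix \<psi> :: "'a \<Rightarrow> real" assume \<psi>: "test_fun \<psi>"
      then obtain r where r: "{x. \<psi> x \<noteq> 0} \<subseteq> cball 0 r" by (force simp: test_fun_def bounded_iff)
      have c: "continuous_on UNIV \<psi>"
        using \<psi> Ck_continuous[OF smooth_fun_imp_Ck] by (auto simp: test_fun_def)
      have "compact (\<psi> ` cball 0 r)"
        by (intro compact_continuous_image continuous_on_subset[OF c]) auto
      then obtain B where B: "\<And>x. x \<in> cball 0 r \<Longrightarrow> \<bar>\<psi> x\<bar> \<le> B"
        using compact_imp_bounded by (fastforce simp: bounded_iff)
      have "\<bar>\<psi> x\<bar> \<le> B * indicator (cball 0 r) x" for x
        using B[of x] r by (cases "x \<in> cball 0 r") auto
      from square_integrable_bounded_support(1)[OF _ _ _ this]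
      have s\<psi>: "square_integrable \<psi>" using c by (auto intro: borel_measurable_continuous_onI)
      have "(LINT x|lebesgue. weak_deriv k U x * \<psi> x) = (LINT x|lebesgue. V k x * \<psi> x)"
        using w(2) V(3)[OF k] \<psi> unfolding is_weak_deriv_def by (simp add: mult_cancel_left)
      then show "(LINT x|lebesgue. (weak_deriv k U x - V k x) * \<psi> x) = 0"
        unfolding left_diff_distrib
        using integrable_square_integrable_mult[OF w(1) s\<psi>] integrable_square_integrable_mult[OF V(1)[OF k] s\<psi>]
        by simp
    qed
    then have "(LINT x|lebesgue. weak_deriv k U x * weak_deriv k U x) = (LINT x|lebesgue. (V k x)\<^sup>2)"
      by (intro integral_cong_AE)
        (use w(1) V(1)[OF k] in \<open>auto simp: square_integrable_def power2_eq_square elim!: eventually_mono\<close>)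
    then show ?thesis using V(2)[OF k] by simp
  qed
  then have "sobolev_inner s U U \<le> real (card (multi_indices s :: ('a \<Rightarrow> nat) set)) * (A\<^sup>2 * measure lborel (cball (0::'a) R))"
    unfolding sobolev_inner_def by (rule sum_bounded_above)
  then have "sobolev_norm s U \<le> sqrt (real (card (multi_indices s :: ('a \<Rightarrow> nat) set)) * (A\<^sup>2 * measure lborel (cball (0::'a) R)))"
    unfolding sobolev_norm_def by (rule real_sqrt_le_mono)
  also have "\<dots> = sqrt (real (card (multi_indices s :: ('a \<Rightarrow> nat) set)) * measure lborel (cball (0::'a) R)) * A"
    using A by (simp add: real_sqrt_mult ac_simps)
  finally show "sobolev_norm s U \<le> sqrt (real (card (multi_indices s :: ('a \<Rightarrow> nat) set)) * measure lborel (cball (0::'a) R)) * A" .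
qed

section \<open>Derivatives of Sinkhorn potentials\<close>

locale compact_prob_space = compact_finite_measure \<mu> S + prob_space \<mu>
  for \<mu> :: "'b::euclidean_space measure" and S
begin

lemma nonempty: "S \<noteq> {}"
  using not_empty space_eq by simp

lemma integral_greater:
  fixes h :: "'b \<Rightarrow> real"
  assumes "continuous_on S h" "\<And>y. y \<in> S \<Longrightarrow> a < h y"
  shows "a < (LINT y|\<mu>. h y)"
proof -
  obtain y where y: "y \<in> S" "\<And>z. z \<in> S \<Longrightarrow> h y \<le> h z"
    using continuous_attains_inf[OF compact_S nonempty assms(1)] by blast
  have "(LINT z|\<mu>. h y) \<le> (LINT z|\<mu>. h z)"
    using y by (intro integral_mono integrable_continuous assms(1)) (auto simp: space_eq)
  then show ?thesis using assms(2)[OF y(1)] prob_space by simp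
qed

lemma integral_less:
  fixes h :: "'b \<Rightarrow> real"
  assumes "continuous_on S h" "\<And>y. y \<in> S \<Longrightarrow> h y < a"
  shows "(LINT y|\<mu>. h y) < a"
  using integral_greater[of "\<lambda>y. - h y" "- a"] assms by (simp add: continuous_on_minus)

end

lemma compact_prob_spaceI:
  assumes "prob_measure_on Y \<beta>" "compact Y"
  shows "compact_prob_space \<beta> Y"
proof -
  interpret prob_space \<beta> using assms(1) by (simp add: prob_measure_on_def)
  show ?thesis
    using assms by (intro_locales) (auto simp: compact_finite_measure_axioms_def prob_measure_on_def)
qed

text \<open>The right-hand side of the optimality condition, and the function that it determines. Both are defined on
  the whole space, and the potential is smooth there even if \<open>X\<close> is a finite set.\<close>

definition partition_fun ::
    "('a::euclidean_space \<Rightarrow> 'b \<Rightarrow> real) \<Rightarrow> real \<Rightarrow> 'b measure \<Rightarrow> ('b \<Rightarrow> real) \<Rightarrow> 'a \<Rightarrow> real" where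
  "partition_fun e \<epsilon> \<beta> v x = (LINT y|\<beta>. exp ((v y - e x y) / \<epsilon>))"

definition potential ::
    "('a::euclidean_space \<Rightarrow> 'b \<Rightarrow> real) \<Rightarrow> real \<Rightarrow> 'b measure \<Rightarrow> ('b \<Rightarrow> real) \<Rightarrow> 'a \<Rightarrow> real" where
  "potential e \<epsilon> \<beta> v x = - \<epsilon> * ln (partition_fun e \<epsilon> \<beta> v x)"

definition gibbs_const :: "nat \<Rightarrow> real \<Rightarrow> real" where
  "gibbs_const m M = 2 ^ m * (2 ^ m * M * compose_const m M) * inverse_const m (compose_const m M)"

context compact_prob_space
begin

context
  fixes e :: "'a::euclidean_space \<Rightarrow> 'b \<Rightarrow> real" and \<epsilon> :: real and v :: "'b \<Rightarrow> real"
  assumes e: "\<And>n. Ck_family n S e" and v: "continuous_on S v" and \<epsilon>: "0 < \<epsilon>"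
begin

lemma Ck_family_exponent: "Ck_family n S (\<lambda>x y. (v y - e x y) / \<epsilon>)"
  unfolding divide_inverse mult.commute[of _ "inverse \<epsilon>"]
  by (intro Ck_family_cmult Ck_family_diff Ck_family_parameter v e)

lemma Ck_family_gibbs: "Ck_family n S (\<lambda>x y. exp ((v y - e x y) / \<epsilon>))"
  by (rule Ck_family_compose[where H="\<lambda>_. exp" and j=0, OF DERIV_exp Ck_family_exponent])

lemma partition_fun_pos: "0 < partition_fun e \<epsilon> \<mu> v x"
  unfolding partition_fun_def
  by (rule integral_greater[OF continuous_slice[OF Ck_family_continuous[OF Ck_family_gibbs[of 0]]]]) simp

lemma Ck_partition_fun: "Ck n (partition_fun e \<epsilon> \<mu> v)"
  unfolding partition_fun_def[abs_def] by (rule Ck_integral[OF Ck_family_gibbs])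

lemma pd_gibbs:
  assumes "y \<in> S"
  shows "pd b (\<lambda>x. exp ((v y - e x y) / \<epsilon>)) x = - inverse \<epsilon> * (pd b (\<lambda>x. e x y) x * exp ((v y - e x y) / \<epsilon>))"
    and "pd b (\<lambda>x. (v y - e x y) / \<epsilon>) x = - inverse \<epsilon> * pd b (\<lambda>x. e x y) x"
proof -
  have d: "(\<lambda>x. e x y) differentiable at x" for x
    using Ck_family_differentiable[OF e[of "Suc 0"] assms] .
  have d': "(\<lambda>x. (v y - e x y) / \<epsilon>) differentiable at x" for x
    using Ck_family_differentiable[OF Ck_family_exponent[of "Suc 0"] assms] .
  have "pd b (\<lambda>x. inverse \<epsilon> * (v y - e x y)) x = - inverse \<epsilon> * pd b (\<lambda>x. e x y) x"
    using d by (subst pd_mult) (auto simp: pd_diff)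
  then show p: "pd b (\<lambda>x. (v y - e x y) / \<epsilon>) x = - inverse \<epsilon> * pd b (\<lambda>x. e x y) x"
    by (simp add: divide_inverse mult.commute)
  show "pd b (\<lambda>x. exp ((v y - e x y) / \<epsilon>)) x = - inverse \<epsilon> * (pd b (\<lambda>x. e x y) x * exp ((v y - e x y) / \<epsilon>))"
    using pd_compose(1)[where H=exp and g="\<lambda>x. (v y - e x y) / \<epsilon>", OF DERIV_exp d'] p by simp
qed

text \<open>The factor \<open>\<epsilon>\<close> in front of the logarithm cancels against the one in the exponent,
  which leaves an average of the derivative of the cost under a probability measure, with no power of
  \<open>1 / \<epsilon>\<close>. This is why the bounds for the derivatives of order \<open>k\<close>
  involve \<open>1 / \<epsilon>\<close> only to the power \<open>k - 1\<close>.\<close>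

lemma pd_potential:
  assumes b: "b \<in> Basis"
  shows "pd b (potential e \<epsilon> \<mu> v) = (\<lambda>x. (LINT y|\<mu>. pd b (\<lambda>x. e x y) x * exp ((v y - e x y) / \<epsilon>))
     * inverse (partition_fun e \<epsilon> \<mu> v x))"
    and "potential e \<epsilon> \<mu> v differentiable at x"
proof -
  let ?Z = "partition_fun e \<epsilon> \<mu> v"
  have Zd: "?Z differentiable at x" for x using Ck_differentiable[OF Ck_partition_fun] .
  have ln: "((\<lambda>t. - \<epsilon> * ln t) has_real_derivative - \<epsilon> * inverse (?Z x)) (at (?Z x))" for x
    using partition_fun_pos[of x] by (auto intro!: derivative_eq_intros simp: divide_inverse)
  show "potential e \<epsilon> \<mu> v differentiable at x"
    unfolding potential_def[abs_def]
    using pd_compose(2)[where H="\<lambda>t. - \<epsilon> * ln t" and g="?Z", OF ln Zd] .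
  show "pd b (potential e \<epsilon> \<mu> v) = (\<lambda>x. (LINT y|\<mu>. pd b (\<lambda>x. e x y) x * exp ((v y - e x y) / \<epsilon>)) * inverse (?Z x))"
  proof
    fix x
    have "pd b (potential e \<epsilon> \<mu> v) x = - \<epsilon> * inverse (?Z x) * pd b ?Z x"
      unfolding potential_def[abs_def]
      using pd_compose(1)[where H="\<lambda>t. - \<epsilon> * ln t" and g="?Z", OF ln Zd] .
    also have "pd b ?Z x = (LINT y|\<mu>. pd b (\<lambda>x. exp ((v y - e x y) / \<epsilon>)) x)"
      unfolding partition_fun_def[abs_def] by (rule pd_integral_family[OF Ck_family_gibbs b, THEN fun_cong])
    also have "\<dots> = (LINT y|\<mu>. - inverse \<epsilon> * (pd b (\<lambda>x. e x y) x * exp ((v y - e x y) / \<epsilon>)))"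
      by (intro Bochner_Integration.integral_cong refl pd_gibbs) (simp add: space_eq)
    finally show "pd b (potential e \<epsilon> \<mu> v) x
        = (LINT y|\<mu>. pd b (\<lambda>x. e x y) x * exp ((v y - e x y) / \<epsilon>)) * inverse (?Z x)"
      using \<epsilon> by simp
  qed
qed

lemma Ck_potential: "Ck n (potential e \<epsilon> \<mu> v)"
proof (rule Ck_mono)
  show "Ck (Suc n) (potential e \<epsilon> \<mu> v)"
  proof (rule Ck_SucI)
    show "Ck n (pd b (potential e \<epsilon> \<mu> v))" if "b \<in> Basis" for b
      unfolding pd_potential(1)[OF that]
      by (intro Ck_mult Ck_inverse Ck_partition_fun partition_fun_pos Ck_integral Ck_family_mult Ck_family_gibbs
          Ck_family_pd[OF e that])
  qed (use pd_potential(2) nonempty_Basis in blast)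
qed simp

text \<open>On the length scale \<open>min 1 \<epsilon>\<close> the Gibbs density is multiplied by at most a bounded
  factor, so all its derivatives are bounded, on that scale, by a multiple of the density itself; the same
  then holds for the numerator and the denominator of the derivative of the potential.\<close>

lemma jet_le_pd_potential:
  assumes M: "0 \<le> M" and je: "\<And>y. y \<in> S \<Longrightarrow> jet_le (Suc m) 1 M (\<lambda>x. e x y) x" and b: "b \<in> Basis"
  shows "jet_le m (min 1 \<epsilon>) (gibbs_const m M) (pd b (potential e \<epsilon> \<mu> v)) x"
proof -
  let ?C1 = "compose_const m M"
  define \<rho> where "\<rho> = min 1 \<epsilon>"
  have \<rho>: "0 < \<rho>" "\<rho> \<le> 1" "\<rho> \<le> \<epsilon>" using \<epsilon> by (auto simp: \<rho>_def)
  let ?Z = "partition_fun e \<epsilon> \<mu> v"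
  let ?E = "\<lambda>x y. exp ((v y - e x y) / \<epsilon>)"
  have jpe: "jet_le m \<rho> M (pd a (\<lambda>x. e x y)) x" if "y \<in> S" "a \<in> Basis" for y a
    using jet_le_pd[OF je[OF that(1)] that(2)] \<rho> by (auto intro: jet_le_mono_scale[of m 1])
  have cpe: "Ck n (pd a (\<lambda>x. e x y))" if "y \<in> S" "a \<in> Basis" for n y a
    using Ck_family_section[OF Ck_family_pd[OF e that(2)] that(1)] by simp
  have jE: "jet_le m \<rho> (?C1 * ?E x y) (\<lambda>x. ?E x y) x" if y: "y \<in> S" for y
  proof (rule jet_le_compose[where H="\<lambda>_. exp", OF DERIV_exp \<rho>(1)])
    show "Ck m (\<lambda>x. (v y - e x y) / \<epsilon>)"
      using Ck_family_section[OF Ck_family_exponent y] .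
    fix m' a assume m: "m = Suc m'" and a: "a \<in> (Basis :: 'a set)"
    have "pd a (\<lambda>x. (v y - e x y) / \<epsilon>) = (\<lambda>x. - inverse \<epsilon> * pd a (\<lambda>x. e x y) x)"
      using pd_gibbs(2)[OF y] by auto
    moreover have "jet_le m' \<rho> (\<bar>- inverse \<epsilon>\<bar> * M) (\<lambda>x. - inverse \<epsilon> * pd a (\<lambda>x. e x y) x) x"
      using jet_le_mono_order[OF jpe[OF y a], of m'] m \<rho>(1) by (intro jet_le_cmult cpe y a) auto
    moreover have "\<bar>- inverse \<epsilon>\<bar> * M \<le> M / \<rho>"
      using mult_left_mono[OF le_imp_inverse_le[OF \<rho>(3,1)] M] \<epsilon> by (simp add: divide_inverse mult.commute)
    ultimately show "jet_le m' \<rho> (M / \<rho>) (pd a (\<lambda>x. (v y - e x y) / \<epsilon>)) x"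
      using jet_le_mono \<rho>(1) by simp
  qed simp
  have iE: "integrable \<mu> (?E x)" by (rule family_integrable[OF Ck_family_gibbs[of 0]])
  have "jet_le m \<rho> (LINT y|\<mu>. 2 ^ m * M * ?C1 * ?E x y) (\<lambda>x. LINT y|\<mu>. pd b (\<lambda>x. e x y) x * ?E x y) x"
  proof (rule jet_le_integral)
    show "Ck_family m S (\<lambda>x y. pd b (\<lambda>x. e x y) x * ?E x y)"
      by (intro Ck_family_mult Ck_family_gibbs Ck_family_pd[OF e b])
    fix y assume y: "y \<in> S"
    have "jet_le m \<rho> (2 ^ m * M * (?C1 * ?E x y)) (\<lambda>x. pd b (\<lambda>x. e x y) x * ?E x y) x"
      by (intro jet_le_mult jpe jE cpe y b \<rho> Ck_family_section[OF Ck_family_gibbs y])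
    then show "jet_le m \<rho> (2 ^ m * M * ?C1 * ?E x y) (\<lambda>x. pd b (\<lambda>x. e x y) x * ?E x y) x"
      by (simp add: mult.assoc)
  qed (use iE in simp)
  then have num: "jet_le m \<rho> (2 ^ m * M * ?C1 * ?Z x) (\<lambda>x. LINT y|\<mu>. pd b (\<lambda>x. e x y) x * ?E x y) x"
    by (simp add: partition_fun_def)
  have "jet_le m \<rho> (LINT y|\<mu>. ?C1 * ?E x y) (\<lambda>x. LINT y|\<mu>. ?E x y) x"
    by (rule jet_le_integral[OF Ck_family_gibbs _ jE]) (use iE in simp)
  then have "jet_le m \<rho> (?C1 * ?Z x) ?Z x" by (simp add: partition_fun_def[abs_def])
  then have "jet_le m \<rho> (inverse_const m ?C1 / ?Z x) (\<lambda>z. inverse (?Z z)) x"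
    by (rule jet_le_inverse[OF \<rho>(1) Ck_partition_fun partition_fun_pos])
  then have "jet_le m \<rho> (2 ^ m * (2 ^ m * M * ?C1 * ?Z x) * (inverse_const m ?C1 / ?Z x)) (pd b (potential e \<epsilon> \<mu> v)) x"
    unfolding pd_potential(1)[OF b] using num
    by (intro jet_le_mult \<rho> Ck_inverse Ck_partition_fun partition_fun_pos Ck_integral
        Ck_family_mult Ck_family_gibbs Ck_family_pd[OF e b])
  moreover have "2 ^ m * (2 ^ m * M * ?C1 * ?Z x) * (inverse_const m ?C1 / ?Z x) = gibbs_const m M"
    using partition_fun_pos[of x] by (simp add: gibbs_const_def)
  ultimately show ?thesis by (simp add: \<rho>_def)
qed

end

end

text \<open>The gradient bound controls the oscillation of the potential over the convex hull of \<open>X\<close>.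
  Hence two points of \<open>X\<close> at which \<open>u\<close> is at most \<open>M\<close> and at least
  \<open>- M\<close> bound it everywhere, and both potentials of a normalized pair have such points.\<close>

lemma potential_extension:
  assumes D: "0 \<le> D" and M: "0 \<le> M"
  shows "\<exists>C\<ge>0. \<forall>(X :: 'a::euclidean_space set) (Y :: 'b::euclidean_space set) e \<beta> v \<epsilon> u.
    compact X \<longrightarrow> compact Y \<longrightarrow> (\<forall>x\<in>X. \<forall>y\<in>X. dist x y \<le> D) \<longrightarrow> prob_measure_on Y \<beta> \<longrightarrow>
    continuous_on Y v \<longrightarrow> (\<forall>n. Ck_family n Y e) \<longrightarrow>
    (\<forall>x\<in>convex hull X. \<forall>y\<in>Y. jet_le (Suc m) 1 M (\<lambda>x. e x y) x) \<longrightarrow> 0 < \<epsilon> \<longrightarrow>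
    (\<forall>x\<in>X. exp (- u x / \<epsilon>) = (LINT y|\<beta>. exp ((v y - e x y) / \<epsilon>))) \<longrightarrow>
    (\<exists>x\<in>X. u x \<le> M) \<longrightarrow> (\<exists>x\<in>X. - M \<le> u x) \<longrightarrow>
    (\<exists>U. sobolev_extension (Suc m) X u U \<and> sobolev_norm (Suc m) U \<le> C * (1 + (1 / \<epsilon>) ^ m))"
proof -
  let ?d = "real DIM('a)"
  define C1 where "C1 = gibbs_const m M"
  have C1: "0 \<le> C1"
    using M compose_const_ge_1[of m M] inverse_const_ge_1[of m "compose_const m M"] by (simp add: C1_def gibbs_const_def)
  obtain C2 R where C2: "0 \<le> C2" "0 < R"
    and ext: "\<forall>(X :: 'a set) f B. compact X \<longrightarrow> X \<noteq> {} \<longrightarrow> (\<forall>x\<in>X. \<forall>y\<in>X. dist x y \<le> D) \<longrightarrow>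
       smooth_fun f \<longrightarrow> (\<forall>x\<in>convex hull X. jet_le (Suc m) 1 B f x) \<longrightarrow>
       (\<exists>F x0. Ck (Suc m) F \<and> (\<forall>x\<in>X. F x = f x) \<and> (\<forall>x. x \<notin> cball x0 R \<longrightarrow> F x = 0) \<and>
         (\<forall>x. jet_le (Suc m) 1 (C2 * (B + 1)) F x))"
    using whitney_extension[OF D, where s="Suc m" and 'a='a] by (elim exE conjE) (rule that)
  define Q where "Q = sqrt (real (card (multi_indices (Suc m) :: ('a \<Rightarrow> nat) set)) * measure lborel (cball (0::'a) R))"
  define C where "C = Q * (C2 * (M + ?d * C1 * D + C1 + 1))"
  have Q: "0 \<le> Q" by (simp add: Q_def)
  have main: "\<exists>U. sobolev_extension (Suc m) X u U \<and> sobolev_norm (Suc m) U \<le> C * (1 + (1 / \<epsilon>) ^ m)"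
    if X: "compact X" and Y: "compact Y" and XD: "\<And>x y. x\<in>X \<Longrightarrow> y\<in>X \<Longrightarrow> dist x y \<le> D"
      and \<beta>: "prob_measure_on Y \<beta>" and v: "continuous_on Y v" and e: "\<And>n. Ck_family n Y e"
      and je: "\<And>x y. x\<in>convex hull X \<Longrightarrow> y\<in>Y \<Longrightarrow> jet_le (Suc m) 1 M (\<lambda>x. e x y) x" and \<epsilon>: "0 < \<epsilon>"
      and u: "\<And>x. x\<in>X \<Longrightarrow> exp (- u x / \<epsilon>) = (LINT y|\<beta>. exp ((v y - e x y) / \<epsilon>))"
      and x1: "x1 \<in> X" "u x1 \<le> M" and x2: "x2 \<in> X" "- M \<le> u x2"
    for X :: "'a set" and Y :: "'b set" and e \<beta> v \<epsilon> u x1 x2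
  proof -
    interpret compact_prob_space \<beta> Y using \<beta> Y by (rule compact_prob_spaceI)
    define f where "f = potential e \<epsilon> \<beta> v"
    define t where "t = (1 / \<epsilon>) ^ m"
    have t: "0 \<le> t" using \<epsilon> by (simp add: t_def)
    have cf: "Ck n f" for n unfolding f_def by (rule Ck_potential[OF e v \<epsilon>])
    then have sf: "smooth_fun f" by (rule Ck_imp_smooth_fun)
    have fu: "f x = u x" if "x \<in> X" for x
    proof -
      have "ln (partition_fun e \<epsilon> \<beta> v x) = - u x / \<epsilon>" using u[OF that, symmetric] by (simp add: partition_fun_def)
      then show ?thesis using \<epsilon> by (simp add: f_def potential_def)
    qed
    have pf: "jet_le m (min 1 \<epsilon>) C1 (pd b f) x" if "x \<in> convex hull X" "b \<in> Basis" for x b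
      unfolding f_def C1_def using that by (intro jet_le_pd_potential[OF e v \<epsilon> M je])
    have hD: "dist a x \<le> D" if "x \<in> convex hull X" "a \<in> X" for x a
    proof -
      have "convex hull X \<subseteq> cball a D" using XD that(2) by (intro hull_minimal) auto
      then show ?thesis using that(1) by auto
    qed
    have osc: "\<bar>f x - f a\<bar> \<le> ?d * C1 * D" if "x \<in> convex hull X" "a \<in> X" for x a
    proof -
      have "closed_segment a x \<subseteq> convex hull X"
        using that by (intro closed_segment_subset) (auto simp: hull_inc convex_convex_hull)
      then have "\<bar>f x - f a\<bar> \<le> ?d * C1 * norm (x - a)"
        using Ck_differentiable[OF cf] jet_le_abs[OF pf] by (intro mean_value_pd) auto
      also have "\<dots> \<le> ?d * C1 * D"
        using hD[OF that] C1 by (intro mult_left_mono) (auto simp: dist_norm norm_minus_commute)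
      finally show ?thesis .
    qed
    have val: "\<bar>f x\<bar> \<le> M + ?d * C1 * D" if "x \<in> convex hull X" for x
      using osc[OF that x1(1)] osc[OF that x2(1)] x1 x2 fu by fastforce
    (* On the unit scale the bound grows by the factor (max 1 (1 / \<epsilon>)) ^ m. *)
    have pf1: "jet_le m 1 (C1 * (1 + t)) (pd b f) x" if "x \<in> convex hull X" "b \<in> Basis" for x b
    proof -
      let ?\<rho> = "min 1 \<epsilon>"
      have "jet_le m ?\<rho> (C1 / ?\<rho> ^ m * ?\<rho> ^ m) (pd b f) x" using pf[OF that] \<epsilon> by simp
      then have "jet_le m 1 (C1 / ?\<rho> ^ m * 1 ^ m) (pd b f) x"
        using \<epsilon> by (intro jet_le_unit_scale[of m ?\<rho>]) auto
      moreover have "C1 / ?\<rho> ^ m * 1 ^ m \<le> C1 * (1 + t)"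
      proof (cases "\<epsilon> \<le> 1")
        case True
        then have "C1 / ?\<rho> ^ m * 1 ^ m = C1 * t" by (simp add: t_def power_one_over divide_inverse power_inverse)
        also have "\<dots> \<le> C1 * (1 + t)" using C1 by (intro mult_left_mono) auto
        finally show ?thesis .
      next
        case False
        then have "C1 / ?\<rho> ^ m * 1 ^ m = C1 * 1" by simp
        also have "\<dots> \<le> C1 * (1 + t)" using C1 t by (intro mult_left_mono) auto
        finally show ?thesis .
      qed
      ultimately show ?thesis using jet_le_mono zero_less_one by blast
    qed
    define B where "B = (M + ?d * C1 * D + C1) * (1 + t)"
    have nn: "0 \<le> M + ?d * C1 * D" using M C1 D by simp
    have "jet_le (Suc m) 1 B f x" if x: "x \<in> convex hull X" for x
    proof -
      have "(M + ?d * C1 * D) * 1 \<le> (M + ?d * C1 * D + C1) * (1 + t)"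
        using nn C1 t by (intro mult_mono) auto
      then have "\<bar>f x\<bar> \<le> B" using val[OF x] by (simp add: B_def)
      moreover have "C1 * (1 + t) \<le> B" unfolding B_def using nn t by (intro mult_right_mono) auto
      ultimately show ?thesis using pf1[OF x] jet_le_mono[of m 1 "C1 * (1 + t)" _ x B] by simp
    qed
    then obtain F x0 where F: "Ck (Suc m) F" "\<And>x. x \<in> X \<Longrightarrow> F x = f x" "\<And>x. x \<notin> cball x0 R \<Longrightarrow> F x = 0"
        "\<And>x. jet_le (Suc m) 1 (C2 * (B + 1)) F x"
      using ext[rule_format, OF X _ XD sf, of B] x1(1) by blast
    have "sobolev_norm (Suc m) F \<le> Q * (C2 * (B + 1))"
      unfolding Q_def using F C2 by (intro sobolev_norm_Ck_compact_support(2)) auto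
    also have "\<dots> \<le> C * (1 + t)"
    proof -
      have "B + 1 \<le> (M + ?d * C1 * D + C1 + 1) * (1 + t)"
        using t by (simp add: B_def algebra_simps)
      then have "Q * (C2 * (B + 1)) \<le> Q * (C2 * ((M + ?d * C1 * D + C1 + 1) * (1 + t)))"
        using Q C2 by (intro mult_left_mono) auto
      then show ?thesis by (simp add: C_def mult.assoc)
    qed
    finally have "sobolev_norm (Suc m) F \<le> C * (1 + t)" .
    moreover have "sobolev_extension (Suc m) X u F"
      unfolding sobolev_extension_def
      using sobolev_norm_Ck_compact_support(1)[OF F(1,3,4)] C2 Ck_continuous[OF F(1)] F(2) fu by simp
    ultimately show ?thesis by (auto simp: t_def)
  qed
  have C: "0 \<le> C" using Q C1 C2 M D by (simp add: C_def)
  show ?thesis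
    by (intro exI[of _ C] conjI allI impI, rule C, elim bexE, rule main) (assumption | blast)+
qed

section \<open>Partial derivatives of the cost in one variable\<close>

lemma pd_embedding:
  assumes "((\<lambda>x. \<iota> x) has_derivative i) (at x)" "c differentiable at (\<iota> x)"
  shows "pd b (\<lambda>x. c (\<iota> x)) x = pd (i b) c (\<iota> x)" "(\<lambda>x. c (\<iota> x)) differentiable at x"
proof -
  have "((\<lambda>x. c (\<iota> x)) has_derivative (\<lambda>h. frechet_derivative c (at (\<iota> x)) (i h))) (at x)"
    using has_derivative_compose[OF assms(1)] assms(2) frechet_derivative_works by blast
  from pd_eqI[OF this] this show "pd b (\<lambda>x. c (\<iota> x)) x = pd (i b) c (\<iota> x)" "(\<lambda>x. c (\<iota> x)) differentiable at x"
    by (auto simp: pd_def differentiable_def)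
qed

context
  fixes \<iota> :: "'a::euclidean_space \<Rightarrow> 'b::euclidean_space \<Rightarrow> 'c::euclidean_space" and i
  assumes d: "\<And>x y. ((\<lambda>x. \<iota> x y) has_derivative i) (at x)" and i: "\<And>b. b \<in> Basis \<Longrightarrow> i b \<in> Basis"
    and cont: "continuous_on UNIV (\<lambda>(x, y). \<iota> x y)"
begin

lemma Ck_family_embedding: "Ck n c \<Longrightarrow> Ck_family n S (\<lambda>x y. c (\<iota> x y))"
proof (induction n arbitrary: c)
  have k: "continuous_on (UNIV \<times> S) (\<lambda>(x, y). c (\<iota> x y))" if "continuous_on UNIV c" for c :: "'c \<Rightarrow> real"
    using continuous_on_compose2[OF that continuous_on_subset[OF cont, of "UNIV \<times> S"]]
    by (simp add: case_prod_beta)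
  {
    case 0
    then show ?case using k by (simp add: Ck_0)
  next
    case (Suc n)
    note p = pd_embedding[OF d Ck_differentiable[OF Suc.prems]]
    have "Ck_family n S (\<lambda>x y. pd b (\<lambda>x. c (\<iota> x y)) x)" if "b \<in> Basis" for b
      unfolding p(1) using Suc.IH[OF Ck_pd[OF Suc.prems i[OF that]]] .
    then show ?case using k[OF Ck_continuous[OF Suc.prems]] p(2) by simp
  }
qed

lemma jet_le_embedding: "Ck n c \<Longrightarrow> jet_le n \<rho> A c (\<iota> x y) \<Longrightarrow> jet_le n \<rho> A (\<lambda>x. c (\<iota> x y)) x"
proof (induction n arbitrary: c A)
  case (Suc n)
  have "pd b (\<lambda>x. c (\<iota> x y)) = (\<lambda>x. pd (i b) c (\<iota> x y))" for b
    using pd_embedding(1)[OF d Ck_differentiable[OF Suc.prems(1)]] by auto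
  then show ?case using Suc i by (auto simp: Ck_Suc)
qed simp

end

lemma iter_partial_le_deriv_sup_norm:
  assumes c: "smooth_fun c" and S: "compact S" and bs: "set bs \<subseteq> Basis" and z: "z \<in> S"
  shows "\<bar>iter_partial bs c z\<bar> \<le> deriv_sup_norm (length bs) S c"
proof -
  let ?L = "{bs'. set bs' \<subseteq> Basis \<and> length bs' = length bs} :: 'a list set"
  have "\<exists>B. \<forall>z\<in>S. \<bar>iter_partial bs' c z\<bar> \<le> B" if "set bs' \<subseteq> Basis" for bs'
  proof -
    have "continuous_on UNIV (iter_partial bs' c)"
      using Ck_continuous[OF Ck_iter_partial[OF smooth_fun_imp_Ck[OF c] that order_refl]] .
    then have "bounded (iter_partial bs' c ` S)"
      by (intro compact_imp_bounded compact_continuous_image S) (auto intro: continuous_on_subset)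
    then show ?thesis by (auto simp: bounded_iff)
  qed
  then obtain B where B: "\<And>bs' z. set bs' \<subseteq> Basis \<Longrightarrow> z \<in> S \<Longrightarrow> \<bar>iter_partial bs' c z\<bar> \<le> B bs'" by metis
  have fin: "finite ?L" using finite_lists_length_eq[OF finite_Basis] .
  have "bdd_above ((\<lambda>(bs, z). \<bar>iter_partial bs c z\<bar>) ` (?L \<times> S))"
  proof (rule bdd_aboveI2)
    fix p assume "p \<in> ?L \<times> S"
    then obtain bs' z where p: "p = (bs', z)" "bs' \<in> ?L" "z \<in> S" by auto
    have "\<bar>iter_partial bs' c z\<bar> \<le> B bs'" using B p by auto
    also have "\<dots> \<le> Max (B ` ?L)" using fin p by (intro Max_ge) auto
    finally show "(case p of (bs, z) \<Rightarrow> \<bar>iter_partial bs c z\<bar>) \<le> Max (B ` ?L)" by (simp add: p)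
  qed
  then show ?thesis
    unfolding deriv_sup_norm_def using cSUP_upper[of "(bs, z)" "?L \<times> S" "\<lambda>(bs, z). \<bar>iter_partial bs c z\<bar>"] bs z by simp
qed

section \<open>Uniform Sobolev bounds for the potentials\<close>

lemma jet_le_cost:
  assumes c: "smooth_fun c" and S: "compact S" and z: "z \<in> S"
    and M: "\<And>k. k \<le> s \<Longrightarrow> deriv_sup_norm k S c \<le> M"
  shows "jet_le s 1 M c z"
  unfolding jet_le_iff_iter_partial
  using iter_partial_le_deriv_sup_norm[OF c S _ z] M order_trans by blast

text \<open>At a zero \<open>x\<close> of \<open>u\<close>, the optimality condition says that the mean of
  \<open>exp ((v - c (x, \<cdot>)) / \<epsilon>)\<close> is \<open>1\<close>, so
  \<open>v - c (x, \<cdot>)\<close> is neither positive nor negative on all of \<open>Y\<close>. This bounds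
  \<open>v\<close> at two points by the size of \<open>c\<close> alone, so the bound for \<open>v\<close>
  does not involve the diameter of \<open>X\<close>.\<close>

lemma conjugate_potential_normalized:
  fixes v e :: "'b::euclidean_space \<Rightarrow> real"
  assumes "prob_measure_on Y \<beta>" "compact Y" and v: "continuous_on Y v" and e: "continuous_on Y e" and \<epsilon>: "0 < \<epsilon>"
    and one: "(LINT y|\<beta>. exp ((v y - e y) / \<epsilon>)) = 1" and M: "\<And>y. y \<in> Y \<Longrightarrow> \<bar>e y\<bar> \<le> M"
  shows "\<exists>y\<in>Y. v y \<le> M" "\<exists>y\<in>Y. - M \<le> v y"
proof -
  interpret compact_prob_space \<beta> Y using assms by (intro compact_prob_spaceI)
  have c: "continuous_on Y (\<lambda>y. exp ((v y - e y) / \<epsilon>))"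
    using \<epsilon> by (auto intro!: continuous_intros v e)
  show "\<exists>y\<in>Y. v y \<le> M"
  proof (rule ccontr)
    assume "\<not> ?thesis"
    then have "1 < exp ((v y - e y) / \<epsilon>)" if "y \<in> Y" for y
      using M[OF that] that \<epsilon> by (auto simp: not_le)
    from integral_greater[OF c this] one show False by simp
  qed
  show "\<exists>y\<in>Y. - M \<le> v y"
  proof (rule ccontr)
    assume "\<not> ?thesis"
    then have "exp ((v y - e y) / \<epsilon>) < 1" if "y \<in> Y" for y
      using M[OF that] that \<epsilon> by (auto simp: not_le divide_less_0_iff)
    from integral_less[OF c this] one show False by simp
  qed
qed

definition power_sum_poly :: "nat \<Rightarrow> real \<Rightarrow> real poly" where
  "power_sum_poly m C = (\<Sum>j\<le>m. monom C j)"

lemma coeff_power_sum_poly: "coeff (power_sum_poly m C) j = (if j \<le> m then C else 0)"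
  by (simp add: power_sum_poly_def coeff_sum coeff_monom if_distrib cong: if_cong)

lemma degree_power_sum_poly: "C \<noteq> 0 \<Longrightarrow> degree (power_sum_poly m C) = m"
  by (intro antisym degree_le le_degree) (auto simp: coeff_power_sum_poly)

lemma poly_power_sum_poly: "poly (power_sum_poly m C) t = C * (\<Sum>j\<le>m. t ^ j)"
  by (simp add: power_sum_poly_def poly_sum poly_monom sum_distrib_left)

text \<open>Both \<open>1\<close> and \<open>t ^ m\<close> occur in the power sum, and they coincide for
  \<open>m = 0\<close>, whence the factor \<open>2\<close>. Adding \<open>1\<close> keeps the coefficients
  positive even for \<open>C = 0\<close>.\<close>

lemma one_plus_power_le_power_sum_poly:
  assumes "0 \<le> C" "0 \<le> t"
  shows "C * (1 + t ^ m) \<le> poly (power_sum_poly m (2 * C + 1)) t"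
proof -
  have "t ^ i \<le> (\<Sum>j\<le>m. t ^ j)" if "i \<le> m" for i
    using that assms by (intro member_le_sum) auto
  from this[of 0] this[of m] have "1 + t ^ m \<le> 2 * (\<Sum>j\<le>m. t ^ j)" by simp
  then have "C * (1 + t ^ m) \<le> C * (2 * (\<Sum>j\<le>m. t ^ j))" using assms by (intro mult_left_mono)
  also have "\<dots> \<le> (2 * C + 1) * (\<Sum>j\<le>m. t ^ j)"
    using assms sum_nonneg[of "{..m}" "\<lambda>j. t ^ j"] by (simp add: algebra_simps)
  finally show ?thesis by (simp add: poly_power_sum_poly)
qed

lemma sobolev_norm_nonneg: "0 \<le> sobolev_norm s U"
  unfolding sobolev_norm_def sobolev_inner_def
  by (intro real_sqrt_ge_zero sum_nonneg integral_nonneg) (simp add: zero_le_mult_iff linorder_linear)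

lemma bigo_of_power_sum_bound:
  assumes "\<And>\<epsilon>. 0 < \<epsilon> \<Longrightarrow> 0 \<le> N \<epsilon>" "\<And>\<epsilon>. 0 < \<epsilon> \<Longrightarrow> N \<epsilon> \<le> poly (power_sum_poly m C) (1 / \<epsilon>)" "0 \<le> C"
  shows "N \<in> O[at_top](\<lambda>\<epsilon>. 1)" "N \<in> O[at_right 0](\<lambda>\<epsilon>. 1 / \<epsilon> ^ m)"
proof -
  show "N \<in> O[at_top](\<lambda>\<epsilon>. 1)"
  proof (rule bigoI[where c="C * (\<Sum>j\<le>m. 1)"])
    show "\<forall>\<^sub>F \<epsilon> in at_top. norm (N \<epsilon>) \<le> C * (\<Sum>j\<le>m. 1) * norm (1::real)"
      using eventually_ge_at_top[of 1]
    proof eventually_elim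
      case (elim \<epsilon>)
      then have "N \<epsilon> \<le> C * (\<Sum>j\<le>m. (1 / \<epsilon>) ^ j)" using assms(2)[of \<epsilon>] by (simp add: poly_power_sum_poly)
      also have "\<dots> \<le> C * (\<Sum>j\<le>m. 1)"
        using elim assms(3) by (intro mult_left_mono sum_mono power_le_one) auto
      finally show ?case using elim assms(1)[of \<epsilon>] by simp
    qed
  qed
  show "N \<in> O[at_right 0](\<lambda>\<epsilon>. 1 / \<epsilon> ^ m)"
  proof (rule bigoI[where c="C * (\<Sum>j\<le>m. 1)"])
    have "\<forall>\<^sub>F \<epsilon> in at_right 0. \<epsilon> \<in> {0<..<1::real}"
      by (rule eventually_at_right_real) simp
    then show "\<forall>\<^sub>F \<epsilon> in at_right 0. norm (N \<epsilon>) \<le> C * (\<Sum>j\<le>m. 1) * norm (1 / \<epsilon> ^ m)"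
    proof eventually_elim
      case (elim \<epsilon>)
      then have e: "0 < \<epsilon>" "\<epsilon> < 1" by auto
      then have "N \<epsilon> \<le> C * (\<Sum>j\<le>m. (1 / \<epsilon>) ^ j)" using assms(2)[of \<epsilon>] by (simp add: poly_power_sum_poly)
      also have "\<dots> \<le> C * (\<Sum>j\<le>m. (1 / \<epsilon>) ^ m)"
        using e assms(3) by (intro mult_left_mono sum_mono power_increasing) auto
      finally show ?case using e assms(1)[of \<epsilon>] by (simp add: power_one_over)
    qed
  qed
qed

theorem theorem2:
  fixes s :: nat
  assumes "1 \<le> s"
  shows "\<exists>P :: real \<Rightarrow> real list \<Rightarrow> real poly.
    (\<forall>D ns. degree (P D ns) = s - 1 \<and> (\<forall>j\<le>s - 1. 0 < coeff (P D ns) j)) \<and>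
    (\<forall>(X :: (real ^ 'n) set) (Y :: (real ^ 'n) set) (c :: (real ^ 'n) \<times> (real ^ 'n) \<Rightarrow> real).
      compact X \<longrightarrow> compact Y \<longrightarrow> smooth_fun c \<longrightarrow>
      (\<forall>\<epsilon> \<alpha> \<beta> u v.
        0 < \<epsilon> \<longrightarrow> prob_measure_on X \<alpha> \<longrightarrow> prob_measure_on Y \<beta> \<longrightarrow>
        normalized_potentials X Y c \<epsilon> \<alpha> \<beta> u v \<longrightarrow>
        (\<exists>U. sobolev_extension s X u U \<and>
             sobolev_norm s U \<le> poly (P (diameter X) (cost_norms s X Y c)) (1 / \<epsilon>)) \<and>
        (\<exists>V. sobolev_extension s Y v V \<and>
             sobolev_norm s V \<le> poly (P (diameter Y) (cost_norms s X Y c)) (1 / \<epsilon>))) \<and>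
      (\<forall>\<alpha> \<beta> u v.
        (\<forall>\<epsilon>>0. prob_measure_on X (\<alpha> \<epsilon>) \<and> prob_measure_on Y (\<beta> \<epsilon>) \<and>
                normalized_potentials X Y c \<epsilon> (\<alpha> \<epsilon>) (\<beta> \<epsilon>) (u \<epsilon>) (v \<epsilon>)) \<longrightarrow>
        (\<exists>U. (\<forall>\<epsilon>>0. sobolev_extension s X (u \<epsilon>) (U \<epsilon>) \<and>
                sobolev_norm s (U \<epsilon>) \<le> poly (P (diameter X) (cost_norms s X Y c)) (1 / \<epsilon>)) \<and>
             (\<lambda>\<epsilon>. sobolev_norm s (U \<epsilon>)) \<in> O[at_top](\<lambda>\<epsilon>. 1) \<and>
             (\<lambda>\<epsilon>. sobolev_norm s (U \<epsilon>)) \<in> O[at_right 0](\<lambda>\<epsilon>. 1 / \<epsilon> ^ (s - 1)))))"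
proof -
  obtain m where s: "s = Suc m" using assms by (cases s) auto
  let ?half = "\<lambda>C D M. \<forall>(X :: (real ^ 'n) set) (Y :: (real ^ 'n) set) e \<beta> v \<epsilon> u.
    compact X \<longrightarrow> compact Y \<longrightarrow> (\<forall>x\<in>X. \<forall>y\<in>X. dist x y \<le> D) \<longrightarrow> prob_measure_on Y \<beta> \<longrightarrow>
    continuous_on Y v \<longrightarrow> (\<forall>n. Ck_family n Y e) \<longrightarrow>
    (\<forall>x\<in>convex hull X. \<forall>y\<in>Y. jet_le (Suc m) 1 M (\<lambda>x. e x y) x) \<longrightarrow> 0 < \<epsilon> \<longrightarrow>
    (\<forall>x\<in>X. exp (- u x / \<epsilon>) = (LINT y|\<beta>. exp ((v y - e x y) / \<epsilon>))) \<longrightarrow>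
    (\<exists>x\<in>X. u x \<le> M) \<longrightarrow> (\<exists>x\<in>X. - M \<le> u x) \<longrightarrow>
    (\<exists>U. sobolev_extension (Suc m) X u U \<and> sobolev_norm (Suc m) U \<le> C * (1 + (1 / \<epsilon>) ^ m))"
  define good where "good C D M \<longleftrightarrow> 0 \<le> C \<and> (0 \<le> D \<longrightarrow> 0 \<le> M \<longrightarrow> ?half C D M)" for C D M :: real
  have "\<exists>C. good C D M" for D M
  proof (cases "0 \<le> D \<and> 0 \<le> M")
    case True
    with potential_extension[of D M, where 'a="real ^ 'n" and 'b="real ^ 'n" and m=m]
    show ?thesis unfolding good_def by blast
  qed (auto simp: good_def)
  then have "good (SOME C. good C D M) D M" for D M by (rule someI_ex)
  moreover define C where "C D M = (SOME C. good C D M)" for D M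
  ultimately have good: "good (C D M) D M" for D M by simp
  have C: "0 \<le> C D M" for D M using good[of D M] by (simp add: good_def)
  have half: "0 \<le> D \<Longrightarrow> 0 \<le> M \<Longrightarrow> ?half (C D M) D M" for D M using good[of D M] unfolding good_def by blast
  (* A single number that dominates all sup norms in the list is enough for the constant. *)
  define mx where "mx ns = Max (insert 0 (set ns))" for ns :: "real list"
  define P where "P D ns = power_sum_poly m (2 * C D (mx ns) + 1)" for D ns
  have P: "degree (P D ns) = s - 1 \<and> (\<forall>j\<le>s - 1. 0 < coeff (P D ns) j)" for D ns
    using C[of D "mx ns"] by (simp add: P_def s degree_power_sum_poly coeff_power_sum_poly)
  have bound: "(\<exists>U. sobolev_extension s X u U \<and>
             sobolev_norm s U \<le> poly (P (diameter X) (cost_norms s X Y c)) (1 / \<epsilon>)) \<and>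
        (\<exists>V. sobolev_extension s Y v V \<and>
             sobolev_norm s V \<le> poly (P (diameter Y) (cost_norms s X Y c)) (1 / \<epsilon>))"
    if X: "compact X" and Y: "compact Y" and c: "smooth_fun c" and \<epsilon>: "0 < \<epsilon>"
      and \<alpha>: "prob_measure_on X \<alpha>" and \<beta>: "prob_measure_on Y \<beta>"
      and uv: "normalized_potentials X Y c \<epsilon> \<alpha> \<beta> u v"
    for X Y :: "(real ^ 'n) set" and c \<epsilon> \<alpha> \<beta> u v
  proof -
    define M where "M = mx (cost_norms s X Y c)"
    let ?S = "(convex hull X) \<times> (convex hull Y)"
    have M0: "0 \<le> M" by (simp add: M_def mx_def)
    have S: "compact ?S" using X Y by (intro compact_Times compact_convex_hull)
    have MS: "deriv_sup_norm k ?S c \<le> M" if "k \<le> s" for k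
      unfolding M_def mx_def cost_norms_def using that by (intro Max_ge) (auto simp del: upt_Suc)
    have jc: "jet_le s 1 M c (x, y)" if "x \<in> convex hull X" "y \<in> convex hull Y" for x y
      using that MS by (intro jet_le_cost[OF c S]) auto
    have Cc: "Ck n c" for n using c by (rule smooth_fun_imp_Ck)
    have hull: "x \<in> X \<Longrightarrow> x \<in> convex hull X" "y \<in> Y \<Longrightarrow> y \<in> convex hull Y" for x y
      by (simp_all add: hull_inc)
    have uv': "continuous_on X u" "continuous_on Y v"
      "\<And>x. x \<in> X \<Longrightarrow> exp (- u x / \<epsilon>) = (LINT y|\<beta>. exp ((v y - c (x, y)) / \<epsilon>))"
      "\<And>y. y \<in> Y \<Longrightarrow> exp (- v y / \<epsilon>) = (LINT x|\<alpha>. exp ((u x - c (x, y)) / \<epsilon>))"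
      using uv by (auto simp: normalized_potentials_def sinkhorn_potentials_def)
    obtain x0 where x0: "x0 \<in> X" "u x0 = 0" using uv by (auto simp: normalized_potentials_def)
    have d1: "((\<lambda>x. (x, y)) has_derivative (\<lambda>h. (h, 0))) (at x)" for x y :: "real ^ 'n"
      by (auto intro!: derivative_eq_intros)
    have d2: "((\<lambda>y. (x, y)) has_derivative (\<lambda>h. (0, h))) (at y)" for x y :: "real ^ 'n"
      by (auto intro!: derivative_eq_intros)
    have k1: "continuous_on UNIV (\<lambda>(x, y). (x, y) :: (real ^ 'n) \<times> (real ^ 'n))"
      "continuous_on UNIV (\<lambda>(y, x). (x, y) :: (real ^ 'n) \<times> (real ^ 'n))"
      by (auto simp: case_prod_beta intro!: continuous_intros)
    have b1: "b \<in> Basis \<Longrightarrow> (b, 0 :: real ^ 'n) \<in> Basis" "b \<in> Basis \<Longrightarrow> (0 :: real ^ 'n, b) \<in> Basis"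
      for b :: "real ^ 'n" by (auto simp: Basis_prod_def)
    note f1 = Ck_family_embedding[where \<iota>="\<lambda>x y. (x, y)", OF d1 b1(1) k1(1) Cc]
    note f2 = Ck_family_embedding[where \<iota>="\<lambda>y x. (x, y)", OF d2 b1(2) k1(2) Cc]
    note j1 = jet_le_embedding[where \<iota>="\<lambda>x y. (x, y)", OF d1 b1(1) k1(1) Cc]
    note j2 = jet_le_embedding[where \<iota>="\<lambda>y x. (x, y)", OF d2 b1(2) k1(2) Cc]
    have diam: "0 \<le> diameter Z \<and> (\<forall>x\<in>Z. \<forall>y\<in>Z. dist x y \<le> diameter Z)" if "compact Z" for Z :: "(real ^ 'n) set"
      using that diameter_bounded_bound[OF compact_imp_bounded[OF that]] diameter_ge_0[OF compact_imp_bounded[OF that]]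
      by blast
    have toP: "C D M * (1 + (1 / \<epsilon>) ^ m) \<le> poly (P D (cost_norms s X Y c)) (1 / \<epsilon>)" for D
      unfolding P_def M_def using C \<epsilon> by (intro one_plus_power_le_power_sum_poly) auto
    have "\<exists>U. sobolev_extension (Suc m) X u U \<and> sobolev_norm (Suc m) U \<le> C (diameter X) M * (1 + (1 / \<epsilon>) ^ m)"
    proof (rule half[rule_format, where e="\<lambda>x y. c (x, y)"])
      show "Ck_family n Y (\<lambda>x y. c (x, y))" for n by (rule f1)
      show "jet_le (Suc m) 1 M (\<lambda>x. c (x, y)) x" if "x \<in> convex hull X" "y \<in> Y" for x y
        using jc[OF that(1) hull(2)[OF that(2)]] unfolding s by (rule j1[rotated])
      show "\<exists>x\<in>X. u x \<le> M" "\<exists>x\<in>X. - M \<le> u x" using x0 M0 by force+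
    qed (use X Y diam \<beta> uv' \<epsilon> M0 in auto)
    moreover have "\<exists>V. sobolev_extension (Suc m) Y v V \<and> sobolev_norm (Suc m) V \<le> C (diameter Y) M * (1 + (1 / \<epsilon>) ^ m)"
    proof (rule half[rule_format, where e="\<lambda>y x. c (x, y)"])
      show "Ck_family n X (\<lambda>y x. c (x, y))" for n by (rule f2)
      show "jet_le (Suc m) 1 M (\<lambda>y. c (x, y)) y" if "y \<in> convex hull Y" "x \<in> X" for x y
        using jc[OF hull(1)[OF that(2)] that(1)] unfolding s by (rule j2[rotated])
      have "continuous_on Y (\<lambda>y. c (x0, y))"
        by (rule continuous_on_compose2[OF Ck_continuous[OF Cc[of 0]]]) (auto intro!: continuous_intros)
      moreover have "\<bar>c (x0, y)\<bar> \<le> M" if "y \<in> Y" for y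
        using jc[OF hull(1)[OF x0(1)] hull(2)[OF that]] by (rule jet_le_abs)
      moreover have "(LINT y|\<beta>. exp ((v y - c (x0, y)) / \<epsilon>)) = 1"
        using uv'(3)[OF x0(1)] x0(2) by simp
      ultimately show "\<exists>y\<in>Y. v y \<le> M" "\<exists>y\<in>Y. - M \<le> v y"
        using conjugate_potential_normalized[OF \<beta> Y uv'(2) _ \<epsilon>] by blast+
    qed (use X Y diam \<alpha> uv' \<epsilon> M0 in auto)
    ultimately show ?thesis unfolding s[symmetric] using toP order_trans by blast
  qed
  have asymptotics: "\<exists>U. (\<forall>\<epsilon>>0. sobolev_extension s X (u \<epsilon>) (U \<epsilon>) \<and>
                sobolev_norm s (U \<epsilon>) \<le> poly (P (diameter X) (cost_norms s X Y c)) (1 / \<epsilon>)) \<and>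
             (\<lambda>\<epsilon>. sobolev_norm s (U \<epsilon>)) \<in> O[at_top](\<lambda>\<epsilon>. 1) \<and>
             (\<lambda>\<epsilon>. sobolev_norm s (U \<epsilon>)) \<in> O[at_right 0](\<lambda>\<epsilon>. 1 / \<epsilon> ^ (s - 1))"
    if X: "compact X" and Y: "compact Y" and c: "smooth_fun c"
      and *: "\<forall>\<epsilon>>0. prob_measure_on X (\<alpha> \<epsilon>) \<and> prob_measure_on Y (\<beta> \<epsilon>) \<and>
                normalized_potentials X Y c \<epsilon> (\<alpha> \<epsilon>) (\<beta> \<epsilon>) (u \<epsilon>) (v \<epsilon>)"
    for X Y :: "(real ^ 'n) set" and c \<alpha> \<beta> u v
  proof -
    have "\<forall>\<epsilon>>0. \<exists>U. sobolev_extension s X (u \<epsilon>) U \<and>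
             sobolev_norm s U \<le> poly (P (diameter X) (cost_norms s X Y c)) (1 / \<epsilon>)"
      using bound[OF X Y c] * by blast
    then obtain U where U: "\<And>\<epsilon>. 0 < \<epsilon> \<Longrightarrow> sobolev_extension s X (u \<epsilon>) (U \<epsilon>) \<and>
             sobolev_norm s (U \<epsilon>) \<le> poly (P (diameter X) (cost_norms s X Y c)) (1 / \<epsilon>)"
      by metis
    then have "\<And>\<epsilon>. 0 < \<epsilon> \<Longrightarrow> sobolev_norm s (U \<epsilon>)
        \<le> poly (power_sum_poly m (2 * C (diameter X) (mx (cost_norms s X Y c)) + 1)) (1 / \<epsilon>)"
      by (simp add: P_def)
    from bigo_of_power_sum_bound[of "\<lambda>\<epsilon>. sobolev_norm s (U \<epsilon>)", OF sobolev_norm_nonneg this]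
    have "(\<lambda>\<epsilon>. sobolev_norm s (U \<epsilon>)) \<in> O[at_top](\<lambda>\<epsilon>. 1)"
      "(\<lambda>\<epsilon>. sobolev_norm s (U \<epsilon>)) \<in> O[at_right 0](\<lambda>\<epsilon>. 1 / \<epsilon> ^ (s - 1))"
      using C by (simp_all add: s)
    then show ?thesis using U by blast
  qed
  show ?thesis
    by (intro exI[of _ P] conjI allI impI)
      ((simp add: P; fail) | (rule bound[THEN conjunct1]; assumption) |
       (rule bound[THEN conjunct2]; assumption) | (rule asymptotics; assumption))+
qed

end
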